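(* Let $(X,d)$ be a (nonempty) compact metric space, $\alpha:X\to X$ a continuous map that is open and non-contracting on $X_\alpha$ (i.e. the restriction $\alpha:X_\alpha\to X_\alpha$ is an open non-contracting map) and a finite-sheeted cover on $X_\alpha$ (i.e. $\sup_{x\in X_\alpha}|\alpha^{-1}(x)\cap X_\alpha|<\infty$), and let $A:C(X)\to C(X)$ be an $X_\alpha$-compatible transfer operator for $(X,\alpha)$ with cocycle $\rho$. Then for every $\mu\in M_\alpha(X)$ $$\tau(\mu)=\int_{X_\alpha}\ln\rho\,d\mu+\bar h_\alpha(\mu).$$
   Context: A transfer operator for $(X,\alpha)$ is a positive linear operator $A:C(X)\to C(X)$ with $A((f\circ\alpha)g)=f\,Ag$ for all $f,g\in C(X)$. $M_\alpha(X)$ is the set of Borel $\alpha$-invariant probability measures on $X$ with the weak-$*$ topology; $\mu[f]=\int f\,d\mu$; $h_\alpha(\mu)$ is the Kolmogorov–Sinai (metric) entropy, and $\bar h_\alpha(\mu):=\limsup_{\nu\to\mu}h_\alpha(\nu)$ is its upper semicontinuous closure, i.e. the infimum over weak-$*$ neighborhoods $U$ of $\mu$ in $M_\alpha(X)$ of $\sup_{\nu\in U}h_\alpha(\nu)$. Convention $\ln0=-\infty$; integrals of logarithms take values in $[-\infty,\infty)$. A point $x\in X$ is essential if every neighborhood $V$ of $x$ satisfies $\mu(V)>0$ for some $\mu\in M_\alpha(X)$; $X_\alpha$ is the (closed) set of essential points; $\alpha(X_\alpha)=X_\alpha$ and every $\mu\in M_\alpha(X)$ is supported in $X_\alpha$.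 For $x\in X_\alpha$ put $\tilde\alpha^{-1}(x):=\alpha^{-1}(x)\cap X_\alpha$. A map $\alpha$ of a metric space into itself is non-contracting if there is $r>0$ such that $d(x,y)\le r$ implies $d(\alpha(x),\alpha(y))\ge d(x,y)$. Compatibility and cocycle: for $x\in X$ let $\nu_x$ be the regular Borel measure (possibly $0$) with $\int f\,d\nu_x=[Af](x)$ for $f\in C(X)$; its support lies in $\alpha^{-1}(x)$. $A$ is $X_\alpha$-compatible if for every $f\in C(X_\alpha)$ the function $x\mapsto\int_{X_\alpha}f\,d\nu_x$ is continuous on $X_\alpha$; then $[A_{X_\alpha}f](x):=\int_{X_\alpha}f\,d\nu_x$ defines a transfer operator on $C(X_\alpha)$. It has the form $[A_{X_\alpha}f](x)=\sum_{y\in\tilde\alpha^{-1}(x)}\rho(y)f(y)$, where $\rho(y)=\nu_{\alpha(y)}(\{y\})\ge0$, $y\in X_\alpha$; $\rho$ is called the cocycle. $t$-entropy: for $\mu\in M_\alpha(X)$, $$\tau(\mu):=\inf_{n\in\mathbb N}\frac1n\inf_G\sum_{g\in G}\mu[g]\ln\frac{\mu[A^ng]}{\mu[g]},$$ where $G$ runs over all (finite) continuous partitions of unity in $C(X)$ by nonnegative functions and a summand with $\mu[g]=0$ is set equal to $0$. *)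

theory Defs
  imports "HOL-Probability.Probability"
begin

text \<open>
  The compact metric space \<open>X\<close> is the universe of a type \<open>'a::metric_space\<close>; its
  compactness is a hypothesis of the theorem, not of the definitions. \<open>C(X)\<close> is the space of
  real-valued continuous functions, and an operator on \<open>C(X)\<close> is a map on all functions whose
  values outside \<open>C(X)\<close> are never used.
\<close>

definition CX :: "('a::metric_space \<Rightarrow> real) set" where
  "CX = {f. continuous_on UNIV f}"

definition transfer_operator ::
  "('a::metric_space \<Rightarrow> 'a) \<Rightarrow> (('a \<Rightarrow> real) \<Rightarrow> ('a \<Rightarrow> real)) \<Rightarrow> bool" where
  "transfer_operator \<alpha> A \<longleftrightarrow>
     (\<forall>f\<in>CX. A f \<in> CX) \<and>
     (\<forall>f\<in>CX. \<forall>g\<in>CX. A (\<lambda>x. f x + g x) = (\<lambda>x. A f x + A g x)) \<and>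
     (\<forall>c. \<forall>f\<in>CX. A (\<lambda>x. c * f x) = (\<lambda>x. c * A f x)) \<and>
     (\<forall>f\<in>CX. (\<forall>x. 0 \<le> f x) \<longrightarrow> (\<forall>x. 0 \<le> A f x)) \<and>
     (\<forall>f\<in>CX. \<forall>g\<in>CX. A (\<lambda>x. f (\<alpha> x) * g x) = (\<lambda>x. f x * A g x))"

definition invariant_measures :: "('a::metric_space \<Rightarrow> 'a) \<Rightarrow> 'a measure set" where
  "invariant_measures \<alpha> = {\<mu>. sets \<mu> = sets borel \<and> prob_space \<mu> \<and> distr \<mu> borel \<alpha> = \<mu>}"

text \<open>The coarsest topology making all evaluations \<open>\<mu> \<mapsto> \<mu>[f]\<close>, \<open>f \<in> C(X)\<close>, continuous.\<close>

definition weak_star :: "('a::metric_space \<Rightarrow> 'a) \<Rightarrow> 'a measure topology" where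
  "weak_star \<alpha> =
     pullback_topology (invariant_measures \<alpha>) (\<lambda>\<mu>. \<lambda>f\<in>CX. integral\<^sup>L \<mu> f) (powertop_real CX)"

definition essential_set :: "('a::metric_space \<Rightarrow> 'a) \<Rightarrow> 'a set" where
  "essential_set \<alpha> =
     {x. \<forall>V. open V \<and> x \<in> V \<longrightarrow> (\<exists>\<mu>\<in>invariant_measures \<alpha>. measure \<mu> V > 0)}"

definition non_contracting_on :: "'a::metric_space set \<Rightarrow> ('a \<Rightarrow> 'a) \<Rightarrow> bool" where
  "non_contracting_on S \<alpha> \<longleftrightarrow>
     (\<exists>r>0. \<forall>x\<in>S. \<forall>y\<in>S. dist x y \<le> r \<longrightarrow> dist (\<alpha> x) (\<alpha> y) \<ge> dist x y)"

definition finite_sheeted_on :: "'a set \<Rightarrow> ('a \<Rightarrow> 'a) \<Rightarrow> bool" where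
  "finite_sheeted_on S \<alpha> \<longleftrightarrow>
     (\<exists>N. \<forall>x\<in>S. finite (\<alpha> -` {x} \<inter> S) \<and> card (\<alpha> -` {x} \<inter> S) \<le> N)"

text \<open>
  The representing measure \<open>\<nu>\<^sub>x\<close>: for compact \<open>X\<close> and a positive linear \<open>A\<close> it exists and is
  unique by the Riesz representation theorem. Regularity is not stated since every finite
  Borel measure on a metric space is (closed, hence for compact \<open>X\<close> inner) regular.
  Finiteness is stated since the Bochner integral of a non-integrable function is \<open>0\<close>.
\<close>

definition rep_measure ::
  "(('a::metric_space \<Rightarrow> real) \<Rightarrow> ('a \<Rightarrow> real)) \<Rightarrow> 'a \<Rightarrow> 'a measure" where
  "rep_measure A x =
     (THE \<nu>. sets \<nu> = sets borel \<and> finite_measure \<nu> \<and> (\<forall>f\<in>CX. integral\<^sup>L \<nu> f = A f x))"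

definition compatible_on ::
  "'a::metric_space set \<Rightarrow> (('a \<Rightarrow> real) \<Rightarrow> ('a \<Rightarrow> real)) \<Rightarrow> bool" where
  "compatible_on S A \<longleftrightarrow>
     (\<forall>f :: 'a \<Rightarrow> real. continuous_on S f \<longrightarrow>
        continuous_on S (\<lambda>x. set_lebesgue_integral (rep_measure A x) S f))"

definition cocycle ::
  "('a::metric_space \<Rightarrow> 'a) \<Rightarrow> (('a \<Rightarrow> real) \<Rightarrow> ('a \<Rightarrow> real)) \<Rightarrow> 'a \<Rightarrow> real" where
  "cocycle \<alpha> A y = measure (rep_measure A (\<alpha> y)) {y}"

text \<open>Logarithm of a nonnegative real with \<open>ln 0 = -\<infinity>\<close> (the library has \<open>ln 0 = 0\<close>).\<close>

definition eln :: "real \<Rightarrow> ereal" where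
  "eln x = (if x \<le> 0 then -\<infinity> else ereal (ln x))"

text \<open>
  Integral of an extended-real function as integral of the positive part minus integral of the
  negative part (\<open>e2ennreal\<close> truncates negative values to \<open>0\<close>); meaningful whenever one of the
  two is finite, as is the case for functions bounded above.
\<close>

definition set_ereal_integral :: "'a measure \<Rightarrow> 'a set \<Rightarrow> ('a \<Rightarrow> ereal) \<Rightarrow> ereal" where
  "set_ereal_integral M S f =
     enn2ereal (\<integral>\<^sup>+x. e2ennreal (f x) * indicator S x \<partial>M)
     - enn2ereal (\<integral>\<^sup>+x. e2ennreal (- f x) * indicator S x \<partial>M)"

definition borel_partitions :: "'a::metric_space set set set" where
  "borel_partitions = {P. finite P \<and> partition_on UNIV P \<and> P \<subseteq> sets borel}"

text \<open>The library convention \<open>ln 0 = 0\<close> gives \<open>0 ln 0 = 0\<close>.\<close>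

definition partition_entropy :: "'a measure \<Rightarrow> 'a set set \<Rightarrow> real" where
  "partition_entropy \<mu> P = - (\<Sum>E\<in>P. measure \<mu> E * ln (measure \<mu> E))"

text \<open>The common refinement of \<open>P\<close>, \<open>\<alpha>\<^sup>-\<^sup>1P\<close> up to \<open>\<alpha>\<^sup>-\<^sup>n\<^sup>+\<^sup>1P\<close>.\<close>

definition dyn_refinement :: "('a \<Rightarrow> 'a) \<Rightarrow> 'a set set \<Rightarrow> nat \<Rightarrow> 'a set set" where
  "dyn_refinement \<alpha> P n =
     (\<lambda>s. \<Inter>i<n. (\<alpha> ^^ i) -` s i) ` ({..<n} \<rightarrow>\<^sub>E P) - {{}}"

definition KS_entropy :: "('a::metric_space \<Rightarrow> 'a) \<Rightarrow> 'a measure \<Rightarrow> ereal" where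
  "KS_entropy \<alpha> \<mu> =
     (SUP P\<in>borel_partitions.
        ereal (lim (\<lambda>n. partition_entropy \<mu> (dyn_refinement \<alpha> P n) / real n)))"

definition usc_entropy :: "('a::metric_space \<Rightarrow> 'a) \<Rightarrow> 'a measure \<Rightarrow> ereal" where
  "usc_entropy \<alpha> \<mu> =
     (INF U\<in>{U. openin (weak_star \<alpha>) U \<and> \<mu> \<in> U}. SUP \<nu>\<in>U. KS_entropy \<alpha> \<nu>)"

text \<open>
  Partitions of unity are taken as sets of functions. Admitting repeated members would not
  change the infimum below: replacing two equal members \<open>g\<close>, \<open>g\<close> by \<open>2g\<close> preserves the sum.
\<close>

definition partitions_of_unity :: "('a::metric_space \<Rightarrow> real) set set" where
  "partitions_of_unity =
     {G. finite G \<and> G \<subseteq> CX \<and> (\<forall>g\<in>G. \<forall>x. 0 \<le> g x) \<and> (\<forall>x. (\<Sum>g\<in>G. g x) = 1)}"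

definition t_entropy ::
  "(('a::metric_space \<Rightarrow> real) \<Rightarrow> ('a \<Rightarrow> real)) \<Rightarrow> 'a measure \<Rightarrow> ereal" where
  "t_entropy A \<mu> =
     (INF n\<in>{1::nat..}. ereal (1 / real n) *
        (INF G\<in>partitions_of_unity. \<Sum>g\<in>G.
           if integral\<^sup>L \<mu> g = 0 then 0
           else ereal (integral\<^sup>L \<mu> g) * eln (integral\<^sup>L \<mu> ((A ^^ n) g) / integral\<^sup>L \<mu> g)))"

end

(* For x in S = X_alpha write L f x for the sum of f over the fibre of x in S; since alpha is open
   and locally injective on S, L preserves continuity. For mu invariant let F(mu) be the infimum of
   mu[ln L f] - mu[ln f] over continuous f > 0 on S. Telescoping, n F(mu) <= mu[ln L^n f] - mu[ln f].

   h(mu) = F(mu). Lower bound: for a partition xi into small sets, take f = sum of mu(D) u_D over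
   the cells D of the n-th refinement, with bumps u_D = 1 on D on whose supports alpha^n is
   injective; then L^n f <= 1 and - mu[ln f] is at most the entropy of the refinement. Upper bound:
   inverse branches do not expand, so orbits of length n are shadowed by the points of
   alpha^-n of a finite net, and q = f / (L f o alpha), a probability on every fibre, gives
   weights for these points (Gibbs inequality). Since F is an infimum of weak-* continuous
   functions, h is upper semicontinuous.

   tau(mu) = mu[ln rho] + F(mu). Lower bound: given a partition of unity G, use
   f = rho_n sum_g (mu[g] / mu[A^n g]) g, where rho_n is the cocycle of A^n, and concavity of ln.
   Upper bound, with n = 1: exp(phi) = f / (L f o alpha) / (rho + e) on S satisfies
   L (rho exp(phi)) <= 1; extend phi to X, subtract k dist(., S) with k large, and partition X by
   tent functions of phi. *)

theory Submission
  imports Defs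
begin

section \<open>Riesz representation on compact metric spaces\<close>

text \<open>The measures \<open>rep_measure A x\<close> are definite descriptions, so the cocycle
  means something only after existence and uniqueness in the Riesz representation are settled. Three
  obstacles shape the rest. \<open>F\<close> ranges over strictly positive functions, so that
  logarithms are continuous, while the functions built from partitions can vanish; a constant
  \<theta> > 0 is added, which costs at most \<theta> N^n after n applications of L and tends to 0
  with n fixed. The cocycle can vanish too, and the integral of ln rho can be -\<infinity>: the
  upper bound for tau works with rho + e and lets e tend to 0 by monotone convergence, and the lower
  bound is needed only when the integral is finite, so that rho > 0 almost everywhere. Finally, A
  sees mass of nu_x off S, where invariant measures have none: for the lower bound it suffices that
  A^n dominates L^n applied to rho_n g, for the upper bound this mass has to be suppressed. All four
  estimates, two for h and two for tau, rest on \<open>ln t \<le> t - 1\<close>.\<close>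

lemma CX_intros:
  "(\<lambda>x. c) \<in> CX"
  "f \<in> CX \<Longrightarrow> g \<in> CX \<Longrightarrow> (\<lambda>x. f x + g x) \<in> CX"
  "f \<in> CX \<Longrightarrow> g \<in> CX \<Longrightarrow> (\<lambda>x. f x - g x) \<in> CX"
  "f \<in> CX \<Longrightarrow> g \<in> CX \<Longrightarrow> (\<lambda>x. f x * g x) \<in> CX"
  "f \<in> CX \<Longrightarrow> g \<in> CX \<Longrightarrow> (\<lambda>x. max (f x) (g x)) \<in> CX"
  "f \<in> CX \<Longrightarrow> g \<in> CX \<Longrightarrow> (\<lambda>x. min (f x) (g x)) \<in> CX"
  "f \<in> CX \<Longrightarrow> (\<lambda>x. - f x) \<in> CX"
  "f \<in> CX \<Longrightarrow> (\<lambda>x. exp (f x)) \<in> CX"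
  "(\<lambda>x. infdist x S) \<in> CX"
  by (auto simp: CX_def intro!: continuous_intros)

lemma CX_sum: "(\<And>i. i \<in> I \<Longrightarrow> f i \<in> CX) \<Longrightarrow> (\<lambda>x. \<Sum>i\<in>I. f i x) \<in> CX"
  by (auto simp: CX_def intro!: continuous_intros)

lemma CX_bounded:
  assumes "compact (UNIV :: 'a::metric_space set)" and "f \<in> (CX :: ('a \<Rightarrow> real) set)"
  obtains B where "\<And>x. \<bar>f x\<bar> \<le> B"
proof -
  have "compact (f ` UNIV)"
    using assms by (intro compact_continuous_image) (auto simp: CX_def)
  then have "bounded (range f)" by (rule compact_imp_bounded)
  then obtain B where "\<forall>y\<in>range f. norm y \<le> B" by (auto simp: bounded_iff)
  then show ?thesis by (intro that[of B]) auto
qed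

lemma Dini_at_top:
  fixes s :: "nat \<Rightarrow> 'a::metric_space \<Rightarrow> real"
  assumes X: "compact (UNIV :: 'a set)" and s: "\<And>n. s n \<in> CX" and v: "v \<in> CX"
    and mono: "\<And>n x. s n x \<le> s (Suc n) x" and lim: "\<And>x. (\<lambda>n. s n x) \<longlonglongrightarrow> v x"
    and e: "0 < e"
  shows "\<exists>n. \<forall>x. v x - s n x < e"
proof -
  define U where "U n = {x. v x - s n x < e}" for n
  have inc: "incseq (\<lambda>n. s n x)" for x using mono by (simp add: incseq_SucI)
  have op: "open (U n)" for n
    unfolding U_def using s[of n] v
    by (intro open_Collect_less) (auto simp: CX_def intro!: continuous_intros)
  have cov: "UNIV \<subseteq> (\<Union>n\<in>UNIV. U n)"
  proof
    fix x
    have "eventually (\<lambda>n. dist (s n x) (v x) < e) sequentially"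
      using lim[of x] e by (simp add: tendsto_iff)
    then obtain n where "dist (s n x) (v x) < e" by (auto simp: eventually_sequentially)
    then show "x \<in> (\<Union>n\<in>UNIV. U n)" by (auto simp: U_def dist_real_def abs_less_iff intro: exI[of _ n])
  qed
  obtain C where C: "finite C" "UNIV \<subseteq> (\<Union>n\<in>C. U n)"
    using compactE_image[OF X, of UNIV U] op cov by auto
  show ?thesis
  proof (intro exI allI)
    fix x
    obtain n where n: "n \<in> C" "x \<in> U n" using C by auto
    have "n \<le> Max (insert 0 C)" using n C by auto
    then have "s n x \<le> s (Max (insert 0 C)) x" using inc[of x] by (auto simp: incseq_def)
    then show "v x - s (Max (insert 0 C)) x < e" using n by (auto simp: U_def)
  qed
qed

text \<open>Countable additivity of \<open>lborel\<close> avoids any ordering of the intervals: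
  lengths in a disjoint decomposition are measures of its pieces.\<close>

lemma sums_measure_Ico:
  fixes a b :: "nat \<Rightarrow> real"
  assumes "\<And>n. a n \<le> b n" "c \<le> d" "disjoint_family (\<lambda>n. {a n..<b n})"
    and "(\<Union>n. {a n..<b n}) = {c..<d}"
  shows "(\<lambda>n. b n - a n) sums (d - c)"
proof -
  have "(\<Sum>n. emeasure lborel {a n..<b n}) = emeasure lborel (\<Union>n. {a n..<b n})"
    using assms(3) by (intro suminf_emeasure) auto
  then have eq: "(\<Sum>n. ennreal (b n - a n)) = ennreal (d - c)"
    using assms by simp
  then have "(\<lambda>n. ennreal (b n - a n)) sums ennreal (d - c)"
    by (simp add: sums_iff)
  then show ?thesis
    using assms(1,2) by (subst (asm) sums_ennreal) auto
qed

text \<open>Following Kindler, the functional is turned into a premeasure on the semiring of strips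
  between two graphs in \<open>X \<times> \<real>\<close>: the strip from \<open>f\<close> to \<open>g\<close> has measure \<open>\<Lambda> (g - f)\<close>, and
  countable additivity follows from Dini's theorem.\<close>

definition strip :: "('a \<Rightarrow> real) \<Rightarrow> ('a \<Rightarrow> real) \<Rightarrow> ('a \<times> real) set" where
  "strip f g = {(x, t). f x \<le> t \<and> t < g x}"

lemma semiring_strips:
  "semiring_of_sets UNIV {strip f g | f g :: 'a::metric_space \<Rightarrow> real. f \<in> CX \<and> g \<in> CX \<and> (\<forall>x. f x \<le> g x)}"
  (is "semiring_of_sets _ ?M")
proof
  show "{} \<in> ?M"
  proof -
    have "{} = strip (\<lambda>x::'a. 0) (\<lambda>x. 0)" by (auto simp: strip_def)
    then show ?thesis using CX_intros(1) by blast
  qed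
  fix a b assume "a \<in> ?M" "b \<in> ?M"
  then obtain f g f' g' where [simp]: "a = strip f g" "b = strip f' g'"
    and C: "f \<in> CX" "g \<in> CX" "f' \<in> CX" "g' \<in> CX" and le: "\<And>x. f x \<le> g x" "\<And>x. f' x \<le> g' x"
    by auto
  \<comment> \<open>The outer \<open>max\<close> keeps the upper graph above the lower one at points
    over which the two strips do not meet, as membership in \<open>?M\<close> demands.\<close>
  have "a \<inter> b = strip (\<lambda>x. max (f x) (f' x)) (\<lambda>x. max (max (f x) (f' x)) (min (g x) (g' x)))"
    by (auto simp: strip_def)
  moreover have "\<dots> \<in> ?M"
    using C by (auto intro!: exI CX_intros)
  ultimately show "a \<inter> b \<in> ?M" by simp
  \<comment> \<open>What lies in \<open>a\<close> below the lower graph of \<open>b\<close>, and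
    what lies above its upper graph; the truncations keep the graphs ordered.\<close>
  let ?c = "strip f (\<lambda>x. min (g x) (max (f x) (f' x)))"
  let ?d = "strip (\<lambda>x. min (g x) (max (f x) (g' x))) g"
  have "?c \<in> ?M" "?d \<in> ?M"
    using C le by (auto intro!: exI CX_intros)
  moreover have "a - b = \<Union>{?c, ?d}"
  proof (intro set_eqI)
    fix z
    show "z \<in> a - b \<longleftrightarrow> z \<in> \<Union>{?c, ?d}"
      using le[of "fst z"] by (cases z) (auto simp: strip_def min_le_iff_disj less_max_iff_disj)
  qed
  moreover have "?c \<inter> ?d = {}"
  proof -
    have "z \<notin> ?c \<inter> ?d" for z
      using le[of "fst z"] by (cases z) (auto simp: strip_def min_le_iff_disj less_max_iff_disj)
    then show ?thesis by blast
  qed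
  then have "disjoint {?c, ?d}"
    by (auto simp: disjoint_def)
  ultimately show "\<exists>C\<subseteq>?M. finite C \<and> disjoint C \<and> a - b = \<Union> C"
    by (intro exI[of _ "{?c, ?d}"]) auto
qed auto

locale positive_functional =
  fixes \<Lambda> :: "('a::metric_space \<Rightarrow> real) \<Rightarrow> real"
  assumes X_compact: "compact (UNIV :: 'a set)"
    and add: "f \<in> CX \<Longrightarrow> g \<in> CX \<Longrightarrow> \<Lambda> (\<lambda>x. f x + g x) = \<Lambda> f + \<Lambda> g"
    and scale: "f \<in> CX \<Longrightarrow> \<Lambda> (\<lambda>x. c * f x) = c * \<Lambda> f"
    and nonneg: "f \<in> CX \<Longrightarrow> (\<And>x. 0 \<le> f x) \<Longrightarrow> 0 \<le> \<Lambda> f"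
begin

lemma diff: "f \<in> CX \<Longrightarrow> g \<in> CX \<Longrightarrow> \<Lambda> (\<lambda>x. f x - g x) = \<Lambda> f - \<Lambda> g"
  using add[of f "\<lambda>x. (-1) * g x"] scale[of g "-1"]
  by (simp add: CX_intros)

lemma mono: "f \<in> CX \<Longrightarrow> g \<in> CX \<Longrightarrow> (\<And>x. f x \<le> g x) \<Longrightarrow> \<Lambda> f \<le> \<Lambda> g"
  using nonneg[of "\<lambda>x. g x - f x"] diff[of g f] by (simp add: CX_intros)

lemma sum: "finite I \<Longrightarrow> (\<And>i. i \<in> I \<Longrightarrow> f i \<in> CX) \<Longrightarrow> \<Lambda> (\<lambda>x. \<Sum>i\<in>I. f i x) = (\<Sum>i\<in>I. \<Lambda> (f i))"
proof (induction I rule: finite_induct)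
  case empty
  then show ?case using scale[of "\<lambda>x. 0" 0] CX_intros(1)[of 0] by simp
next
  case (insert i I)
  then show ?case using add[of "f i" "\<lambda>x. \<Sum>i\<in>I. f i x"] by (simp add: CX_sum)
qed

text \<open>The partial sums increase to a continuous limit, hence uniformly, and positivity bounds
  \<open>\<Lambda>\<close> of the remainder by a small multiple of
  \<open>\<Lambda> (\<lambda>x. 1)\<close>. This becomes the countable additivity of the premeasure
  on strips.\<close>

lemma sums:
  assumes u: "\<And>n. u n \<in> CX" "\<And>n x. 0 \<le> u n x" and v: "v \<in> CX"
    and uv: "\<And>x. (\<lambda>n. u n x) sums v x"
  shows "(\<lambda>n. \<Lambda> (u n)) sums \<Lambda> v"
proof -
  define s where "s n x = (\<Sum>i<n. u i x)" for n x
  have sC: "s n \<in> CX" for n unfolding s_def by (intro CX_sum u)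
  have sv: "s n x \<le> v x" for n x
    unfolding s_def using uv[of x] u(2) by (metis sum_le_suminf sums_iff finite_lessThan)
  have \<Lambda>s: "\<Lambda> (s n) = (\<Sum>i<n. \<Lambda> (u i))" for n unfolding s_def by (rule sum) (auto intro: u)
  have "(\<lambda>n. \<Lambda> (s n)) \<longlonglongrightarrow> \<Lambda> v"
  proof (rule LIMSEQ_I)
    fix e :: real assume e: "0 < e"
    have one: "0 \<le> \<Lambda> (\<lambda>x. 1)" by (rule nonneg) (auto intro: CX_intros)
    define d where "d = e / (1 + \<Lambda> (\<lambda>x. 1))"
    have d: "0 < d" using e one by (auto simp: d_def)
    obtain n0 where n0: "\<And>x. v x - s n0 x < d"
      using Dini_at_top[of s v d] X_compact sC v u uv d
      by (auto simp: s_def sums_def)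
    show "\<exists>n0. \<forall>n\<ge>n0. norm (\<Lambda> (s n) - \<Lambda> v) < e"
    proof (intro exI allI impI)
      fix n assume "n0 \<le> n"
      then have "s n0 x \<le> s n x" for x
        unfolding s_def using u by (intro sum_mono2) auto
      then have "v x - s n x \<le> d * 1" for x
        using n0[of x] by (smt (verit))
      then have "\<Lambda> (\<lambda>x. v x - s n x) \<le> \<Lambda> (\<lambda>x. d * 1)"
        by (intro mono) (auto intro!: CX_intros v sC)
      then have "\<Lambda> v - \<Lambda> (s n) \<le> d * \<Lambda> (\<lambda>x. 1)"
        using scale[of "\<lambda>x. 1" d, OF CX_intros(1)] diff[OF v sC] by simp
      also have "\<dots> < e" using e one by (simp add: d_def field_simps)
      finally have "\<Lambda> v - \<Lambda> (s n) < e" .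
      moreover have "\<Lambda> (s n) \<le> \<Lambda> v" by (intro mono sv sC v)
      ultimately show "norm (\<Lambda> (s n) - \<Lambda> v) < e" by simp
    qed
  qed
  then show ?thesis unfolding sums_def \<Lambda>s .
qed

definition strip_measure :: "('a \<times> real) measure" where
  "strip_measure = extend_measure UNIV {(f, g). f \<in> CX \<and> g \<in> CX \<and> (\<forall>x. f x \<le> g x)}
     (\<lambda>(f, g). strip f g) (\<lambda>(f, g). ennreal (\<Lambda> (\<lambda>x. g x - f x)))"

lemma emeasure_strip:
  assumes "f \<in> CX" "g \<in> CX" "\<And>x. f x \<le> g x"
  shows "emeasure strip_measure (strip f g) = ennreal (\<Lambda> (\<lambda>x. g x - f x))"
proof -
  have fib: "{t. f x \<le> t \<and> t < g x} = {f x..<g x}" for f g :: "'a \<Rightarrow> real" and x by auto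
  have sub: "strip f g = strip k l \<Longrightarrow> {f x..<g x} = {k x..<l x}" for f g k l :: "'a \<Rightarrow> real" and x
    by (auto simp: strip_def set_eq_iff)
  \<comment> \<open>Where f and g coincide the fibre is empty and f cannot be recovered from the
    strip; the difference g - f always can. Hence the measure of a strip, the empty one included, is
    well defined.\<close>
  have len: "g x - f x = l x - k x"
    if "strip f g = strip k l" "\<And>x. f x \<le> g x" "\<And>x. k x \<le> l x" for f g k l :: "'a \<Rightarrow> real" and x
    using sub[OF that(1), of x] that(2)[of x] that(3)[of x] unfolding Ico_eq_Ico by linarith
  show ?thesis
  proof (rule extend_measure_caratheodory_pair[OF strip_measure_def, of f g])
    show "f \<in> CX \<and> g \<in> CX \<and> (\<forall>x. f x \<le> g x)" using assms by auto
    show "semiring_of_sets UNIV {strip f g | f g. f \<in> CX \<and> g \<in> CX \<and> (\<forall>x. f x \<le> g x)}"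
      by (rule semiring_strips)
  next
    fix f g :: "'a \<Rightarrow> real" assume "f \<in> CX \<and> g \<in> CX \<and> (\<forall>x. f x \<le> g x)" "strip f g = {}"
    moreover have "strip f f = {}" by (auto simp: strip_def)
    ultimately have "g x - f x = f x - f x" for x
      using len[of f g f f] by simp
    then have "(\<lambda>x. g x - f x) = (\<lambda>x. 0 * f x)" by simp
    moreover have "\<Lambda> (\<lambda>x. 0 * f x) = 0"
      using scale[of f 0] \<open>f \<in> CX \<and> _\<close> by simp
    ultimately have "\<Lambda> (\<lambda>x. g x - f x) = 0" by simp
    then show "ennreal (\<Lambda> (\<lambda>x. g x - f x)) = 0" by simp
  next
    fix f g k l :: "'a \<Rightarrow> real"
    assume "f \<in> CX \<and> g \<in> CX \<and> (\<forall>x. f x \<le> g x)" "k \<in> CX \<and> l \<in> CX \<and> (\<forall>x. k x \<le> l x)"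
      "strip f g = strip k l"
    then have "(\<lambda>x. g x - f x) = (\<lambda>x. l x - k x)" using len[of f g k l] by auto
    then show "ennreal (\<Lambda> (\<lambda>x. g x - f x)) = ennreal (\<Lambda> (\<lambda>x. l x - k x))" by simp
  next
    fix a b :: "nat \<Rightarrow> 'a \<Rightarrow> real" and f g
    assume ab: "\<And>n. a n \<in> CX \<and> b n \<in> CX \<and> (\<forall>x. a n x \<le> b n x)"
      and fg: "f \<in> CX \<and> g \<in> CX \<and> (\<forall>x. f x \<le> g x)"
      and disj: "disjoint_family (\<lambda>n. strip (a n) (b n))"
      and un: "(\<Union>n. strip (a n) (b n)) = strip f g"
    \<comment> \<open>Over a fixed x the strips are disjoint intervals that fill the fibre of
      \<open>strip f g\<close>, so their lengths sum pointwise, which is what \<open>sums\<close>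
      asks for.\<close>
    have "(\<lambda>n. b n x - a n x) sums (g x - f x)" for x
    proof (rule sums_measure_Ico)
      have slice: "{a n x..<b n x} = Pair x -` strip (a n) (b n)" for n by (auto simp: strip_def)
      show "disjoint_family (\<lambda>n. {a n x..<b n x})"
        using disj unfolding slice by (auto simp: disjoint_family_on_def)
      show "(\<Union>n. {a n x..<b n x}) = {f x..<g x}"
        unfolding slice vimage_UN[symmetric] un by (auto simp: strip_def)
    qed (use ab fg in auto)
    then have "(\<lambda>n. \<Lambda> (\<lambda>x. b n x - a n x)) sums \<Lambda> (\<lambda>x. g x - f x)"
      using ab fg by (intro sums) (auto intro!: CX_intros)
    then have "(\<lambda>n. ennreal (\<Lambda> (\<lambda>x. b n x - a n x))) sums ennreal (\<Lambda> (\<lambda>x. g x - f x))"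
      using ab fg by (subst sums_ennreal) (auto intro!: nonneg CX_intros)
    then show "(\<Sum>n. ennreal (\<Lambda> (\<lambda>x. b n x - a n x))) = ennreal (\<Lambda> (\<lambda>x. g x - f x))"
      by (simp add: sums_iff)
  qed simp
qed

lemma strip_sets: "f \<in> CX \<Longrightarrow> g \<in> CX \<Longrightarrow> (\<And>x. f x \<le> g x) \<Longrightarrow> strip f g \<in> sets strip_measure"
  unfolding strip_measure_def by (subst sets_extend_measure) (auto intro!: sigma_sets.Basic)

lemma space_strip_measure: "space strip_measure = UNIV"
  unfolding strip_measure_def by (subst space_extend_measure) auto

end

text \<open>Truncated multiples of the distance to the complement. At each point of U the value is
  exactly 1 after finitely many steps, so the cylinder of height 1 over U is a plain union of
  strips, and the closed sets \<open>{x. 1 \<le> f n x}\<close> exhaust U.\<close>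

lemma open_Sup_CX:
  fixes U :: "'a::metric_space set"
  assumes "open U"
  obtains f :: "nat \<Rightarrow> 'a \<Rightarrow> real" where "\<And>n. f n \<in> CX" "\<And>n x. 0 \<le> f n x" "\<And>n x. f n x \<le> 1"
    "\<And>n x. x \<notin> U \<Longrightarrow> f n x = 0" "\<And>x. x \<in> U \<Longrightarrow> \<exists>n0. \<forall>n\<ge>n0. f n x = 1" "\<And>x. incseq (\<lambda>n. f n x)"
proof (cases "U = UNIV")
  \<comment> \<open>\<open>infdist\<close> to the empty set is 0, so the formula used below would
    give 0 everywhere; the constant 1 serves instead.\<close>
  case True
  then show ?thesis by (intro that[of "\<lambda>n x. 1"]) (auto intro: CX_intros)
next
  case False
  define f where "f n x = min 1 (real n * infdist x (- U))" for n :: nat and x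
  show ?thesis
  proof (rule that[of f])
    show "f n \<in> CX" for n unfolding f_def by (intro CX_intros)
    show "0 \<le> f n x" "f n x \<le> 1" for n x by (auto simp: f_def infdist_nonneg)
    show "f n x = 0" if "x \<notin> U" for n x using that by (auto simp: f_def)
    show "incseq (\<lambda>n. f n x)" for x
      unfolding incseq_def f_def by (intro allI impI min.mono mult_right_mono) (auto simp: infdist_nonneg)
    show "\<exists>n0. \<forall>n\<ge>n0. f n x = 1" if "x \<in> U" for x
    proof -
      have "closed (- U)" "- U \<noteq> {}" using assms False by auto
      then have pos: "0 < infdist x (- U)"
        using that by (metis ComplD infdist_pos_not_in_closed)
      obtain n0 :: nat where n0: "1 / infdist x (- U) < n0" using reals_Archimedean2 by blast
      have "f n x = 1" if "n0 \<le> n" for n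
      proof -
        have "1 \<le> real n0 * infdist x (- U)" using n0 pos by (simp add: field_simps)
        also have "\<dots> \<le> real n * infdist x (- U)" using that pos by (intro mult_right_mono) auto
        finally show ?thesis by (simp add: f_def)
      qed
      then show ?thesis by blast
    qed
  qed
qed

context positive_functional begin

lemma cylinder_open:
  assumes "open U"
  shows "U \<times> {0..<1} \<in> sets strip_measure"
proof -
  obtain f :: "nat \<Rightarrow> 'a \<Rightarrow> real" where f: "\<And>n. f n \<in> CX" "\<And>n x. 0 \<le> f n x" "\<And>n x. f n x \<le> 1"
    "\<And>n x. x \<notin> U \<Longrightarrow> f n x = 0" "\<And>x. x \<in> U \<Longrightarrow> \<exists>n0. \<forall>n\<ge>n0. f n x = 1"
    using open_Sup_CX[OF assms] by metis
  have "U \<times> {0..<1} = (\<Union>n. strip (\<lambda>x. 0) (f n))"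
  proof (intro set_eqI iffI)
    fix z assume "z \<in> U \<times> {0..<1::real}"
    then have z: "fst z \<in> U" "0 \<le> snd z" "snd z < 1" by auto
    then obtain n where "f n (fst z) = 1" using f(5) by blast
    then have "z \<in> strip (\<lambda>x. 0) (f n)" using z by (auto simp: strip_def)
    then show "z \<in> (\<Union>n. strip (\<lambda>x. 0) (f n))" by blast
  next
    fix z assume "z \<in> (\<Union>n. strip (\<lambda>x. 0) (f n))"
    then obtain n where "0 \<le> snd z" "snd z < f n (fst z)" by (auto simp: strip_def)
    moreover have "fst z \<in> U" using calculation f(4)[of "fst z" n] by force
    ultimately show "z \<in> U \<times> {0..<1}" using f(3)[of n "fst z"] by (cases z) auto
  qed
  also have "\<dots> \<in> sets strip_measure"
    using f by (intro sets.countable_UN) (auto intro!: strip_sets CX_intros)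
  finally show ?thesis .
qed

text \<open>A Borel set receives the measure of the cylinder of height 1 over it. For f with values
  in [0, 1] the region under f lies in the cylinder over any set outside which f vanishes, which is
  how \<open>\<Lambda> f\<close> gets compared with this measure.\<close>

definition rep :: "'a measure" where
  "rep = distr (restrict_space strip_measure (UNIV \<times> {0..<1})) borel fst"

lemma fst_measurable: "fst \<in> restrict_space strip_measure (UNIV \<times> {0..<1}) \<rightarrow>\<^sub>M borel"
proof (rule borel_measurableI)
  fix U :: "'a set" assume U: "open U"
  have "fst -` U \<inter> space (restrict_space strip_measure (UNIV \<times> {0..<1})) = U \<times> {0..<1}"
    by (auto simp: space_restrict_space space_strip_measure)
  then show "fst -` U \<inter> space (restrict_space strip_measure (UNIV \<times> {0..<1}))
      \<in> sets (restrict_space strip_measure (UNIV \<times> {0..<1}))"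
    using cylinder_open[OF U] cylinder_open[OF open_UNIV]
    by (subst sets_restrict_space_iff) (auto simp: space_strip_measure)
qed

lemma emeasure_rep: "B \<in> sets borel \<Longrightarrow> emeasure rep B = emeasure strip_measure (B \<times> {0..<1})"
proof -
  assume B: "B \<in> sets borel"
  have *: "fst -` B \<inter> space (restrict_space strip_measure (UNIV \<times> {0..<1})) = B \<times> {0..<1}"
    by (auto simp: space_restrict_space space_strip_measure)
  show ?thesis
    unfolding rep_def
    apply (subst emeasure_distr[OF fst_measurable B])
    apply (subst *)
    apply (subst emeasure_restrict_space)
    using cylinder_open[OF open_UNIV] by (auto simp: space_strip_measure)
qed

lemma cylinder_sets: "B \<in> sets borel \<Longrightarrow> B \<times> {0..<1} \<in> sets strip_measure"
proof -
  assume "B \<in> sets borel"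
  from measurable_sets[OF fst_measurable this]
  have "B \<times> {0..<1} \<in> sets (restrict_space strip_measure (UNIV \<times> {0..<1}))"
    by (auto simp: space_restrict_space space_strip_measure Sigma_def elim!: back_subst[of "\<lambda>A. A \<in> _"])
  then show ?thesis
    using cylinder_open[OF open_UNIV] by (simp add: sets_restrict_space_iff space_strip_measure)
qed

lemma sets_rep [simp]: "sets rep = sets borel"
  by (simp add: rep_def)

lemma emeasure_rep_UNIV: "emeasure rep UNIV = ennreal (\<Lambda> (\<lambda>x. 1))"
proof -
  have "(UNIV :: 'a set) \<times> {0..<1} = strip (\<lambda>x. 0) (\<lambda>x. 1)" by (auto simp: strip_def)
  then show ?thesis
    using emeasure_strip[of "\<lambda>x. 0" "\<lambda>x. 1"] by (simp add: emeasure_rep CX_intros)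
qed

lemma finite_rep: "finite_measure rep"
proof
  have "space rep = UNIV" using sets_eq_imp_space_eq[OF sets_rep] by simp
  then show "emeasure rep (space rep) \<noteq> \<infinity>" by (simp add: emeasure_rep_UNIV)
qed

lemma measure_rep_ge:
  assumes f: "f \<in> CX" "\<And>x. 0 \<le> f x" "\<And>x. f x \<le> 1" and B: "B \<in> sets borel" "\<And>x. x \<notin> B \<Longrightarrow> f x = 0"
  shows "\<Lambda> f \<le> measure rep B"
proof -
  interpret finite_measure rep by (rule finite_rep)
  have "ennreal (\<Lambda> f) = emeasure strip_measure (strip (\<lambda>x. 0) f)"
    using emeasure_strip[of "\<lambda>x. 0" f] f by (simp add: CX_intros)
  also have "\<dots> \<le> emeasure strip_measure (B \<times> {0..<1})"
  proof (rule emeasure_mono)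
    show "strip (\<lambda>x. 0) f \<subseteq> B \<times> {0..<1}"
      using f B(2) by (force simp: strip_def intro: order_less_le_trans)
  qed (rule cylinder_sets[OF B(1)])
  also have "\<dots> = ennreal (measure rep B)"
    using emeasure_rep[OF B(1)] by (simp add: emeasure_eq_measure)
  finally show ?thesis by (simp add: ennreal_le_iff)
qed

text \<open>Cut f into horizontal slices of height h. The k-th slice divided by h is at most 1 and
  vanishes off \<open>D k\<close>, so its \<open>\<Lambda>\<close> is at most the measure of
  \<open>D k\<close>; the step function built from these sets exceeds f by at most h.\<close>

lemma \<Lambda>_le_integral_nonneg:
  assumes f: "f \<in> CX" "\<And>x. 0 \<le> f x"
  shows "\<Lambda> f \<le> integral\<^sup>L rep f"
proof (rule field_le_epsilon)
  interpret finite_measure rep by (rule finite_rep)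
  fix e :: real assume e: "0 < e"
  obtain B where B: "\<And>x. \<bar>f x\<bar> \<le> B" using CX_bounded[OF X_compact f(1)] by blast
  define h where "h = e / (measure rep UNIV + 1)"
  have h: "0 < h" "h * measure rep UNIV \<le> e"
    using e by (auto simp: h_def field_simps add_pos_nonneg)
  obtain K :: nat where K: "B / h < K" using reals_Archimedean2 by blast
  have Kh: "f x \<le> real K * h" for x
    using K h(1) B[of x] by (simp add: field_simps)
  have fb: "f \<in> borel_measurable rep"
    using f(1) unfolding CX_def measurable_cong_sets[OF sets_rep refl]
    by (auto intro: borel_measurable_continuous_onI)
  define F where "F k x = min h (max 0 (f x - real k * h))" for k :: nat and x
  define D where "D k = {x. real k * h < f x}" for k :: nat
  have D: "D k \<in> sets borel" for k
    unfolding D_def using f(1) by (intro borel_open open_Collect_less) (auto simp: CX_def)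
  have telescope: "(\<Sum>k<m. F k x) = min (real m * h) (f x)" for m x
    using f(2)[of x] h(1) by (induction m) (auto simp: F_def min_def max_def algebra_simps)
  have "\<Lambda> f = \<Lambda> (\<lambda>x. \<Sum>k<K. F k x)"
    using telescope[where m = K] Kh by (simp add: min.absorb2)
  also have "\<dots> = (\<Sum>k<K. \<Lambda> (F k))"
    unfolding F_def by (intro sum) (auto intro!: CX_intros f)
  also have "\<dots> \<le> (\<Sum>k<K. h * measure rep (D k))"
  proof (rule sum_mono)
    fix k
    have FC: "(\<lambda>x. (1 / h) * F k x) \<in> CX"
      unfolding F_def by (intro CX_intros f)
    have "\<Lambda> (\<lambda>x. (1 / h) * F k x) \<le> measure rep (D k)"
      by (rule measure_rep_ge[OF FC _ _ D]) (use h in \<open>auto simp: F_def D_def field_simps\<close>)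
    moreover have "\<Lambda> (\<lambda>x. (1 / h) * F k x) = (1 / h) * \<Lambda> (F k)"
      by (rule scale) (auto simp: F_def intro!: CX_intros f)
    ultimately have "(1 / h) * \<Lambda> (F k) \<le> measure rep (D k)" by linarith
    then show "\<Lambda> (F k) \<le> h * measure rep (D k)" using h(1) by (simp add: field_simps)
  qed
  also have "\<dots> = (\<Sum>k<K. \<integral>x. h * indicator (D k) x \<partial>rep)"
    using D by simp
  also have "\<dots> = (\<integral>x. (\<Sum>k<K. h * indicator (D k) x) \<partial>rep)"
    using D by (intro Bochner_Integration.integral_sum[symmetric]) (auto simp: emeasure_eq_measure)
  also have "\<dots> \<le> (\<integral>x. f x + h \<partial>rep)"
  proof (rule integral_mono)
    have intf: "integrable rep f"
      using fb B by (intro integrable_const_bound[of _ B]) auto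
    then show "integrable rep (\<lambda>x. f x + h)" by auto
    show "integrable rep (\<lambda>x. \<Sum>k<K. h * indicator (D k) x)"
      using D by (intro Bochner_Integration.integrable_sum) (auto simp: emeasure_eq_measure)
    fix x
    \<comment> \<open>The bound by \<open>real m * h\<close> is carried along for the induction: the
      layer m counts only where \<open>real m * h < f x\<close>, and there the new sum is still at
      most f + h.\<close>
    have "(\<Sum>k<m. h * indicator (D k) x) \<le> real m * h \<and> (\<Sum>k<m. h * indicator (D k) x) \<le> f x + h" for m
    proof (induction m)
      case (Suc m)
      have "(\<Sum>k<Suc m. h * indicator (D k) x) = (\<Sum>k<m. h * indicator (D k) x) + h * indicator (D m) x"
        by (rule sum.lessThan_Suc)
      moreover have "h * indicator (D m) x = (if real m * h < f x then h else 0)"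
        by (simp add: D_def)
      moreover have "real (Suc m) * h = real m * h + h" by (simp add: algebra_simps)
      ultimately show ?case using Suc h(1) by (smt (verit))
    qed (use f(2)[of x] h(1) in auto)
    then have "(\<Sum>k<K. h * indicator (D k) x) \<le> f x + h" by blast
    then show "(\<Sum>k<K. h * indicator (D k) x) \<le> f x + h" by simp
  qed
  also have "\<dots> = integral\<^sup>L rep f + h * measure rep UNIV"
  proof -
    have "integrable rep f" using fb B by (intro integrable_const_bound[of _ B]) auto
    moreover have "space rep = UNIV" using sets_eq_imp_space_eq[OF sets_rep] by simp
    ultimately show ?thesis by (simp add: mult.commute)
  qed
  finally show "\<Lambda> f \<le> integral\<^sup>L rep f + e" using h(2) by simp
qed

text \<open>One inequality for nonnegative f is enough: the total mass is exact, so adding constants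
  extends it to all f, and applying it to -f reverses it.\<close>

lemma integral_rep:
  assumes f: "f \<in> CX"
  shows "integral\<^sup>L rep f = \<Lambda> f"
proof -
  interpret finite_measure rep by (rule finite_rep)
  have sp: "space rep = UNIV" using sets_eq_imp_space_eq[OF sets_rep] by simp
  have one: "measure rep UNIV = \<Lambda> (\<lambda>x. 1)"
    using emeasure_rep_UNIV nonneg[of "\<lambda>x. 1"] by (simp add: emeasure_eq_measure CX_intros)
  have int: "integrable rep g" if g: "g \<in> CX" for g
  proof -
    obtain B where B: "\<And>x. \<bar>g x\<bar> \<le> B" using CX_bounded[OF X_compact g] by blast
    have "g \<in> borel_measurable rep"
      using g unfolding CX_def measurable_cong_sets[OF sets_rep refl]
      by (auto intro: borel_measurable_continuous_onI)
    then show ?thesis using B by (intro integrable_const_bound[of _ B]) auto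
  qed
  have le: "\<Lambda> g \<le> integral\<^sup>L rep g" if g: "g \<in> CX" for g
  proof -
    obtain B where B: "\<And>x. \<bar>g x\<bar> \<le> B" using CX_bounded[OF X_compact g] by blast
    have B': "\<Lambda> (\<lambda>x. B * 1) = B * \<Lambda> (\<lambda>x. 1)" by (rule scale) (rule CX_intros)
    have "0 \<le> g x + B * 1" for x using B[of x] by (simp add: abs_le_iff)
    then have "\<Lambda> (\<lambda>x. g x + B * 1) \<le> integral\<^sup>L rep (\<lambda>x. g x + B * 1)"
      using g by (intro \<Lambda>_le_integral_nonneg) (auto intro!: CX_intros)
    then show ?thesis
      using add[OF g, of "\<lambda>x. B * 1"] int[OF g] one B' by (simp add: CX_intros sp mult.commute)
  qed
  have "\<Lambda> (\<lambda>x. (-1) * f x) \<le> integral\<^sup>L rep (\<lambda>x. (-1) * f x)"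
    by (intro le CX_intros f)
  then show ?thesis using le[OF f] scale[OF f, of "-1"] by simp
qed

end

text \<open>Indicators of open sets are limits of continuous functions, and the open sets are an
  intersection-stable generator. This is the uniqueness that the definite description in
  \<open>rep_measure\<close> requires.\<close>

lemma finite_measure_eqI_CX:
  fixes M N :: "'a::metric_space measure"
  assumes X: "compact (UNIV :: 'a set)"
    and M: "sets M = sets borel" "finite_measure M" and N: "sets N = sets borel" "finite_measure N"
    and eq: "\<And>f. f \<in> CX \<Longrightarrow> integral\<^sup>L M f = integral\<^sup>L N f"
  shows "M = N"
proof -
  have op: "measure M U = measure N U" if U: "open U" for U
  proof -
    obtain f :: "nat \<Rightarrow> 'a \<Rightarrow> real" where f: "\<And>n. f n \<in> CX" "\<And>n x. 0 \<le> f n x" "\<And>n x. f n x \<le> 1"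
      "\<And>n x. x \<notin> U \<Longrightarrow> f n x = 0" "\<And>x. x \<in> U \<Longrightarrow> \<exists>n0. \<forall>n\<ge>n0. f n x = 1"
      using open_Sup_CX[OF U] by metis
    have lim: "(\<lambda>n. f n x) \<longlonglongrightarrow> indicator U x" for x
    proof (cases "x \<in> U")
      case True
      then show ?thesis using f(5)[OF True]
        by (intro tendsto_eventually) (auto simp: eventually_sequentially)
    qed (simp add: f(4))
    have "(\<lambda>n. integral\<^sup>L K (f n)) \<longlonglongrightarrow> measure K U"
      if K: "sets K = sets borel" "finite_measure K" for K
    proof -
      interpret finite_measure K by fact
      have "(\<lambda>n. integral\<^sup>L K (f n)) \<longlonglongrightarrow> integral\<^sup>L K (indicator U)"
      proof (rule integral_dominated_convergence[where w = "\<lambda>x. 1"])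
        show "indicator U \<in> borel_measurable K" 
          using borel_open[OF U] K(1) by (intro borel_measurable_indicator) simp
        show "f n \<in> borel_measurable K" for n
          using f(1)[of n] unfolding measurable_cong_sets[OF K(1) refl] CX_def
          by (auto intro: borel_measurable_continuous_onI)
      qed (use lim f in auto)
      moreover have "space K = UNIV" using sets_eq_imp_space_eq[OF K(1)] by simp
      ultimately show ?thesis by simp
    qed
    from this[OF M] this[OF N] show ?thesis
      using eq[OF f(1)] by (simp add: LIMSEQ_unique)
  qed
  interpret M: finite_measure M by fact
  interpret N: finite_measure N by fact
  show ?thesis
  proof (rule measure_eqI_generator_eq[where E = "{U. open U}" and \<Omega> = UNIV and A = "\<lambda>_. UNIV"])
    show "Int_stable {U :: 'a set. open U}" by (auto simp: Int_stable_def)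
    show "sets M = sigma_sets UNIV {U. open U}" "sets N = sigma_sets UNIV {U. open U}"
      using M N by (simp_all add: borel_def)
    show "emeasure M U = emeasure N U" if "U \<in> {U. open U}" for U
      using op that by (simp add: M.emeasure_eq_measure N.emeasure_eq_measure)
  qed (auto simp: M.emeasure_eq_measure)
qed

section \<open>Fibre sums of non-contracting covers\<close>

locale noncontracting_cover =
  fixes \<alpha> :: "'a::metric_space \<Rightarrow> 'a" and S :: "'a set" and r :: real and N :: nat
  assumes X_compact: "compact (UNIV :: 'a set)"
    and \<alpha>_cont: "continuous_on UNIV \<alpha>"
    and S_closed: "closed S" and \<alpha>_image: "\<alpha> ` S = S"
    and \<alpha>_open: "open_map (top_of_set S) (top_of_set S) \<alpha>"
    and r_pos: "0 < r"
    and noncontracting: "x \<in> S \<Longrightarrow> y \<in> S \<Longrightarrow> dist x y \<le> r \<Longrightarrow> dist x y \<le> dist (\<alpha> x) (\<alpha> y)"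
    and fib_bound: "x \<in> S \<Longrightarrow> finite (\<alpha> -` {x} \<inter> S) \<and> card (\<alpha> -` {x} \<inter> S) \<le> N"
begin

definition fib :: "'a \<Rightarrow> 'a set" where "fib x = \<alpha> -` {x} \<inter> S"

definition L :: "('a \<Rightarrow> real) \<Rightarrow> 'a \<Rightarrow> real" where "L f x = (\<Sum>y\<in>fib x. f y)"

lemma S_compact: "compact S"
  using compact_Int_closed[OF X_compact S_closed] by simp

lemma \<alpha>_in: "x \<in> S \<Longrightarrow> \<alpha> x \<in> S" using \<alpha>_image by blast

lemma \<alpha>_pow_in: "x \<in> S \<Longrightarrow> (\<alpha> ^^ n) x \<in> S"
  by (induction n) (auto intro: \<alpha>_in)

lemma \<alpha>_pow_cont: "continuous_on A (\<alpha> ^^ n)"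
proof (induction n)
  case (Suc n)
  then show ?case using continuous_on_compose2[OF \<alpha>_cont Suc] by (simp add: comp_def)
qed (simp add: id_def)

lemma fib_iff: "y \<in> fib x \<longleftrightarrow> y \<in> S \<and> \<alpha> y = x" by (auto simp: fib_def)

lemma finite_fib: "x \<in> S \<Longrightarrow> finite (fib x)" and card_fib: "x \<in> S \<Longrightarrow> card (fib x) \<le> N"
  using fib_bound by (auto simp: fib_def)

lemma fib_nonempty: "x \<in> S \<Longrightarrow> fib x \<noteq> {}"
  using \<alpha>_image by (force simp: fib_def)

lemma fib_separated: "y \<in> fib x \<Longrightarrow> z \<in> fib x \<Longrightarrow> dist y z \<le> r \<Longrightarrow> y = z"
  using noncontracting[of y z] by (auto simp: fib_iff)

text \<open>Openness lifts points near \<alpha> y to points near y, compactness of S makes the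
  radius uniform, and non-contraction improves the crude bound on the lift to
  \<open>dist y z \<le> dist (\<alpha> y) x\<close>. Inverse branches are thus available at one
  scale and do not expand.\<close>

lemma ex_lift_radius:
  "\<exists>d>0. d \<le> r / 4 \<and> (\<forall>y\<in>S. \<forall>x\<in>S. dist (\<alpha> y) x < d \<longrightarrow> (\<exists>z\<in>fib x. dist y z \<le> dist (\<alpha> y) x))"
proof -
  \<comment> \<open>\<open>2 * d\<close> leaves room for passing from the centre y of a ball of the
    cover to the other points in it. The lift lies within r / 2 of the centre, hence within r of
    those points, where non-contraction applies.\<close>
  define Q where "Q y d s \<longleftrightarrow> 0 < d \<and> 0 < s \<and> s \<le> r / 2 \<and> (\<forall>z\<in>ball y s. dist (\<alpha> y) (\<alpha> z) < d) \<and>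
      (\<forall>x\<in>S. dist (\<alpha> y) x < 2 * d \<longrightarrow> (\<exists>z\<in>fib x. dist y z < r / 2))" for y d s
  have "\<exists>d s. Q y d s" if y: "y \<in> S" for y
  proof -
    have "openin (top_of_set S) (ball y (r / 2) \<inter> S)" by (simp add: openin_open_Int Int_commute)
    then have "openin (top_of_set S) (\<alpha> ` (ball y (r / 2) \<inter> S))"
      using \<alpha>_open by (simp add: open_map_def)
    then obtain e where e: "0 < e" "ball (\<alpha> y) e \<inter> S \<subseteq> \<alpha> ` (ball y (r / 2) \<inter> S)"
      using y r_pos unfolding openin_contains_ball by (metis IntI centre_in_ball half_gt_zero imageI)
    have "0 < e / 2" using e by simp
    then obtain s where s: "0 < s" "\<And>z. dist z y < s \<Longrightarrow> dist (\<alpha> z) (\<alpha> y) < e / 2"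
      using \<alpha>_cont unfolding continuous_on_iff by blast
    show ?thesis unfolding Q_def
    proof (rule exI[of _ "e / 2"], rule exI[of _ "min s (r / 2)"], intro conjI ballI impI)
      show "\<exists>z\<in>fib x. dist y z < r / 2" if x: "x \<in> S" "dist (\<alpha> y) x < 2 * (e / 2)" for x
      proof -
        have "x \<in> ball (\<alpha> y) e \<inter> S" using x by simp
        then obtain z where "z \<in> ball y (r / 2) \<inter> S" "x = \<alpha> z" using e(2) by blast
        then show ?thesis by (intro bexI[of _ z]) (auto simp: fib_iff)
      qed
    qed (use e s r_pos in \<open>auto simp: dist_commute\<close>)
  qed
  then obtain d s where "\<And>y. y \<in> S \<Longrightarrow> Q y (d y) (s y)" by metis
  then have ds: "\<And>y. y \<in> S \<Longrightarrow> 0 < d y" "\<And>y. y \<in> S \<Longrightarrow> 0 < s y" "\<And>y. y \<in> S \<Longrightarrow> s y \<le> r / 2"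
    "\<And>y z. y \<in> S \<Longrightarrow> z \<in> ball y (s y) \<Longrightarrow> dist (\<alpha> y) (\<alpha> z) < d y"
    "\<And>y x. y \<in> S \<Longrightarrow> x \<in> S \<Longrightarrow> dist (\<alpha> y) x < 2 * d y \<Longrightarrow> \<exists>z\<in>fib x. dist y z < r / 2"
    unfolding Q_def by blast+
  obtain C where C: "C \<subseteq> S" "finite C" "S \<subseteq> (\<Union>y\<in>C. ball y (s y))"
    by (rule compactE_image[OF S_compact, of S "\<lambda>y. ball y (s y)"]) (use ds(2) in auto)
  \<comment> \<open>The cap r / 4 is what later makes the matching of neighbouring fibres
    injective.\<close>
  define d0 where "d0 = Min (insert (r / 4) (d ` C))"
  have d0: "0 < d0" "\<And>y. y \<in> C \<Longrightarrow> d0 \<le> d y"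
    using C ds(1) r_pos by (auto simp: d0_def)
  have d0': "d0 \<le> r / 4" unfolding d0_def using C by (intro Min_le) auto
  show ?thesis
  proof (intro exI[of _ d0] conjI d0(1) d0' ballI impI)
    fix y x assume y: "y \<in> S" and x: "x \<in> S" and yx: "dist (\<alpha> y) x < d0"
    obtain c where c: "c \<in> C" "y \<in> ball c (s c)" using C y by auto
    have cS: "c \<in> S" using c C by auto
    have "dist (\<alpha> c) x \<le> dist (\<alpha> c) (\<alpha> y) + dist (\<alpha> y) x" by (rule dist_triangle)
    also have "\<dots> < 2 * d c" using ds(4)[OF cS c(2)] yx d0(2)[OF c(1)] by simp
    finally obtain z where z: "z \<in> fib x" "dist c z < r / 2" using ds(5)[OF cS x] by blast
    have "dist y z \<le> dist y c + dist c z" by (rule dist_triangle)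
    also have "\<dots> \<le> r" using c(2) z(2) ds(3)[OF cS] by (simp add: dist_commute)
    finally have "dist y z \<le> dist (\<alpha> y) (\<alpha> z)"
      using y z by (intro noncontracting) (auto simp: fib_iff)
    then show "\<exists>z\<in>fib x. dist y z \<le> dist (\<alpha> y) x" using z by (auto simp: fib_iff)
  qed
qed

definition lift_radius :: real where
  "lift_radius = (SOME d. d > 0 \<and> d \<le> r / 4 \<and>
     (\<forall>y\<in>S. \<forall>x\<in>S. dist (\<alpha> y) x < d \<longrightarrow> (\<exists>z\<in>fib x. dist y z \<le> dist (\<alpha> y) x)))"

lemma lift_radius: "0 < lift_radius" "lift_radius \<le> r / 4"
  "y \<in> S \<Longrightarrow> x \<in> S \<Longrightarrow> dist (\<alpha> y) x < lift_radius \<Longrightarrow> \<exists>z\<in>fib x. dist y z \<le> dist (\<alpha> y) x"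
  using someI_ex[OF ex_lift_radius] unfolding lift_radius_def[symmetric] by auto

text \<open>Lifting moves each point of a fibre by at most dist x x', and points of one fibre are
  more than r apart, so lifting is injective; the injection in the opposite direction and finiteness
  make it a bijection. In particular the number of preimages in S is locally constant.\<close>

lemma fib_bij:
  assumes x: "x \<in> S" "x' \<in> S" "dist x x' < lift_radius"
  obtains h where "bij_betw h (fib x) (fib x')" "\<And>y. y \<in> fib x \<Longrightarrow> dist y (h y) \<le> dist x x'"
proof -
  have inj: "\<exists>h. inj_on h (fib x) \<and> h ` fib x \<subseteq> fib x' \<and> (\<forall>y\<in>fib x. dist y (h y) \<le> dist x x')"
    if x: "x \<in> S" "x' \<in> S" "dist x x' < lift_radius" for x x'
  proof -
    have "\<exists>z\<in>fib x'. dist y z \<le> dist x x'" if "y \<in> fib x" for y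
      using lift_radius(3)[of y x'] that x by (auto simp: fib_iff)
    then obtain h where h: "\<And>y. y \<in> fib x \<Longrightarrow> h y \<in> fib x' \<and> dist y (h y) \<le> dist x x'"
      by metis
    have "inj_on h (fib x)"
    proof (rule inj_onI)
      fix y z assume y: "y \<in> fib x" and z: "z \<in> fib x" and eq: "h y = h z"
      have "dist y z \<le> dist y (h y) + dist (h y) z" by (rule dist_triangle)
      also have "\<dots> \<le> dist x x' + dist x x'"
        using h[OF y] h[OF z] eq by (intro add_mono) (auto simp: dist_commute)
      also have "\<dots> \<le> r" using x(3) lift_radius(2) r_pos by simp
      finally show "y = z" using y z by (rule fib_separated[rotated 2])
    qed
    then show ?thesis using h by blast
  qed
  obtain h where h: "inj_on h (fib x)" "h ` fib x \<subseteq> fib x'" "\<And>y. y \<in> fib x \<Longrightarrow> dist y (h y) \<le> dist x x'"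
    using inj[OF x] by auto
  obtain h' where h': "inj_on h' (fib x')" "h' ` fib x' \<subseteq> fib x"
    using inj[of x' x] x by (auto simp: dist_commute)
  have "card (fib x') \<le> card (fib x)" using h' x finite_fib by (metis card_inj_on_le)
  then have "h ` fib x = fib x'"
    using h x finite_fib by (intro card_seteq) (auto simp: card_image)
  then show ?thesis using h by (intro that[of h]) (auto simp: bij_betw_def)
qed

text \<open>Matched points of nearby fibres are close, so uniform continuity of f compares the two
  sums term by term; there are at most N terms.\<close>

lemma L_continuous:
  assumes f: "continuous_on S f"
  shows "continuous_on S (L f)"
  unfolding continuous_on_iff
proof (intro ballI allI impI)
  fix x and e :: real assume x: "x \<in> S" and e: "0 < e"
  have "uniformly_continuous_on S f" using f S_compact by (rule compact_uniformly_continuous)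
  moreover have "0 < e / (N + 1)" using e by simp
  ultimately obtain d where d: "0 < d" "\<And>y z. y \<in> S \<Longrightarrow> z \<in> S \<Longrightarrow> dist y z < d \<Longrightarrow> dist (f y) (f z) < e / (N + 1)"
    unfolding uniformly_continuous_on_def by blast
  show "\<exists>d>0. \<forall>x'\<in>S. dist x' x < d \<longrightarrow> dist (L f x') (L f x) < e"
  proof (intro exI[of _ "min d lift_radius"] conjI ballI impI)
    show "0 < min d lift_radius" using d lift_radius by simp
    fix x' assume x': "x' \<in> S" "dist x' x < min d lift_radius"
    obtain h where h: "bij_betw h (fib x) (fib x')" "\<And>y. y \<in> fib x \<Longrightarrow> dist y (h y) \<le> dist x x'"
      using fib_bij[of x x'] x x' by (auto simp: dist_commute)
    have hS: "h y \<in> S" "y \<in> S" if "y \<in> fib x" for y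
      using that h(1) by (auto simp: bij_betw_def fib_iff)
    have "L f x' = (\<Sum>y\<in>fib x. f (h y))"
      unfolding L_def by (rule sum.reindex_bij_betw[OF h(1), symmetric])
    then have "\<bar>L f x' - L f x\<bar> = \<bar>\<Sum>y\<in>fib x. f (h y) - f y\<bar>"
      by (simp add: L_def sum_subtractf)
    also have "\<dots> \<le> (\<Sum>y\<in>fib x. \<bar>f (h y) - f y\<bar>)" by (rule sum_abs)
    also have "\<dots> \<le> (\<Sum>y\<in>fib x. e / (N + 1))"
    proof (rule sum_mono)
      fix y assume y: "y \<in> fib x"
      have "dist (h y) y < d" using h(2)[OF y] x' by (simp add: dist_commute)
      then show "\<bar>f (h y) - f y\<bar> \<le> e / (N + 1)"
        using d(2)[of "h y" y] hS[OF y] by (simp add: dist_real_def)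
    qed
    also have "\<dots> = card (fib x) * (e / (N + 1))" by simp
    also have "\<dots> \<le> N * (e / (N + 1))"
      using card_fib[OF x] e by (intro mult_right_mono) auto
    also have "\<dots> < e" using e by (simp add: field_simps)
    finally show "dist (L f x') (L f x) < e" by (simp add: dist_real_def)
  qed
qed

lemma L_add: "L (\<lambda>y. f y + g y) = (\<lambda>x. L f x + L g x)" by (rule ext) (simp add: L_def sum.distrib)

lemma L_cmult: "L (\<lambda>y. c * f y) = (\<lambda>x. c * L f x)" by (rule ext) (simp add: L_def sum_distrib_left)

lemma L_sum: "L (\<lambda>y. \<Sum>i\<in>I. f i y) = (\<lambda>x. \<Sum>i\<in>I. L (f i) x)"
  unfolding L_def by (intro ext sum.swap)

lemma L_mono: "(\<And>y. y \<in> S \<Longrightarrow> f y \<le> g y) \<Longrightarrow> L f x \<le> L g x"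
  unfolding L_def by (intro sum_mono) (auto simp: fib_iff)

lemma L_pos: "x \<in> S \<Longrightarrow> (\<And>y. y \<in> S \<Longrightarrow> 0 < f y) \<Longrightarrow> 0 < L f x"
  unfolding L_def by (intro sum_pos finite_fib fib_nonempty) (auto simp: fib_iff)

lemma L_ge: "y \<in> S \<Longrightarrow> (\<And>y. y \<in> S \<Longrightarrow> 0 \<le> f y) \<Longrightarrow> f y \<le> L f (\<alpha> y)"
  unfolding L_def by (intro member_le_sum finite_fib \<alpha>_in) (auto simp: fib_iff)

text \<open>A function of \<alpha> y is constant along a fibre. Hence L is itself a transfer
  operator on S, the one with cocycle 1.\<close>

lemma L_pull: "L (\<lambda>y. g (\<alpha> y) * f y) x = g x * L f x"
  unfolding L_def sum_distrib_left by (intro sum.cong) (auto simp: fib_iff)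

lemma L_one_le: "x \<in> S \<Longrightarrow> L (\<lambda>_. 1) x \<le> N"
  unfolding L_def using card_fib[of x] by simp

lemma Ln_continuous: "continuous_on S f \<Longrightarrow> continuous_on S ((L ^^ n) f)"
  by (induction n) (auto intro: L_continuous)

lemma Ln_mono: "(\<And>y. y \<in> S \<Longrightarrow> f y \<le> g y) \<Longrightarrow> x \<in> S \<Longrightarrow> (L ^^ n) f x \<le> (L ^^ n) g x"
  by (induction n arbitrary: x) (auto intro!: L_mono)

lemma Ln_add: "(L ^^ n) (\<lambda>y. f y + g y) = (\<lambda>x. (L ^^ n) f x + (L ^^ n) g x)"
  by (induction n) (simp_all add: L_add)

lemma Ln_cmult: "(L ^^ n) (\<lambda>y. c * f y) = (\<lambda>x. c * (L ^^ n) f x)"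
  by (induction n) (simp_all add: L_cmult)

lemma Ln_sum: "(L ^^ n) (\<lambda>y. \<Sum>i\<in>I. f i y) = (\<lambda>x. \<Sum>i\<in>I. (L ^^ n) (f i) x)"
  by (induction n) (simp_all add: L_sum)

lemma Ln_ge: "y \<in> S \<Longrightarrow> (\<And>y. y \<in> S \<Longrightarrow> 0 \<le> f y) \<Longrightarrow> f y \<le> (L ^^ n) f ((\<alpha> ^^ n) y)"
proof (induction n)
  case (Suc n)
  \<comment> \<open>Writing the zero function as a multiple by 0 lets \<open>Ln_cmult\<close>
    evaluate its image.\<close>
  have "0 \<le> (L ^^ n) f x" if "x \<in> S" for x
    using Ln_mono[of "\<lambda>_. 0 * 0" f x n] Suc.prems that Ln_cmult[of n 0 "\<lambda>_. 0"] by simp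
  then have "(L ^^ n) f ((\<alpha> ^^ n) y) \<le> (L ^^ Suc n) f ((\<alpha> ^^ Suc n) y)"
    using Suc.prems by (auto intro!: L_ge \<alpha>_pow_in)
  then show ?case using Suc by force
qed simp

lemma Ln_const_le: "x \<in> S \<Longrightarrow> 0 \<le> c \<Longrightarrow> (L ^^ n) (\<lambda>_. c) x \<le> c * real N ^ n"
proof (induction n arbitrary: x)
  case (Suc n)
  have "(L ^^ Suc n) (\<lambda>_. c) x \<le> L (\<lambda>_. (c * real N ^ n) * 1) x"
    using Suc by (auto intro!: L_mono)
  also have "\<dots> \<le> (c * real N ^ n) * N"
    unfolding L_cmult using Suc.prems by (intro mult_left_mono L_one_le) auto
  finally show ?case by (simp add: algebra_simps)
qed simp

end

section \<open>Invariant measures carried by S and the functional F\<close>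

locale supported_measure = noncontracting_cover +
  fixes \<mu> :: "'a measure"
  assumes sets_\<mu> [measurable_cong, simp]: "sets \<mu> = sets borel"
    and prob: "prob_space \<mu>"
    and invariant: "distr \<mu> borel \<alpha> = \<mu>"
    and AE_S: "AE x in \<mu>. x \<in> S"
begin

sublocale prob_space \<mu> by (rule prob)

lemma space_\<mu> [simp]: "space \<mu> = UNIV"
  using sets_eq_imp_space_eq[OF sets_\<mu>] by simp

lemma \<alpha>_measurable [measurable]: "\<alpha> \<in> borel \<rightarrow>\<^sub>M borel"
  by (rule borel_measurable_continuous_onI[OF \<alpha>_cont])

lemma \<alpha>_pow_measurable [measurable]: "(\<alpha> ^^ n) \<in> borel \<rightarrow>\<^sub>M borel"
  by (rule borel_measurable_continuous_onI[OF \<alpha>_pow_cont])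

lemma S_borel [measurable, simp]: "S \<in> sets borel"
  using S_closed by (rule borel_closed)

abbreviation "I f \<equiv> set_lebesgue_integral \<mu> S f"

lemma set_measurable_continuous:
  "continuous_on S (f :: 'a \<Rightarrow> real) \<Longrightarrow> set_borel_measurable \<mu> S f"
  unfolding set_borel_measurable_def
  by (subst measurable_cong_sets[OF sets_\<mu> refl]) (rule borel_measurable_continuous_on_indicator; simp)

lemma set_integrable_continuous:
  assumes f: "continuous_on S (f :: 'a \<Rightarrow> real)"
  shows "set_integrable \<mu> S f"
proof -
  have "bounded (f ` S)" using f S_compact by (intro compact_imp_bounded compact_continuous_image)
  then obtain B where B: "\<And>x. x \<in> S \<Longrightarrow> \<bar>f x\<bar> \<le> B" by (auto simp: bounded_iff)
  show ?thesis unfolding set_integrable_def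
  proof (rule integrable_const_bound[of _ "max 0 B"])
    show "AE x in \<mu>. norm (indicator S x *\<^sub>R f x) \<le> max 0 B"
      using B by (intro AE_I2) (auto simp: indicator_def le_max_iff_disj)
  qed (use set_measurable_continuous[OF f] in \<open>simp add: set_borel_measurable_def\<close>)
qed

lemma I_mono:
  "set_integrable \<mu> S f \<Longrightarrow> set_integrable \<mu> S g \<Longrightarrow> (\<And>x. x \<in> S \<Longrightarrow> f x \<le> g x) \<Longrightarrow> I f \<le> (I g :: real)"
  by (rule set_integral_mono) auto

lemma I_const [simp]: "I (\<lambda>_. c) = (c :: real)"
proof -
  have "I (\<lambda>_. c) = (\<integral>x. c \<partial>\<mu>)"
    unfolding set_lebesgue_integral_def
    by (intro integral_cong_AE) (use AE_S in \<open>auto simp: indicator_def\<close>)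
  then show ?thesis using prob_space by simp
qed

lemma I_integral:
  fixes f :: "'a \<Rightarrow> real"
  assumes "f \<in> borel_measurable borel"
  shows "integral\<^sup>L \<mu> f = I f"
  unfolding set_lebesgue_integral_def
  using assms by (intro integral_cong_AE) (use AE_S in \<open>auto simp: indicator_def\<close>)

lemma AE_\<alpha>:
  assumes "AE x in \<mu>. P x"
  shows "AE x in \<mu>. P (\<alpha> x)"
proof -
  obtain Z where Z: "{x. \<not> P x} \<subseteq> Z" "emeasure \<mu> Z = 0" "Z \<in> sets borel"
    using AE_E[OF assms] by auto
  have "emeasure \<mu> (\<alpha> -` Z) = emeasure (distr \<mu> borel \<alpha>) Z"
    using Z by (subst emeasure_distr) auto
  then have "emeasure \<mu> (\<alpha> -` Z) = 0" using Z invariant by simp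
  moreover have "\<alpha> -` Z \<in> sets \<mu>" using measurable_sets[OF \<alpha>_measurable Z(3)] by simp
  ultimately show ?thesis using Z(1) by (intro AE_I[of _ _ "\<alpha> -` Z"]) auto
qed

lemma AE_\<alpha>_pow: "AE x in \<mu>. P x \<Longrightarrow> AE x in \<mu>. P ((\<alpha> ^^ n) x)"
proof (induction n)
  case (Suc n)
  then show ?case using AE_\<alpha>[of "\<lambda>x. P ((\<alpha> ^^ n) x)"] by (simp add: funpow_swap1)
qed simp

text \<open>f is controlled only on S, so invariance is applied to its extension by 0. As \<alpha>
  maps S into S, composing the extension or f itself with \<alpha> gives the same function on
  S.\<close>

lemma
  fixes f :: "'a \<Rightarrow> real"
  assumes f: "set_integrable \<mu> S f"
  shows set_integrable_\<alpha>: "set_integrable \<mu> S (\<lambda>x. f (\<alpha> x))" and I_\<alpha>: "I (\<lambda>x. f (\<alpha> x)) = I f"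
proof -
  let ?g = "\<lambda>x. indicator S x *\<^sub>R f x"
  have g: "integrable \<mu> ?g" using f by (simp add: set_integrable_def)
  have gm[measurable]: "?g \<in> borel_measurable borel"
    using borel_measurable_integrable[OF g] unfolding measurable_cong_sets[OF sets_\<mu> refl] .
  have gi: "integrable \<mu> (\<lambda>x. ?g (\<alpha> x))" "(\<integral>x. ?g (\<alpha> x) \<partial>\<mu>) = integral\<^sup>L \<mu> ?g"
  proof -
    have \<alpha>m: "\<alpha> \<in> \<mu> \<rightarrow>\<^sub>M borel" by measurable
    have "integrable (distr \<mu> borel \<alpha>) ?g" using g invariant by simp
    then show "integrable \<mu> (\<lambda>x. ?g (\<alpha> x))" using integrable_distr_eq[OF \<alpha>m gm] by blast
    have "integral\<^sup>L (distr \<mu> borel \<alpha>) ?g = (\<integral>x. ?g (\<alpha> x) \<partial>\<mu>)" by (rule integral_distr[OF \<alpha>m gm])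
    then show "(\<integral>x. ?g (\<alpha> x) \<partial>\<mu>) = integral\<^sup>L \<mu> ?g" using invariant by simp
  qed
  have eq: "(\<lambda>x. indicator S x *\<^sub>R f (\<alpha> x)) = (\<lambda>x. indicator S x *\<^sub>R ?g (\<alpha> x))"
    by (auto simp: indicator_def \<alpha>_in)
  show "set_integrable \<mu> S (\<lambda>x. f (\<alpha> x))"
    unfolding set_integrable_def eq using gi(1) by (intro integrable_mult_indicator) auto
  have "I (\<lambda>x. f (\<alpha> x)) = (\<integral>x. ?g (\<alpha> x) \<partial>\<mu>)"
    unfolding set_lebesgue_integral_def eq
  proof (rule integral_cong_AE)
    show "AE x in \<mu>. indicator S x *\<^sub>R ?g (\<alpha> x) = ?g (\<alpha> x)"
      using AE_S by (auto simp: indicator_def)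
  qed measurable
  then show "I (\<lambda>x. f (\<alpha> x)) = I f" using gi(2) by (simp add: set_lebesgue_integral_def)
qed

lemma
  fixes f :: "'a \<Rightarrow> real"
  assumes f: "set_integrable \<mu> S f"
  shows set_integrable_\<alpha>_pow: "set_integrable \<mu> S (\<lambda>x. f ((\<alpha> ^^ n) x))" and I_\<alpha>_pow: "I (\<lambda>x. f ((\<alpha> ^^ n) x)) = I f"
proof -
  have "set_integrable \<mu> S (\<lambda>x. f ((\<alpha> ^^ n) x)) \<and> I (\<lambda>x. f ((\<alpha> ^^ n) x)) = I f"
  proof (induction n)
    case (Suc n)
    then show ?case
      using set_integrable_\<alpha>[of "\<lambda>x. f ((\<alpha> ^^ n) x)"] I_\<alpha>[of "\<lambda>x. f ((\<alpha> ^^ n) x)"]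
      by (simp add: funpow_swap1)
  qed (use f in simp)
  then show "set_integrable \<mu> S (\<lambda>x. f ((\<alpha> ^^ n) x))" "I (\<lambda>x. f ((\<alpha> ^^ n) x)) = I f" by auto
qed

text \<open>For positive \<open>f\<close>, \<open>q = f / (L f \<circ> \<alpha>)\<close> is a probability vector on each fibre, and
  \<open>V f\<close> is the integral of \<open>- ln q\<close>. The infimum \<open>F\<close> equals the entropy of \<open>\<mu>\<close>.\<close>

definition positive_functions :: "('a \<Rightarrow> real) set" where
  "positive_functions = {f. continuous_on S f \<and> (\<forall>x\<in>S. 0 < f x)}"

definition V :: "('a \<Rightarrow> real) \<Rightarrow> real" where
  "V f = I (\<lambda>x. ln (L f x)) - I (\<lambda>x. ln (f x))"

definition F :: real where "F = (INF f\<in>positive_functions. V f)"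

lemma positive_L: "f \<in> positive_functions \<Longrightarrow> L f \<in> positive_functions"
  by (auto simp: positive_functions_def intro: L_continuous L_pos)

lemma positive_Ln: "f \<in> positive_functions \<Longrightarrow> (L ^^ n) f \<in> positive_functions"
  by (induction n) (auto intro: positive_L)

lemma continuous_ln: "f \<in> positive_functions \<Longrightarrow> continuous_on S (\<lambda>x. ln (f x))"
  by (auto simp: positive_functions_def intro!: continuous_on_ln)

lemma integrable_ln: "f \<in> positive_functions \<Longrightarrow> set_integrable \<mu> S (\<lambda>x. ln (f x))"
  by (intro set_integrable_continuous continuous_ln)

text \<open>Each f is dominated by L f composed with \<alpha>, because x belongs to the fibre of
  \<alpha> x; invariance removes \<alpha> from the integral. This bounds the family from below, so
  that \<open>F\<close> is a genuine real infimum.\<close>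

lemma V_nonneg: "f \<in> positive_functions \<Longrightarrow> 0 \<le> V f"
proof -
  assume f: "f \<in> positive_functions"
  have "I (\<lambda>x. ln (f x)) \<le> I (\<lambda>x. ln (L f (\<alpha> x)))"
  proof (rule I_mono)
    show "set_integrable \<mu> S (\<lambda>x. ln (L f (\<alpha> x)))"
      by (rule set_integrable_\<alpha>[of "\<lambda>x. ln (L f x)"]) (intro integrable_ln positive_L f)
    fix x assume x: "x \<in> S"
    then show "ln (f x) \<le> ln (L f (\<alpha> x))"
      using f L_ge[OF x, of f] by (auto simp: positive_functions_def less_imp_le)
  qed (rule integrable_ln[OF f])
  also have "\<dots> = I (\<lambda>x. ln (L f x))"
    by (rule I_\<alpha>[of "\<lambda>x. ln (L f x)"]) (intro integrable_ln positive_L f)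
  finally show "0 \<le> V f" by (simp add: V_def)
qed

lemma one_positive: "(\<lambda>_. 1) \<in> positive_functions" by (simp add: positive_functions_def)

lemma F_le: "f \<in> positive_functions \<Longrightarrow> F \<le> V f"
  unfolding F_def by (rule cINF_lower) (auto intro!: bdd_belowI2[of _ 0] V_nonneg)

lemma F_approx:
  assumes "0 < e"
  obtains f where "f \<in> positive_functions" "V f < F + e"
proof -
  have "(INF f\<in>positive_functions. V f) < F + e" using assms by (simp add: F_def[symmetric])
  then show ?thesis
    using one_positive that by (subst (asm) cINF_less_iff) (auto intro!: bdd_belowI2[of _ 0] V_nonneg)
qed

lemma F_iterate:
  assumes f: "f \<in> positive_functions"
  shows "real n * F \<le> I (\<lambda>x. ln ((L ^^ n) f x)) - I (\<lambda>x. ln (f x))"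
proof (induction n)
  case (Suc n)
  have "F \<le> V ((L ^^ n) f)" by (intro F_le positive_Ln f)
  then show ?case using Suc by (simp add: V_def algebra_simps)
qed simp

end

section \<open>Entropy of partitions\<close>

text \<open>Fekete's argument: division of n by a nearly optimal k compares a n / n with a k / k,
  the remainder contributing at most the constant M. Convergence is needed because
  \<open>KS_entropy\<close> is defined by \<open>lim\<close>, which says nothing about divergent
  sequences.\<close>

lemma subadditive_converges:
  fixes a :: "nat \<Rightarrow> real"
  assumes sub: "\<And>n m. a (n + m) \<le> a n + a m" and nonneg: "\<And>n. 0 \<le> a n"
  shows "convergent (\<lambda>n. a n / real n)"
proof -
  \<comment> \<open>The index 0 is left out: \<open>a 0 / real 0\<close> is 0 and would falsify the
    infimum.\<close>
  define l where "l = (INF n\<in>{1..}. a n / real n)"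
  have bdd: "bdd_below ((\<lambda>n. a n / real n) ` {1..})"
    using nonneg by (intro bdd_belowI2[of _ 0]) auto
  have lower: "l \<le> a n / real n" if "1 \<le> n" for n
    unfolding l_def using bdd that by (intro cINF_lower) auto
  have mult: "a (q * k + s) \<le> real q * a k + a s" for q k s
  proof (induction q)
    case (Suc q)
    have "a (Suc q * k + s) \<le> a k + a (q * k + s)" using sub[of k "q * k + s"] by (simp add: add.assoc)
    then show ?case using Suc by (simp add: algebra_simps)
  qed simp
  have "(\<lambda>n. a n / real n) \<longlonglongrightarrow> l"
  proof (rule LIMSEQ_I)
    fix e :: real assume e: "0 < e"
    have "\<exists>k\<in>{1..}. a k / real k < l + e / 2"
      using cINF_less_iff[OF _ bdd, of "l + e / 2"] e unfolding l_def[symmetric] by auto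
    then obtain k where k: "1 \<le> k" "a k / real k < l + e / 2" by auto
    define M where "M = (\<Sum>s<k. a s)"
    have M: "a s \<le> M" if "s < k" for s
      unfolding M_def using that nonneg by (intro member_le_sum) auto
    obtain n0 :: nat where n0: "2 * M / e < n0" using reals_Archimedean2 by blast
    show "\<exists>n0. \<forall>n\<ge>n0. norm (a n / real n - l) < e"
    proof (intro exI[of _ "Suc n0"] allI impI)
      fix n assume n: "Suc n0 \<le> n"
      have np: "0 < real n" using n by simp
      have "a n = a (n div k * k + n mod k)" by simp
      also have "\<dots> \<le> real (n div k) * a k + a (n mod k)" by (rule mult)
      also have "\<dots> \<le> real (n div k) * a k + M" using k M[of "n mod k"] by simp
      also have "real (n div k) * a k = real (n div k * k) * (a k / real k)" using k by simp
      also have "\<dots> \<le> real n * (a k / real k)"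
        using nonneg[of k] by (intro mult_right_mono) (auto simp del: of_nat_mult)
      finally have "a n / real n \<le> a k / real k + M / real n"
        using np by (simp add: field_simps)
      moreover have "M / real n < e / 2"
      proof -
        have "2 * M / e < real n" using n0 n by simp
        then show ?thesis using e np by (simp add: field_simps)
      qed
      ultimately have "a n / real n < l + e" using k(2) by linarith
      then show "norm (a n / real n - l) < e" using lower[of n] n e by simp
    qed
  qed
  then show ?thesis by (rule convergentI)
qed

definition cell :: "'a set set \<Rightarrow> 'a \<Rightarrow> 'a set" where
  "cell P x = (THE D. D \<in> P \<and> x \<in> D)"

lemma cell_eq: "partition_on UNIV P \<Longrightarrow> D \<in> P \<Longrightarrow> x \<in> D \<Longrightarrow> cell P x = D"
  unfolding cell_def partition_on_def disjoint_def by (intro the_equality) auto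

lemma cell_in: "partition_on UNIV P \<Longrightarrow> cell P x \<in> P"
  and in_cell: "partition_on UNIV P \<Longrightarrow> x \<in> cell P x"
proof -
  assume P: "partition_on UNIV P"
  then obtain D where D: "D \<in> P" "x \<in> D" by (auto simp: partition_on_def)
  then show "cell P x \<in> P" "x \<in> cell P x" using cell_eq[OF P D] by auto
qed

lemma in_cell_iff: "partition_on UNIV P \<Longrightarrow> y \<in> cell P x \<longleftrightarrow> cell P y = cell P x"
  using cell_eq cell_in in_cell by metis

text \<open>Classes of points with equal itineraries. This form replaces the choice functions of
  \<open>dyn_refinement\<close> and lets an atom be indexed by any of its points.\<close>

definition atom :: "('a \<Rightarrow> 'a) \<Rightarrow> 'a set set \<Rightarrow> nat \<Rightarrow> 'a \<Rightarrow> 'a set" where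
  "atom \<alpha> P n x = {y. \<forall>i<n. cell P ((\<alpha> ^^ i) y) = cell P ((\<alpha> ^^ i) x)}"

lemma dyn_refinement_atoms:
  assumes P: "partition_on UNIV P"
  shows "dyn_refinement \<alpha> P n = range (atom \<alpha> P n)"
proof (intro set_eqI iffI)
  fix D assume "D \<in> dyn_refinement \<alpha> P n"
  then obtain s where s: "s \<in> {..<n} \<rightarrow>\<^sub>E P" "D = (\<Inter>i<n. (\<alpha> ^^ i) -` s i)" "D \<noteq> {}"
    by (auto simp: dyn_refinement_def)
  then obtain x where x: "x \<in> D" by auto
  have "s i = cell P ((\<alpha> ^^ i) x)" if "i < n" for i
    using s x that by (intro cell_eq[OF P, symmetric]) auto
  then have "D = atom \<alpha> P n x"
    using s by (auto simp: atom_def in_cell_iff[OF P])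
  then show "D \<in> range (atom \<alpha> P n)" by auto
next
  fix D assume "D \<in> range (atom \<alpha> P n)"
  then obtain x where D: "D = atom \<alpha> P n x" by auto
  let ?s = "\<lambda>i\<in>{..<n}. cell P ((\<alpha> ^^ i) x)"
  have "D = (\<Inter>i<n. (\<alpha> ^^ i) -` ?s i)"
    unfolding D atom_def by (auto simp: in_cell_iff[OF P])
  moreover have "?s \<in> {..<n} \<rightarrow>\<^sub>E P" using cell_in[OF P] by auto
  moreover have "x \<in> D" by (simp add: D atom_def)
  ultimately show "D \<in> dyn_refinement \<alpha> P n" unfolding dyn_refinement_def by blast
qed

lemma partition_on_atoms:
  assumes "partition_on UNIV P"
  shows "partition_on UNIV (dyn_refinement \<alpha> P n)"
  unfolding dyn_refinement_atoms[OF assms]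
  by (rule partition_onI) (auto simp: atom_def disjnt_def)

lemma cell_dyn_refinement:
  assumes "partition_on UNIV P"
  shows "cell (dyn_refinement \<alpha> P n) x = atom \<alpha> P n x"
  by (rule cell_eq[OF partition_on_atoms[OF assms]])
     (auto simp: dyn_refinement_atoms[OF assms] atom_def)

section \<open>Entropy of an invariant measure along the refinements of a partition\<close>

locale invariant_measure =
  fixes \<alpha> :: "'a::metric_space \<Rightarrow> 'a" and \<mu> :: "'a measure"
  assumes sets_borel: "sets \<mu> = sets borel"
    and prob_\<mu>: "prob_space \<mu>"
    and measurable_\<alpha>: "\<alpha> \<in> borel \<rightarrow>\<^sub>M borel"
    and distr_\<alpha>: "distr \<mu> borel \<alpha> = \<mu>"
begin

sublocale prob_space \<mu> by (rule prob_\<mu>)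

lemma space_UNIV: "space \<mu> = UNIV"
  using sets_eq_imp_space_eq[OF sets_borel] by simp

lemma measurable_\<alpha>_pow: "(\<alpha> ^^ n) \<in> borel \<rightarrow>\<^sub>M borel"
proof (induction n)
  case (Suc n)
  then show ?case using measurable_comp[OF Suc measurable_\<alpha>] by (simp add: comp_def)
qed (simp add: id_def)

lemma distr_\<alpha>_pow: "distr \<mu> borel (\<alpha> ^^ n) = \<mu>"
proof (induction n)
  case 0
  show ?case using sets_borel by (simp add: distr_id2 id_def)
next
  case (Suc n)
  have "distr (distr \<mu> borel (\<alpha> ^^ n)) borel \<alpha> = distr \<mu> borel (\<alpha> \<circ> \<alpha> ^^ n)"
    by (rule distr_distr[OF measurable_\<alpha>])
       (use measurable_\<alpha>_pow in \<open>simp add: measurable_cong_sets[OF sets_borel refl]\<close>)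
  then show ?case using Suc distr_\<alpha> by (simp add: comp_def)
qed

lemma sum_measure_partition:
  assumes "P \<in> borel_partitions"
  shows "(\<Sum>D\<in>P. measure \<mu> D) = 1"
proof -
  have "measure \<mu> (\<Union>D\<in>P. D) = (\<Sum>D\<in>P. measure \<mu> D)"
    using assms sets_borel
    by (intro finite_measure_finite_Union)
       (auto simp: borel_partitions_def partition_on_def disjoint_family_on_def disjoint_def)
  moreover have "(\<Union>D\<in>P. D) = space \<mu>"
    using assms by (auto simp: borel_partitions_def partition_on_def space_UNIV)
  ultimately show ?thesis using prob_space by simp
qed

text \<open>Turns sums over cells into integrals over points. Entropies become integrals of minus
  the logarithm of the measure of the cell of x, which can be compared almost everywhere and
  composed with \<alpha>.\<close>

lemma cell_integral:
  fixes g :: "'a set \<Rightarrow> real"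
  assumes P: "P \<in> borel_partitions"
  shows "integrable \<mu> (\<lambda>x. g (cell P x))" "(\<integral>x. g (cell P x) \<partial>\<mu>) = (\<Sum>D\<in>P. measure \<mu> D * g D)"
proof -
  have part: "partition_on UNIV P" and fin: "finite P" and bor: "P \<subseteq> sets \<mu>"
    using P sets_borel by (auto simp: borel_partitions_def)
  have eq: "(\<lambda>x. g (cell P x)) = (\<lambda>x. \<Sum>D\<in>P. indicator D x * g D)"
  proof
    fix x
    have "(\<Sum>D\<in>P. indicator D x * g D) = (\<Sum>D\<in>{cell P x}. indicator D x * g D)"
      using fin cell_in[OF part, of x] cell_eq[OF part, of _ x]
      by (intro sum.mono_neutral_right) (auto simp: indicator_def)
    then show "g (cell P x) = (\<Sum>D\<in>P. indicator D x * g D)"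
      using in_cell[OF part, of x] by simp
  qed
  show "integrable \<mu> (\<lambda>x. g (cell P x))"
    unfolding eq using bor
    by (intro Bochner_Integration.integrable_sum integrable_mult_left)
       (auto intro!: integrable_real_indicator simp: less_top[symmetric])
  have "(\<integral>x. (\<Sum>D\<in>P. indicator D x * g D) \<partial>\<mu>) = (\<Sum>D\<in>P. \<integral>x. indicator D x * g D \<partial>\<mu>)"
    using bor by (intro Bochner_Integration.integral_sum integrable_mult_left)
       (auto intro!: integrable_real_indicator simp: less_top[symmetric])
  also have "\<dots> = (\<Sum>D\<in>P. measure \<mu> D * g D)"
    using bor sets.sets_into_space by (intro sum.cong) (auto simp: Int_absorb1 Int_absorb2 space_UNIV)
  finally show "(\<integral>x. g (cell P x) \<partial>\<mu>) = (\<Sum>D\<in>P. measure \<mu> D * g D)"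
    unfolding eq .
qed

lemma AE_cell_pos:
  assumes P: "P \<in> borel_partitions"
  shows "AE x in \<mu>. 0 < measure \<mu> (cell P x)"
proof -
  have part: "partition_on UNIV P" using P by (simp add: borel_partitions_def)
  define Z where "Z = (\<Union>D\<in>{D \<in> P. measure \<mu> D = 0}. D)"
  have "Z \<in> null_sets \<mu>"
    unfolding Z_def using P sets_borel
    by (intro null_sets.finite_UN) (auto simp: borel_partitions_def null_sets_def emeasure_eq_measure)
  moreover have "{x \<in> space \<mu>. \<not> 0 < measure \<mu> (cell P x)} \<subseteq> Z"
    using in_cell[OF part] cell_in[OF part] by (auto simp: Z_def zero_less_measure_iff)
  ultimately show ?thesis by (rule AE_I')
qed

text \<open>Apply \<open>ln t \<le> t - 1\<close> to the ratio of w D to the measure of D; total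
  weight at most 1 is all that enters. Positivity of w on cells of positive measure guards against
  the convention \<open>ln 0 = 0\<close>, under which a weight 0 would count as cheap.\<close>

lemma Gibbs_inequality:
  assumes P: "P \<in> borel_partitions"
    and w: "\<And>D. D \<in> P \<Longrightarrow> 0 \<le> w D" "(\<Sum>D\<in>P. w D) \<le> 1"
    and pos: "\<And>D. D \<in> P \<Longrightarrow> 0 < measure \<mu> D \<Longrightarrow> 0 < w D"
  shows "partition_entropy \<mu> P \<le> - (\<Sum>D\<in>P. measure \<mu> D * ln (w D))"
proof -
  have "(\<Sum>D\<in>P. measure \<mu> D * ln (w D) - measure \<mu> D * ln (measure \<mu> D))
      \<le> (\<Sum>D\<in>P. w D - measure \<mu> D)"
  proof (rule sum_mono)
    fix D assume D: "D \<in> P"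
    show "measure \<mu> D * ln (w D) - measure \<mu> D * ln (measure \<mu> D) \<le> w D - measure \<mu> D"
    proof (cases "measure \<mu> D = 0")
      case False
      then have m: "0 < measure \<mu> D" by (simp add: zero_less_measure_iff)
      then have wD: "0 < w D" using pos D by simp
      have "ln (w D / measure \<mu> D) \<le> w D / measure \<mu> D - 1"
        using m wD by (intro ln_le_minus_one) simp
      then have "measure \<mu> D * ln (w D / measure \<mu> D) \<le> measure \<mu> D * (w D / measure \<mu> D - 1)"
        using m by (intro mult_left_mono) auto
      then show ?thesis using m wD by (simp add: ln_div right_diff_distrib)
    qed (use w(1)[OF D] in simp)
  qed
  then show ?thesis
    using sum_measure_partition[OF P] w(2) by (simp add: partition_entropy_def sum_subtractf)
qed

lemma partition_entropy_nonneg: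
  "0 \<le> partition_entropy \<mu> P"
proof -
  have "measure \<mu> D * ln (measure \<mu> D) \<le> 0" for D
    by (cases "measure \<mu> D = 0") (auto intro!: mult_nonneg_nonpos simp: zero_less_measure_iff)
  then show ?thesis by (simp add: partition_entropy_def sum_nonpos)
qed

lemma dyn_refinement_borel:
  assumes P: "P \<in> borel_partitions"
  shows "dyn_refinement \<alpha> P n \<in> borel_partitions"
proof -
  have fin: "finite P" and part: "partition_on UNIV P" and bor: "P \<subseteq> sets borel"
    using P by (auto simp: borel_partitions_def)
  have "finite (dyn_refinement \<alpha> P n)"
    unfolding dyn_refinement_def using fin by (intro finite_Diff finite_imageI finite_PiE) auto
  moreover have "D \<in> sets borel" if D: "D \<in> dyn_refinement \<alpha> P n" for D
  proof (cases "n = 0")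
    case True
    then show ?thesis using D by (auto simp: dyn_refinement_def)
  next
    case False
    obtain s where s: "s \<in> {..<n} \<rightarrow>\<^sub>E P" "D = (\<Inter>i<n. (\<alpha> ^^ i) -` s i)"
      using D by (auto simp: dyn_refinement_def)
    have "(\<alpha> ^^ i) -` s i \<in> sets borel" if "i < n" for i
      using measurable_sets[OF measurable_\<alpha>_pow, of "s i" i] s that bor by (auto simp: PiE_iff)
    then show ?thesis unfolding s(2) using False by (intro sets.finite_INT) auto
  qed
  ultimately show ?thesis
    using partition_on_atoms[OF part] by (auto simp: borel_partitions_def)
qed

lemma measure_vimage_pow: "B \<in> sets borel \<Longrightarrow> measure \<mu> ((\<alpha> ^^ n) -` B) = measure \<mu> B"
  using measure_distr[of "\<alpha> ^^ n" \<mu> borel B] distr_\<alpha>_pow[of n] measurable_\<alpha>_pow[of n]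
  by (simp add: measurable_cong_sets[OF sets_borel refl] space_UNIV)

text \<open>An atom of length n + m is the intersection of an atom of length n and the preimage
  under \<alpha>^n of an atom of length m. The product of their measures is a weight admissible in
  the Gibbs inequality; its logarithm splits, and invariance removes \<alpha>^n from the second
  part.\<close>

lemma entropy_subadditive:
  assumes P: "P \<in> borel_partitions"
  shows "partition_entropy \<mu> (dyn_refinement \<alpha> P (n + m))
    \<le> partition_entropy \<mu> (dyn_refinement \<alpha> P n) + partition_entropy \<mu> (dyn_refinement \<alpha> P m)"
proof -
  have part: "partition_on UNIV P" using P by (simp add: borel_partitions_def)
  note bp = dyn_refinement_borel[OF P]
  define p where "p k x = measure \<mu> (atom \<alpha> P k x)" for k x
  have self: "x \<in> atom \<alpha> P k x" for k x by (simp add: atom_def)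
  have atom_eq: "y \<in> atom \<alpha> P k x \<Longrightarrow> atom \<alpha> P k y = atom \<alpha> P k x" for x y k
    by (auto simp: atom_def)
  have split: "y \<in> atom \<alpha> P (n + m) x \<longleftrightarrow> y \<in> atom \<alpha> P n x \<and> (\<alpha> ^^ n) y \<in> atom \<alpha> P m ((\<alpha> ^^ n) x)" for x y
  proof -
    have pow: "(\<alpha> ^^ i) ((\<alpha> ^^ n) z) = (\<alpha> ^^ (n + i)) z" for i z
      by (metis add.commute funpow_add comp_apply)
    show ?thesis unfolding atom_def mem_Collect_eq pow
    proof (intro iffI conjI allI impI)
      fix i assume *: "(\<forall>i<n. cell P ((\<alpha> ^^ i) y) = cell P ((\<alpha> ^^ i) x)) \<and>
        (\<forall>i<m. cell P ((\<alpha> ^^ (n + i)) y) = cell P ((\<alpha> ^^ (n + i)) x))" and i: "i < n + m"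
      show "cell P ((\<alpha> ^^ i) y) = cell P ((\<alpha> ^^ i) x)"
      proof (cases "i < n")
        case False
        then have "i = n + (i - n)" "i - n < m" using i by auto
        then show ?thesis using * by metis
      qed (use * in auto)
    qed auto
  qed
  have atom_bor: "atom \<alpha> P k x \<in> sets borel" for k x
    using bp[of k] by (auto simp: borel_partitions_def dyn_refinement_atoms[OF part])
  \<comment> \<open>The weight has to be a function of the atom, so it is read off at an arbitrary
    point of it; \<open>w_eq\<close> shows that the choice does not matter.\<close>
  define w where "w D = (let x = SOME x. x \<in> D in p n x * p m ((\<alpha> ^^ n) x))" for D
  have w_eq: "w (atom \<alpha> P (n + m) x) = p n x * p m ((\<alpha> ^^ n) x)" for x
  proof -
    define y where "y = (SOME y. y \<in> atom \<alpha> P (n + m) x)"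
    have "y \<in> atom \<alpha> P (n + m) x" unfolding y_def using self by (rule someI)
    then have "atom \<alpha> P n y = atom \<alpha> P n x" "atom \<alpha> P m ((\<alpha> ^^ n) y) = atom \<alpha> P m ((\<alpha> ^^ n) x)"
      unfolding split using atom_eq by blast+
    then show ?thesis unfolding w_def y_def[symmetric] Let_def p_def by simp
  qed
  have p_le: "measure \<mu> (atom \<alpha> P (n + m) x) \<le> p n x" "measure \<mu> (atom \<alpha> P (n + m) x) \<le> p m ((\<alpha> ^^ n) x)" for x
  proof -
    show "measure \<mu> (atom \<alpha> P (n + m) x) \<le> p n x"
      unfolding p_def using split atom_bor sets_borel by (intro finite_measure_mono) auto
    have "measure \<mu> (atom \<alpha> P (n + m) x) \<le> measure \<mu> ((\<alpha> ^^ n) -` atom \<alpha> P m ((\<alpha> ^^ n) x))"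
      using split atom_bor sets_borel measurable_sets[OF measurable_\<alpha>_pow atom_bor]
      by (intro finite_measure_mono) auto
    then show "measure \<mu> (atom \<alpha> P (n + m) x) \<le> p m ((\<alpha> ^^ n) x)"
      unfolding p_def using measure_vimage_pow[OF atom_bor] by simp
  qed
  have ent: "partition_entropy \<mu> (dyn_refinement \<alpha> P k) = - (\<integral>x. ln (p k x) \<partial>\<mu>)"
    "integrable \<mu> (\<lambda>x. ln (p k x))" for k
    using cell_integral[OF bp[of k], of "\<lambda>D. ln (measure \<mu> D)"]
    by (simp_all add: partition_entropy_def p_def cell_dyn_refinement[OF part])
  have "partition_entropy \<mu> (dyn_refinement \<alpha> P (n + m))
      \<le> - (\<Sum>D\<in>dyn_refinement \<alpha> P (n + m). measure \<mu> D * ln (w D))"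
  proof (rule Gibbs_inequality[OF bp])
    fix D assume "D \<in> dyn_refinement \<alpha> P (n + m)"
    then obtain x where D: "D = atom \<alpha> P (n + m) x" by (auto simp: dyn_refinement_atoms[OF part])
    show "0 \<le> w D" by (simp add: D w_eq p_def)
    show "0 < w D" if "0 < measure \<mu> D"
      using that p_le[of x] by (auto simp: D w_eq intro!: mult_pos_pos)
  next
    let ?N = "dyn_refinement \<alpha> P n" and ?M = "dyn_refinement \<alpha> P m"
    \<comment> \<open>The pair of atoms that determines D. Injectivity places the weights among the
      products over all pairs, and these sum to 1.\<close>
    define h where "h D = (let x = SOME x. x \<in> D in (atom \<alpha> P n x, atom \<alpha> P m ((\<alpha> ^^ n) x)))" for D
    have h_eq: "h (atom \<alpha> P (n + m) x) = (atom \<alpha> P n x, atom \<alpha> P m ((\<alpha> ^^ n) x))" for x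
    proof -
      define y where "y = (SOME y. y \<in> atom \<alpha> P (n + m) x)"
      have "y \<in> atom \<alpha> P (n + m) x" unfolding y_def using self by (rule someI)
      then have "atom \<alpha> P n y = atom \<alpha> P n x" "atom \<alpha> P m ((\<alpha> ^^ n) y) = atom \<alpha> P m ((\<alpha> ^^ n) x)"
        unfolding split using atom_eq by blast+
      then show ?thesis unfolding h_def y_def[symmetric] Let_def by simp
    qed
    have inj: "inj_on h (dyn_refinement \<alpha> P (n + m))"
    proof (rule inj_onI)
      fix D E assume "D \<in> dyn_refinement \<alpha> P (n + m)" "E \<in> dyn_refinement \<alpha> P (n + m)" and eq: "h D = h E"
      then obtain x y where D: "D = atom \<alpha> P (n + m) x" "E = atom \<alpha> P (n + m) y"
        by (auto simp: dyn_refinement_atoms[OF part])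
      then have "atom \<alpha> P n x = atom \<alpha> P n y" "atom \<alpha> P m ((\<alpha> ^^ n) x) = atom \<alpha> P m ((\<alpha> ^^ n) y)"
        using eq by (auto simp: h_eq)
      then have "x \<in> atom \<alpha> P (n + m) y" using self unfolding split by blast
      then show "D = E" using D atom_eq by simp
    qed
    have "(\<Sum>D\<in>dyn_refinement \<alpha> P (n + m). w D)
        = (\<Sum>D\<in>dyn_refinement \<alpha> P (n + m). (\<lambda>(E, E'). measure \<mu> E * measure \<mu> E') (h D))"
      by (intro sum.cong) (auto simp: dyn_refinement_atoms[OF part] w_eq h_eq p_def)
    also have "\<dots> = (\<Sum>(E, E')\<in>h ` dyn_refinement \<alpha> P (n + m). measure \<mu> E * measure \<mu> E')"
      by (simp add: sum.reindex[OF inj])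
    also have "\<dots> \<le> (\<Sum>(E, E')\<in>?N \<times> ?M. measure \<mu> E * measure \<mu> E')"
      using bp[of n] bp[of m]
      by (intro sum_mono2) (auto simp: borel_partitions_def dyn_refinement_atoms[OF part] h_eq)
    also have "\<dots> = (\<Sum>E\<in>?N. measure \<mu> E) * (\<Sum>E\<in>?M. measure \<mu> E)"
      by (simp add: sum_product sum.cartesian_product)
    also have "\<dots> = 1" using sum_measure_partition[OF bp] by simp
    finally show "(\<Sum>D\<in>dyn_refinement \<alpha> P (n + m). w D) \<le> 1" .
  qed
  also have "(\<Sum>D\<in>dyn_refinement \<alpha> P (n + m). measure \<mu> D * ln (w D))
      = (\<integral>x. ln (p n x * p m ((\<alpha> ^^ n) x)) \<partial>\<mu>)"
    using cell_integral(2)[OF bp[of "n + m"], of "\<lambda>D. ln (w D)"]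
    by (simp add: cell_dyn_refinement[OF part] w_eq)
  also have "\<dots> = (\<integral>x. ln (p n x) + ln (p m ((\<alpha> ^^ n) x)) \<partial>\<mu>)"
  proof (rule integral_cong_AE)
    show "AE x in \<mu>. ln (p n x * p m ((\<alpha> ^^ n) x)) = ln (p n x) + ln (p m ((\<alpha> ^^ n) x))"
      using AE_cell_pos[OF bp[of "n + m"]]
    proof eventually_elim
      case (elim x)
      then have "0 < p n x" "0 < p m ((\<alpha> ^^ n) x)"
        using p_le[of x] by (auto simp: cell_dyn_refinement[OF part])
      then show ?case by (simp add: ln_mult)
    qed
    have meas: "(\<lambda>x. ln (p k x)) \<in> borel_measurable borel" for k
      using borel_measurable_integrable[OF ent(2)[of k]] by (simp add: measurable_cong_sets[OF sets_borel refl])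
    show "(\<lambda>x. ln (p n x) + ln (p m ((\<alpha> ^^ n) x))) \<in> borel_measurable \<mu>"
      using meas[of n] measurable_compose[OF measurable_\<alpha>_pow meas[of m]]
      by (simp add: measurable_cong_sets[OF sets_borel refl])
    show "(\<lambda>x. ln (p n x * p m ((\<alpha> ^^ n) x))) \<in> borel_measurable \<mu>"
      using cell_integral(1)[OF bp[of "n + m"], of "\<lambda>D. ln (w D)"]
      by (simp add: cell_dyn_refinement[OF part] w_eq borel_measurable_integrable)
  qed
  also have "\<dots> = (\<integral>x. ln (p n x) \<partial>\<mu>) + (\<integral>x. ln (p m x) \<partial>\<mu>)"
  proof -
    have meas: "(\<lambda>x. ln (p m x)) \<in> borel_measurable borel"
      using borel_measurable_integrable[OF ent(2)[of m]] by (simp add: measurable_cong_sets[OF sets_borel refl])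
    have \<alpha>m: "\<alpha> ^^ n \<in> \<mu> \<rightarrow>\<^sub>M borel"
      using measurable_\<alpha>_pow by (simp add: measurable_cong_sets[OF sets_borel refl])
    have i: "integrable \<mu> (\<lambda>x. ln (p m ((\<alpha> ^^ n) x)))"
      using integrable_distr_eq[OF \<alpha>m meas] ent(2)[of m] distr_\<alpha>_pow[of n] by simp
    have "(\<integral>x. ln (p m ((\<alpha> ^^ n) x)) \<partial>\<mu>) = (\<integral>x. ln (p m x) \<partial>\<mu>)"
      using integral_distr[OF \<alpha>m meas] distr_\<alpha>_pow[of n] by simp
    then show ?thesis using ent(2)[of n] i by simp
  qed
  finally show ?thesis using ent(1)[of n] ent(1)[of m] by simp
qed

lemma entropy_LIMSEQ:
  assumes P: "P \<in> borel_partitions"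
  shows "(\<lambda>n. partition_entropy \<mu> (dyn_refinement \<alpha> P n) / real n)
    \<longlonglongrightarrow> lim (\<lambda>n. partition_entropy \<mu> (dyn_refinement \<alpha> P n) / real n)"
  unfolding convergent_LIMSEQ_iff[symmetric]
  by (intro subadditive_converges entropy_subadditive partition_entropy_nonneg P)

lemma KS_entropy_ge:
  assumes P: "P \<in> borel_partitions"
    and le: "\<And>n. real n * c \<le> partition_entropy \<mu> (dyn_refinement \<alpha> P n)"
  shows "ereal c \<le> KS_entropy \<alpha> \<mu>"
proof -
  have "c \<le> lim (\<lambda>n. partition_entropy \<mu> (dyn_refinement \<alpha> P n) / real n)"
  proof (rule LIMSEQ_le_const[OF entropy_LIMSEQ[OF P]])
    show "\<exists>N. \<forall>n\<ge>N. c \<le> partition_entropy \<mu> (dyn_refinement \<alpha> P n) / real n"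
      using le by (intro exI[of _ 1]) (auto simp: field_simps)
  qed
  then show ?thesis unfolding KS_entropy_def by (intro SUP_upper2[OF P]) simp
qed

lemma KS_entropy_le:
  assumes le: "\<And>P e. P \<in> borel_partitions \<Longrightarrow> 0 < e \<Longrightarrow>
    \<exists>K. \<forall>n. partition_entropy \<mu> (dyn_refinement \<alpha> P n) \<le> real n * (c + e) + K"
  shows "KS_entropy \<alpha> \<mu> \<le> ereal c"
  unfolding KS_entropy_def
proof (rule SUP_least)
  fix P assume P: "P \<in> (borel_partitions :: 'a set set set)"
  have "lim (\<lambda>n. partition_entropy \<mu> (dyn_refinement \<alpha> P n) / real n) \<le> c"
  proof (rule field_le_epsilon)
    fix e :: real assume "0 < e"
    then obtain K where K: "\<And>n. partition_entropy \<mu> (dyn_refinement \<alpha> P n) \<le> real n * (c + e) + K"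
      using le[OF P] by blast
    have "(\<lambda>n. c + e + K / real n) \<longlonglongrightarrow> c + e + 0"
      by (intro tendsto_intros lim_const_over_n)
    moreover have "\<exists>N. \<forall>n\<ge>N. partition_entropy \<mu> (dyn_refinement \<alpha> P n) / real n \<le> c + e + K / real n"
      using K by (intro exI[of _ 1]) (auto simp: field_simps)
    ultimately show "lim (\<lambda>n. partition_entropy \<mu> (dyn_refinement \<alpha> P n) / real n) \<le> c + e"
      using LIMSEQ_le[OF entropy_LIMSEQ[OF P]] by fastforce
  qed
  then show "ereal (lim (\<lambda>n. partition_entropy \<mu> (dyn_refinement \<alpha> P n) / real n)) \<le> ereal c" by simp
qed

end

section \<open>Entropy of a non-contracting cover\<close>

text \<open>Asking for inner and outer approximation together makes the property symmetric under
  complements, which is what an induction over the generated sigma-algebra needs.\<close>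

lemma borel_closed_open_approximation:
  fixes M :: "'a::metric_space measure"
  assumes M: "sets M = sets borel" "finite_measure M" and B: "B \<in> sets borel" and e: "0 < e"
  shows "\<exists>K U. closed K \<and> open U \<and> K \<subseteq> B \<and> B \<subseteq> U \<and> measure M (U - K) < e"
proof -
  interpret finite_measure M by fact
  have "B \<in> sigma_sets UNIV {U. open U}" using B by (simp add: borel_def)
  then show ?thesis using e
  proof (induction arbitrary: e rule: sigma_sets.induct)
    case (Basic U)
    then have U: "open U" by simp
    obtain f :: "nat \<Rightarrow> 'a \<Rightarrow> real" where f: "\<And>n. f n \<in> CX" "\<And>n x. 0 \<le> f n x" "\<And>n x. f n x \<le> 1"
      "\<And>n x. x \<notin> U \<Longrightarrow> f n x = 0" "\<And>x. x \<in> U \<Longrightarrow> \<exists>n0. \<forall>n\<ge>n0. f n x = 1" "\<And>x. incseq (\<lambda>n. f n x)"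
      using open_Sup_CX[OF U] by metis
    define K where "K n = {x. 1 \<le> f n x}" for n
    have K: "closed (K n)" "K n \<subseteq> U" for n
      unfolding K_def using f(1)[of n] f(4)[of _ n] 
      by (auto intro!: closed_Collect_le simp: CX_def) (metis not_one_le_zero)
    have lim: "(\<lambda>n. measure M (U - K n)) \<longlonglongrightarrow> measure M (\<Inter>n. U - K n)"
    proof (rule finite_Lim_measure_decseq)
      show "range (\<lambda>n. U - K n) \<subseteq> sets M"
        using borel_open[OF U] borel_closed[OF K(1)] by (auto simp: M(1))
      show "decseq (\<lambda>n. U - K n)"
        using f(6) by (fastforce simp: decseq_def K_def incseq_def intro: order_trans)
    qed
    have "\<exists>n. x \<in> K n" if "x \<in> U" for x
      using f(5)[OF that] unfolding K_def by (metis mem_Collect_eq order_refl)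
    then have "(\<Inter>n. U - K n) = {}" by auto
    moreover note lim
    ultimately have "(\<lambda>n. measure M (U - K n)) \<longlonglongrightarrow> measure M {}" by (simp only:)
    then have "(\<lambda>n. measure M (U - K n)) \<longlonglongrightarrow> 0" by simp
    then have "eventually (\<lambda>n. measure M (U - K n) < e) sequentially"
      using Basic.prems by (intro order_tendstoD(2)) auto
    then obtain n where "measure M (U - K n) < e" by (auto simp: eventually_sequentially)
    then show ?case using K U by blast
  next
    case Empty
    then show ?case by (intro exI[of _ "{}"]) auto
  next
    case (Compl A)
    obtain K U where KU: "closed K" "open U" "K \<subseteq> A" "A \<subseteq> U" "measure M (U - K) < e"
      using Compl.IH[OF Compl.prems] by auto
    have eq: "(- K) - (- U) = U - K" by auto
    show ?case
    proof (intro exI conjI)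
      show "closed (- U)" using KU(2) by (rule closed_Compl)
      show "open (- K)" using KU(1) by (rule open_Compl)
      show "measure M ((- K) - (- U)) < e" unfolding eq by (rule KU(5))
    qed (use KU(3,4) in blast)+
  next
    case (Union A)
    have "\<exists>K U. closed K \<and> open U \<and> K \<subseteq> A i \<and> A i \<subseteq> U \<and> measure M (U - K) < (e / 2) * (1/2) ^ Suc i" for i
      using Union.IH[of "(e / 2) * (1/2) ^ Suc i" i] Union.prems by simp
    then obtain K U where KU: "\<And>i. closed (K i)" "\<And>i. open (U i)" "\<And>i. K i \<subseteq> A i" "\<And>i. A i \<subseteq> U i"
      "\<And>i. measure M (U i - K i) < (e / 2) * (1/2) ^ Suc i" by metis
    have bor: "K i \<in> sets M" "U i \<in> sets M" for i using KU(1,2) by (auto simp: M(1))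
    have geo: "(\<lambda>i. (e / 2) * (1/2) ^ Suc i) sums (e / 2)"
      using sums_mult[OF power_half_series, of "e / 2"] by simp
    have summ: "summable (\<lambda>i. measure M (U i - K i))"
      by (rule summable_comparison_test'[OF sums_summable[OF geo], of 0])
         (use KU(5) in \<open>auto intro: less_imp_le\<close>)
    have "measure M (\<Union>i. U i - K i) \<le> (\<Sum>i. measure M (U i - K i))"
      using bor summ by (intro finite_measure_subadditive_countably) auto
    also have "\<dots> \<le> e / 2"
      using suminf_le[OF less_imp_le[OF KU(5)] summ sums_summable[OF geo]] sums_unique[OF geo] by simp
    finally have le1: "measure M (\<Union>i. U i - K i) \<le> e / 2" .
    \<comment> \<open>A countable union of closed sets need not be closed, so finitely many are
      kept. The first e / 2 paid for the individual gaps, the second pays for the tail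
      \<open>V n\<close>, which decreases to the empty set.\<close>
    define V where "V n = (\<Union>i. K i) - (\<Union>i<n. K i)" for n
    have "(\<lambda>n. measure M (V n)) \<longlonglongrightarrow> measure M (\<Inter>n. V n)"
    proof (rule finite_Lim_measure_decseq)
      show "range V \<subseteq> sets M" unfolding V_def using bor by auto
      show "decseq V" unfolding V_def decseq_def by (auto dest: order_less_le_trans)
    qed
    moreover have "(\<Inter>n. V n) = {}" unfolding V_def by auto
    ultimately have "(\<lambda>n. measure M (V n)) \<longlonglongrightarrow> 0" by simp
    then have "eventually (\<lambda>n. measure M (V n) < e / 2) sequentially"
      using Union.prems by (intro order_tendstoD(2)) auto
    then obtain n where n: "measure M (V n) < e / 2" by (auto simp: eventually_sequentially)
    have "measure M ((\<Union>i. U i) - (\<Union>i<n. K i)) \<le> measure M ((\<Union>i. U i - K i) \<union> V n)"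
      using bor by (intro finite_measure_mono) (auto simp: V_def)
    also have "\<dots> \<le> measure M (\<Union>i. U i - K i) + measure M (V n)"
      using bor by (intro measure_Un_le) (auto simp: V_def)
    also have "\<dots> < e" using le1 n by simp
    finally have "measure M ((\<Union>i. U i) - (\<Union>i<n. K i)) < e" .
    then show ?case
    proof (intro exI conjI)
      show "closed (\<Union>i<n. K i)" using KU(1) by (intro closed_UN) auto
      show "open (\<Union>i. U i)" using KU(2) by (intro open_UN) auto
      show "(\<Union>i<n. K i) \<subseteq> \<Union> (range A)" "\<Union> (range A) \<subseteq> (\<Union>i. U i)" using KU(3,4) by blast+
    qed
  qed
qed

lemma small_partition:
  assumes X: "compact (UNIV :: 'a::metric_space set)" and e: "0 < e"
  obtains P where "P \<in> (borel_partitions :: 'a set set set)" "\<And>D. D \<in> P \<Longrightarrow> \<exists>c. D \<subseteq> ball c e"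
proof -
  obtain C where C: "finite C" "UNIV \<subseteq> (\<Union>c\<in>C. ball (c :: 'a) e)"
    by (rule compactE_image[OF X, of UNIV "\<lambda>c. ball c e"]) (use e in auto)
  obtain c :: "nat \<Rightarrow> 'a" and k where c: "C = c ` {i. i < k}"
    using C(1) by (auto simp: finite_conv_nat_seg_image)
  define A where "A i = (if i < k then ball (c i) e else {})" for i
  define P where "P = range (disjointed A) - {{}}"
  have zero: "disjointed A i = {}" if "k \<le> i" for i
    using that disjointed_subset[of A i] by (simp add: A_def)
  have "range (disjointed A) \<subseteq> insert {} (disjointed A ` {..<k})"
    using zero by (auto simp: not_less[symmetric])
  then have fin: "finite P" unfolding P_def by (meson finite.insertI finite_Diff finite_imageI finite_lessThan finite_subset)
  have "(\<Union>i. disjointed A i) = UNIV"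
    unfolding UN_disjointed_eq using C c by (auto simp: A_def) 
  then have part: "partition_on UNIV P"
    unfolding P_def
  proof (intro partition_onI)
    show "\<Union> (range (disjointed A) - {{}}) = UNIV"
      using \<open>(\<Union>i. disjointed A i) = UNIV\<close> by blast
    fix D E assume "D \<in> range (disjointed A) - {{}}" "E \<in> range (disjointed A) - {{}}" "D \<noteq> E"
    then obtain i j where "D = disjointed A i" "E = disjointed A j" "i \<noteq> j" by auto
    then show "disjnt D E"
      using disjoint_family_disjointed[of A] by (simp add: disjoint_family_on_def disjnt_def)
  qed auto
  have bor: "P \<subseteq> sets borel"
  proof -
    have "range A \<subseteq> sets borel" by (auto simp: A_def)
    then have "range (disjointed A) \<subseteq> sets borel" by (rule sets.range_disjointed_sets)
    then show ?thesis by (auto simp: P_def)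
  qed
  show ?thesis
  proof (rule that[of P])
    show "P \<in> borel_partitions" using fin part bor by (simp add: borel_partitions_def)
    fix D assume "D \<in> P"
    then obtain i where "D = disjointed A i" "D \<noteq> {}" by (auto simp: P_def)
    then show "\<exists>c. D \<subseteq> ball c e" using disjointed_subset[of A i] by (auto simp: A_def split: if_splits)
  qed
qed

section \<open>Shadowing of orbits and weights of inverse branches\<close>

context noncontracting_cover begin

text \<open>The induction peels off the first step: the orbit of \<alpha> x is shadowed by z, and x
  is lifted over z. A lift never increases the distance, so errors do not accumulate and one radius
  serves for all n.\<close>

lemma shadowing:
  "x \<in> S \<Longrightarrow> w \<in> S \<Longrightarrow> dist ((\<alpha> ^^ n) x) w < lift_radius \<Longrightarrow>
    \<exists>z\<in>S. (\<alpha> ^^ n) z = w \<and> (\<forall>i\<le>n. dist ((\<alpha> ^^ i) x) ((\<alpha> ^^ i) z) \<le> dist ((\<alpha> ^^ n) x) w)"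
proof (induction n arbitrary: x)
  case (Suc n)
  have pow: "(\<alpha> ^^ Suc i) y = (\<alpha> ^^ i) (\<alpha> y)" for i y by (simp add: funpow_swap1)
  obtain z where z: "z \<in> S" "(\<alpha> ^^ n) z = w"
    "\<And>i. i \<le> n \<Longrightarrow> dist ((\<alpha> ^^ i) (\<alpha> x)) ((\<alpha> ^^ i) z) \<le> dist ((\<alpha> ^^ Suc n) x) w"
    using Suc.IH[of "\<alpha> x"] Suc.prems unfolding pow by (auto intro: \<alpha>_in)
  have d: "dist (\<alpha> x) z \<le> dist ((\<alpha> ^^ Suc n) x) w" using z(3)[of 0] by simp
  obtain y where y: "y \<in> fib z" "dist x y \<le> dist (\<alpha> x) z"
    using lift_radius(3)[of x z] Suc.prems z(1) d by auto
  have yz: "\<alpha> y = z" "y \<in> S" using y by (auto simp: fib_iff)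
  show ?case
  proof (rule bexI[of _ y], intro conjI allI impI)
    show "(\<alpha> ^^ Suc n) y = w" unfolding pow yz using z by simp
    fix i assume "i \<le> Suc n"
    then show "dist ((\<alpha> ^^ i) x) ((\<alpha> ^^ i) y) \<le> dist ((\<alpha> ^^ Suc n) x) w"
      using z(3)[of "i - 1"] y d yz by (cases i) (auto simp: pow simp del: funpow.simps)
  qed (rule yz)
qed auto

definition fibn :: "nat \<Rightarrow> 'a \<Rightarrow> 'a set" where "fibn n w = {z \<in> S. (\<alpha> ^^ n) z = w}"

text \<open>A function q with fibre sums 1 describes a random walk backwards along \<alpha>; the
  products are the probabilities of its paths of length n from w, and these paths are in bijection
  with the n-th preimages of w in S.\<close>

lemma fibn_sum:
  assumes q: "\<And>x. x \<in> S \<Longrightarrow> L q x = 1"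
  shows "w \<in> S \<Longrightarrow> finite (fibn n w) \<and> (\<Sum>z\<in>fibn n w. \<Prod>i<n. q ((\<alpha> ^^ i) z)) = 1"
proof (induction n arbitrary: w)
  case 0
  then have "fibn 0 w = {w}" by (auto simp: fibn_def)
  then show ?case by simp
next
  case (Suc n)
  have eq: "fibn (Suc n) w = (\<Union>y\<in>fib w. fibn n y)"
    by (auto simp: fibn_def fib_iff \<alpha>_pow_in)
  have sub: "y \<in> S" if "y \<in> fib w" for y using that by (simp add: fib_iff)
  have "(\<Sum>z\<in>fibn (Suc n) w. \<Prod>i<Suc n. q ((\<alpha> ^^ i) z))
      = (\<Sum>y\<in>fib w. \<Sum>z\<in>fibn n y. \<Prod>i<Suc n. q ((\<alpha> ^^ i) z))"
    unfolding eq using Suc sub by (intro sum.UNION_disjoint finite_fib) (auto simp: fibn_def)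
  also have "\<dots> = (\<Sum>y\<in>fib w. q y * (\<Sum>z\<in>fibn n y. \<Prod>i<n. q ((\<alpha> ^^ i) z)))"
    unfolding sum_distrib_left by (intro sum.cong refl) (auto simp: fibn_def)
  also have "\<dots> = (\<Sum>y\<in>fib w. q y)" using Suc.IH sub by (intro sum.cong) auto
  also have "\<dots> = 1" using q[OF Suc.prems] by (simp add: L_def)
  finally show ?case unfolding eq using Suc sub finite_fib by auto
qed

end

sublocale supported_measure \<subseteq> invariant_measure \<alpha> \<mu>
  by unfold_locales (simp_all add: prob invariant)

section \<open>Lower bound for the entropy by bump functions on atoms\<close>

context supported_measure begin

text \<open>Points of one fibre are more than r apart, so a function supported in a ball of radius r
  / 2 is nonzero at no more than one of them.\<close>

lemma L_bump_le:
  assumes t: "\<And>y. 0 \<le> t y" "\<And>y. t y \<le> 1" "\<And>y. t y \<noteq> 0 \<Longrightarrow> dist c y < r / 2" and x: "x \<in> S"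
  shows "L t x \<le> (1 :: real)"
proof (cases "\<exists>y\<in>fib x. t y \<noteq> 0")
  case True
  then obtain y where y: "y \<in> fib x" "t y \<noteq> 0" by auto
  have "t z = 0" if z: "z \<in> fib x" "z \<noteq> y" for z
  proof (rule ccontr)
    assume "t z \<noteq> 0"
    then have "dist y z \<le> r" using t(3)[of z] t(3)[OF y(2)] dist_triangle3[of y z c] by simp
    then show False using fib_separated[OF y(1) z(1)] z(2) by simp
  qed
  then have "L t x = (\<Sum>z\<in>{y}. t z)"
    unfolding L_def using y finite_fib[OF x] by (intro sum.mono_neutral_right) auto
  then show ?thesis using t(2) by simp
qed (simp add: L_def)

text \<open>All factors but the one with index 0 depend on \<alpha> y only and leave the innermost L
  by \<open>L_pull\<close>. What remains inside is L (t 0), at most 1, and the other factors form a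
  product of the same kind with shifted indices; hence the induction over all t.\<close>

lemma Ln_bump_prod_le:
  assumes t: "\<And>i y. 0 \<le> t i y" "\<And>i x. x \<in> S \<Longrightarrow> L (t i) x \<le> (1 :: real)"
  shows "x \<in> S \<Longrightarrow> (L ^^ n) (\<lambda>y. \<Prod>i<n. t i ((\<alpha> ^^ i) y)) x \<le> 1"
  using t
proof (induction n arbitrary: t x)
  case (Suc n)
  have eq: "(\<lambda>y. \<Prod>i<Suc n. t i ((\<alpha> ^^ i) y)) = (\<lambda>y. (\<Prod>i<n. t (Suc i) ((\<alpha> ^^ i) (\<alpha> y))) * t 0 y)"
    by (rule ext) (simp add: prod.lessThan_Suc_shift funpow_swap1 mult.commute del: prod.lessThan_Suc)
  have "(L ^^ Suc n) (\<lambda>y. \<Prod>i<Suc n. t i ((\<alpha> ^^ i) y)) x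
      = (L ^^ n) (\<lambda>y. (\<Prod>i<n. t (Suc i) ((\<alpha> ^^ i) y)) * L (t 0) y) x"
    unfolding eq funpow_Suc_right comp_apply
    by (simp only: L_pull[of "\<lambda>x. \<Prod>i<n. t (Suc i) ((\<alpha> ^^ i) x)" "t 0", abs_def])
  also have "\<dots> \<le> (L ^^ n) (\<lambda>y. \<Prod>i<n. t (Suc i) ((\<alpha> ^^ i) y)) x"
    using Suc.prems by (intro Ln_mono) (auto intro!: mult_left_le prod_nonneg)
  also have "\<dots> \<le> 1" using Suc.prems by (intro Suc.IH) auto
  finally show ?case .
qed simp

lemma F_le_KS: "ereal F \<le> KS_entropy \<alpha> \<mu>"
proof -
  obtain P where P: "P \<in> (borel_partitions :: 'a set set set)" and small: "\<And>D. D \<in> P \<Longrightarrow> \<exists>c. D \<subseteq> ball c (r / 8)"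
    using small_partition[OF X_compact, of "r / 8"] r_pos by auto
  have part: "partition_on UNIV P" using P by (simp add: borel_partitions_def)
  obtain c where c: "\<And>D. D \<in> P \<Longrightarrow> D \<subseteq> ball (c D) (r / 8)" using small by metis
  \<comment> \<open>The value is 1 within r / 8 of the centre, in particular on D, and 0 beyond r /
    4, well inside the radius r / 2 allowed by \<open>L_bump_le\<close>.\<close>
  define t where "t D y = max 0 (min 1 (2 - dist (c D) y * 8 / r))" for D y
  have t01: "0 \<le> t D y" "t D y \<le> 1" for D y by (auto simp: t_def)
  have t1: "t (cell P y) y = 1" for y
  proof -
    have "dist (c (cell P y)) y < r / 8" using c[OF cell_in[OF part, of y]] in_cell[OF part, of y] by auto
    then have "dist (c (cell P y)) y * 8 / r \<le> 1" using r_pos by (simp add: field_simps)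
    then show ?thesis by (simp add: t_def)
  qed
  have tsupp: "dist (c D) y < r / 2" if "t D y \<noteq> 0" for D y
  proof -
    have "dist (c D) y * 8 / r < 2" using that by (auto simp: t_def max_def min_def split: if_splits)
    then have "dist (c D) y * 8 < 2 * r" using r_pos by (simp only: pos_divide_less_eq)
    then show ?thesis using r_pos by simp
  qed
  have tC: "t D \<in> CX" for D using r_pos unfolding t_def CX_def by (auto intro!: continuous_intros)
  show ?thesis
  proof (rule KS_entropy_ge[OF P])
    fix n
    let ?Q = "dyn_refinement \<alpha> P n"
    have Q: "?Q \<in> borel_partitions" by (rule dyn_refinement_borel[OF P])
    have finQ: "finite ?Q" using Q by (simp add: borel_partitions_def)
    \<comment> \<open>A bump for the atom D, following the itinerary of an arbitrary point of D; it
      equals 1 on all of D since the points of D share their itinerary.\<close>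
    define u where "u D y = (\<Prod>i<n. t (cell P ((\<alpha> ^^ i) (SOME x. x \<in> D))) ((\<alpha> ^^ i) y))" for D y
    have u: "0 \<le> u D y" for D y by (auto simp: u_def t01 intro: prod_nonneg)
    have u1: "u (cell ?Q y) y = 1" for y
    proof -
      have "(SOME x. x \<in> atom \<alpha> P n y) \<in> atom \<alpha> P n y" by (rule someI[of _ y]) (simp add: atom_def)
      then have "u (atom \<alpha> P n y) y = (\<Prod>i<n. t (cell P ((\<alpha> ^^ i) y)) ((\<alpha> ^^ i) y))"
        unfolding u_def by (intro prod.cong) (auto simp: atom_def)
      then show ?thesis by (simp add: cell_dyn_refinement[OF part] t1)
    qed
    have uC: "continuous_on S (u D)" for D
      unfolding u_def using tC unfolding CX_def
      by (intro continuous_intros continuous_on_compose2[OF _ \<alpha>_pow_cont]) auto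
    have Lu: "(L ^^ n) (u D) x \<le> 1" if "x \<in> S" for D x
      unfolding u_def
    proof (rule Ln_bump_prod_le[OF _ _ that])
      show "L (t (cell P ((\<alpha> ^^ i) (SOME x. x \<in> D)))) x \<le> 1" if "x \<in> S" for i x
        using t01 tsupp that by (rule L_bump_le)
    qed (rule t01)
    \<comment> \<open>Cells of measure 0 leave places where the sum over the atoms can vanish;
      \<theta> keeps f positive. The resulting error is removed at fixed n, so its growth with n is
      harmless.\<close>
    have bound: "real n * F \<le> partition_entropy \<mu> ?Q + \<theta> * real N ^ n" if \<theta>: "0 < \<theta>" for \<theta>
    proof -
      define f where "f y = \<theta> + (\<Sum>D\<in>?Q. measure \<mu> D * u D y)" for y
      have fC: "continuous_on S f" unfolding f_def by (intro continuous_intros uC)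
      have f_ge: "\<theta> \<le> f y" for y unfolding f_def by (simp add: sum_nonneg u)
      have f: "f \<in> positive_functions"
        using fC f_ge \<theta> by (auto simp: positive_functions_def intro: less_le_trans)
      have f_cell: "measure \<mu> (cell ?Q y) \<le> f y" for y
      proof -
        have "measure \<mu> (cell ?Q y) * u (cell ?Q y) y \<le> (\<Sum>D\<in>?Q. measure \<mu> D * u D y)"
          using finQ u cell_in[OF partition_on_atoms[OF part]] by (intro member_le_sum) auto
        then show ?thesis using \<theta> u1[of y] by (simp add: f_def)
      qed
      have Lf: "(L ^^ n) f x \<le> 1 + \<theta> * real N ^ n" if x: "x \<in> S" for x
      proof -
        have "(L ^^ n) f x = (L ^^ n) (\<lambda>_. \<theta>) x + (\<Sum>D\<in>?Q. measure \<mu> D * (L ^^ n) (u D) x)"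
          unfolding f_def Ln_add Ln_sum Ln_cmult ..
        also have "\<dots> \<le> \<theta> * real N ^ n + (\<Sum>D\<in>?Q. measure \<mu> D * 1)"
          using x \<theta> by (intro add_mono Ln_const_le sum_mono mult_left_mono Lu) auto
        finally show ?thesis using sum_measure_partition[OF Q] by simp
      qed
      have "I (\<lambda>x. ln ((L ^^ n) f x)) \<le> I (\<lambda>x. \<theta> * real N ^ n)"
      proof (rule I_mono)
        show "set_integrable \<mu> S (\<lambda>x. ln ((L ^^ n) f x))" by (intro integrable_ln positive_Ln f)
        show "set_integrable \<mu> S (\<lambda>x. \<theta> * real N ^ n)" by (intro set_integrable_continuous continuous_intros)
        fix x assume x: "x \<in> S"
        have "0 < (L ^^ n) f x" using positive_Ln[OF f] x by (simp add: positive_functions_def)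
        then have "ln ((L ^^ n) f x) \<le> (L ^^ n) f x - 1" by (rule ln_le_minus_one)
        then show "ln ((L ^^ n) f x) \<le> \<theta> * real N ^ n" using Lf[OF x] by simp
      qed
      moreover have "- partition_entropy \<mu> ?Q \<le> I (\<lambda>x. ln (f x))"
      proof -
        have "- partition_entropy \<mu> ?Q = (\<integral>x. ln (measure \<mu> (cell ?Q x)) \<partial>\<mu>)"
          using cell_integral(2)[OF Q, of "\<lambda>D. ln (measure \<mu> D)"] by (simp add: partition_entropy_def)
        also have "\<dots> \<le> I (\<lambda>x. ln (f x))"
          unfolding set_lebesgue_integral_def
        proof (rule integral_mono_AE)
          show "integrable \<mu> (\<lambda>x. ln (measure \<mu> (cell ?Q x)))" by (rule cell_integral(1)[OF Q])
          show "integrable \<mu> (\<lambda>x. indicator S x *\<^sub>R ln (f x))"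
            using integrable_ln[OF f] by (simp add: set_integrable_def)
          show "AE x in \<mu>. ln (measure \<mu> (cell ?Q x)) \<le> indicator S x *\<^sub>R ln (f x)"
            using AE_cell_pos[OF Q] AE_S
            by eventually_elim (use f_cell in \<open>auto intro: ln_mono less_le_trans\<close>)
        qed
        finally show ?thesis .
      qed
      ultimately show ?thesis using F_iterate[OF f, of n] by simp
    qed
    show "real n * F \<le> partition_entropy \<mu> ?Q"
    proof (rule field_le_epsilon)
      fix e :: real assume e: "0 < e"
      define \<theta> where "\<theta> = e / (real N ^ n + 1)"
      have N: "0 < real N ^ n + 1" by (simp add: add_nonneg_pos)
      have "\<theta> * real N ^ n \<le> \<theta> * (real N ^ n + 1)" using e N by (intro mult_left_mono) (auto simp: \<theta>_def)
      also have "\<dots> = e" using N by (simp add: \<theta>_def)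
      finally show "real n * F \<le> partition_entropy \<mu> ?Q + e"
        using bound[of \<theta>] e N by (simp add: \<theta>_def)
    qed
  qed
qed

end

lemma sum_prod_PiE:
  fixes f :: "'i \<Rightarrow> 'b \<Rightarrow> real"
  assumes "finite A" "\<And>x. x \<in> A \<Longrightarrow> finite (B x)"
  shows "(\<Sum>g\<in>PiE A B. \<Prod>x\<in>A. f x (g x)) = (\<Prod>x\<in>A. \<Sum>y\<in>B x. f x y)"
proof -
  have "infsum (\<lambda>g. \<Prod>x\<in>A. f x (g x)) (PiE A B) = (\<Prod>x\<in>A. infsum (f x) (B x))"
    using assms by (intro infsum_prod_PiE) (auto intro!: finite_PiE summable_on_finite)
  then show ?thesis using assms by (simp add: finite_PiE)
qed

lemma compact_closed_separated:
  fixes K T :: "'a::metric_space set"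
  assumes "compact K" "closed T" "K \<inter> T = {}"
  shows "\<exists>d>0. \<forall>x\<in>K. \<forall>y\<in>T. d \<le> dist x y"
proof (cases "K = {} \<or> T = {}")
  case True
  then show ?thesis by (intro exI[of _ 1]) auto
next
  case False
  have "continuous_on K (\<lambda>x. infdist x T)" by (intro continuous_intros)
  then obtain x where x: "x \<in> K" "\<And>y. y \<in> K \<Longrightarrow> infdist x T \<le> infdist y T"
    using continuous_attains_inf[OF assms(1)] False by blast
  have "0 < infdist x T" using x assms False by (intro infdist_pos_not_in_closed) auto
  then show ?thesis using x infdist_le order_trans by (intro exI[of _ "infdist x T"]) blast
qed

lemma finite_compact_separated:
  fixes K :: "'i \<Rightarrow> 'a::metric_space set"
  assumes P: "finite P" and K: "\<And>i. i \<in> P \<Longrightarrow> compact (K i)"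
    and disj: "\<And>i j. i \<in> P \<Longrightarrow> j \<in> P \<Longrightarrow> i \<noteq> j \<Longrightarrow> K i \<inter> K j = {}"
  obtains d where "0 < d" "\<And>i j x y. i \<in> P \<Longrightarrow> j \<in> P \<Longrightarrow> x \<in> K i \<Longrightarrow> y \<in> K j \<Longrightarrow> dist x y < d \<Longrightarrow> i = j"
proof -
  have "\<exists>d>0. \<forall>x\<in>K i. \<forall>y\<in>K j. d \<le> dist x y" if "i \<in> P" "j \<in> P" "i \<noteq> j" for i j
    using that K disj by (intro compact_closed_separated compact_imp_closed) auto
  then obtain d where d: "\<And>i j. i \<in> P \<Longrightarrow> j \<in> P \<Longrightarrow> i \<noteq> j \<Longrightarrow> 0 < d i j"
    "\<And>i j x y. i \<in> P \<Longrightarrow> j \<in> P \<Longrightarrow> i \<noteq> j \<Longrightarrow> x \<in> K i \<Longrightarrow> y \<in> K j \<Longrightarrow> d i j \<le> dist x y" by metis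
  define A where "A = insert 1 ((\<lambda>(i, j). d i j) ` {(i, j). i \<in> P \<and> j \<in> P \<and> i \<noteq> j})"
  have "finite {(i, j). i \<in> P \<and> j \<in> P \<and> i \<noteq> j}"
    by (rule finite_subset[of _ "P \<times> P"]) (use P in auto)
  then have A: "finite A" "A \<noteq> {}" by (auto simp: A_def)
  show ?thesis
  proof (rule that[of "Min A"])
    show "0 < Min A" using A d(1) by (subst Min_gr_iff) (auto simp: A_def)
    fix i j x y assume *: "i \<in> P" "j \<in> P" "x \<in> K i" "y \<in> K j" "dist x y < Min A"
    show "i = j"
    proof (rule ccontr)
      assume ne: "i \<noteq> j"
      then have "Min A \<le> d i j" using * A by (intro Min_le) (auto simp: A_def)
      then show False using d(2)[OF *(1,2) ne *(3,4)] *(5) by simp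
    qed
  qed
qed

section \<open>Upper bound for the entropy by coding orbit segments\<close>

context supported_measure begin

lemma set_integrable_indicator_comb:
  assumes "B \<in> sets borel"
  shows "set_integrable \<mu> S (\<lambda>x. if x \<in> B then a else b :: real)"
    and "I (\<lambda>x. if x \<in> B then a else b) = a + (b - a) * measure \<mu> (- B)"
proof -
  have eq: "(\<lambda>x. if x \<in> B then a else b) = (\<lambda>x. a + (b - a) * indicator (- B) x)"
    by (auto simp: indicator_def)
  have B: "- B \<in> sets \<mu>" using assms by simp
  have i: "integrable \<mu> (\<lambda>x. a + (b - a) * indicator (- B) x)"
    using B by (intro Bochner_Integration.integrable_add integrable_mult_right) (auto simp: emeasure_eq_measure)
  then show "set_integrable \<mu> S (\<lambda>x. if x \<in> B then a else b)"
    unfolding eq set_integrable_def by (intro integrable_mult_indicator) auto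
  have "I (\<lambda>x. a + (b - a) * indicator (- B) x) = (\<integral>x. a + (b - a) * indicator (- B) x \<partial>\<mu>)"
    using borel_measurable_integrable[OF i]
    by (intro I_integral[symmetric]) (simp add: measurable_cong_sets[OF sets_\<mu> refl])
  also have "\<dots> = a + (b - a) * measure \<mu> (- B)"
    using B prob_space by (subst Bochner_Integration.integral_add) (auto simp: emeasure_eq_measure)
  finally show "I (\<lambda>x. if x \<in> B then a else b) = a + (b - a) * measure \<mu> (- B)"
    unfolding eq .
qed

text \<open>An orbit segment of length \<open>n\<close> is coded by a point of \<open>\<alpha>\<^sup>-\<^sup>n\<close> of a finite net that shadows
  it, together with the cell of each point of the segment that lies outside the compact
  sets \<open>K D \<subseteq> D\<close>; inside them the cell is determined by the shadowing point. Giving the codes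
  product weights, with \<open>\<Prod>i<n. q (\<alpha>\<^sup>i z)\<close> for the shadowing points, bounds the entropy.\<close>

lemma KS_le_V:
  assumes f: "f \<in> positive_functions"
  shows "KS_entropy \<alpha> \<mu> \<le> ereal (V f)"
proof (rule KS_entropy_le)
  fix P :: "'a set set" and e :: real
  assume P: "P \<in> borel_partitions" and e: "0 < e"
  have part: "partition_on UNIV P" and finP: "finite P" and borP: "\<And>D. D \<in> P \<Longrightarrow> D \<in> sets borel"
    using P by (auto simp: borel_partitions_def)
  have neP: "P \<noteq> {}" using part by (auto simp: partition_on_def)
  define cP where "cP = real (card P)"
  have cP: "0 < cP" using finP neP by (simp add: cP_def card_gt_0_iff)

  \<comment> \<open>A probability on every fibre in S whose logarithm g is continuous there; by
    invariance \<open>I g = - V f\<close>, so -g is the coding cost per step with the right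
    mean.\<close>
  define q where "q x = f x / L f (\<alpha> x)" for x
  define g where "g x = ln (f x) - ln (L f (\<alpha> x))" for x
  have f0: "0 < f x" and Lf0: "0 < L f x" if "x \<in> S" for x
    using f positive_L[OF f] that by (auto simp: positive_functions_def)
  have q0: "0 < q x" and lnq: "ln (q x) = g x" if "x \<in> S" for x
    using f0[OF that] Lf0[OF \<alpha>_in[OF that]] by (simp_all add: q_def g_def ln_div)
  have Lq: "L q x = 1" if x: "x \<in> S" for x
  proof -
    have "L q x = L (\<lambda>y. (1 / L f (\<alpha> y)) * f y) x" by (simp add: q_def[abs_def])
    also have "\<dots> = (1 / L f x) * L f x" by (rule L_pull)
    finally show ?thesis using Lf0[OF x] by simp
  qed
  have g1: "set_integrable \<mu> S (\<lambda>x. ln (f x))" "set_integrable \<mu> S (\<lambda>x. ln (L f (\<alpha> x)))"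
    using integrable_ln[OF f] set_integrable_\<alpha>[OF integrable_ln[OF positive_L[OF f]]] by auto
  have gint: "set_integrable \<mu> S g" unfolding g_def[abs_def] by (intro set_integral_diff g1)
  have Ig: "I g = - V f"
    unfolding g_def[abs_def] V_def
    using set_integral_diff(2)[OF g1] I_\<alpha>[OF integrable_ln[OF positive_L[OF f]]] by simp
  have gC: "continuous_on S g"
    unfolding g_def[abs_def]
    using continuous_ln[OF f] continuous_on_compose2[OF continuous_ln[OF positive_L[OF f]] _, of S \<alpha>]
      continuous_on_subset[OF \<alpha>_cont, of S] \<alpha>_in
    by (intro continuous_on_diff) auto
  have "uniformly_continuous_on S g" using gC S_compact by (rule compact_uniformly_continuous)
  moreover have "0 < e / 2" using e by simp
  ultimately obtain d1 where d1: "0 < d1" "\<And>x y. x \<in> S \<Longrightarrow> y \<in> S \<Longrightarrow> dist x y < d1 \<Longrightarrow> dist (g x) (g y) < e / 2"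
    unfolding uniformly_continuous_on_def by (metis dist_commute)

  \<comment> \<open>The probability set aside for naming a cell explicitly. The error e is spent as
    e / 2 on the oscillation of g between an orbit and its shadow, e / 4 per step on not naming a
    cell, and e / 4 in the mean on the cells that are named.\<close>
  define \<eta> where "\<eta> = 1 - exp (- (e / 4))"
  have \<eta>: "0 < \<eta>" "\<eta> < 1" "ln (1 - \<eta>) = - (e / 4)" using e by (auto simp: \<eta>_def)
  define c where "c = - ln (\<eta> / cP)"
  have c: "0 \<le> c"
  proof -
    have "1 \<le> cP" using cP by (simp add: cP_def)
    then have "\<eta> / cP \<le> 1" using \<eta> cP by (simp add: field_simps)
    then show ?thesis using \<eta> cP by (simp add: c_def)
  qed
  \<comment> \<open>A named cell costs c, and cells are named on a set of measure at most
    \<open>cP * \<kappa>\<close>; this choice keeps the mean cost below e / 4. Using c + 1 excludes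
    a zero denominator.\<close>
  define \<kappa> where "\<kappa> = e / 4 / (cP * (c + 1))"
  have \<kappa>: "0 < \<kappa>" using e cP c by (auto simp: \<kappa>_def)
  have "\<exists>K. closed K \<and> K \<subseteq> D \<and> measure \<mu> (D - K) < \<kappa>" if D: "D \<in> P" for D
  proof -
    obtain K U where KU: "closed K" "open U" "K \<subseteq> D" "D \<subseteq> U" "measure \<mu> (U - K) < \<kappa>"
      using borel_closed_open_approximation[OF sets_\<mu> finite_measure_axioms borP[OF D] \<kappa>] by auto
    have "measure \<mu> (D - K) \<le> measure \<mu> (U - K)"
      using KU(1,2,4) by (intro finite_measure_mono) auto
    then show ?thesis using KU by auto
  qed
  then obtain K where K: "\<And>D. D \<in> P \<Longrightarrow> closed (K D)" "\<And>D. D \<in> P \<Longrightarrow> K D \<subseteq> D"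
    "\<And>D. D \<in> P \<Longrightarrow> measure \<mu> (D - K D) < \<kappa>" by metis
  have Kc: "compact (K D)" if "D \<in> P" for D
    using compact_Int_closed[OF X_compact K(1)[OF that]] by simp
  have Kd: "K D \<inter> K E = {}" if "D \<in> P" "E \<in> P" "D \<noteq> E" for D E
    using K(2)[OF that(1)] K(2)[OF that(2)] cell_eq[OF part] that by blast
  obtain d2 where d2: "0 < d2"
    "\<And>D E x y. D \<in> P \<Longrightarrow> E \<in> P \<Longrightarrow> x \<in> K D \<Longrightarrow> y \<in> K E \<Longrightarrow> dist x y < d2 \<Longrightarrow> D = E"
    by (rule finite_compact_separated[of P K, OF finP Kc Kd]) blast+
  define KK where "KK = (\<Union>D\<in>P. K D)"
  have KKb: "KK \<in> sets borel" unfolding KK_def using K(1) finP by (intro borel_closed closed_UN) auto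
  have KK: "measure \<mu> (- KK) \<le> cP * \<kappa>"
  proof -
    have "measure \<mu> (- KK) \<le> measure \<mu> (\<Union>D\<in>P. D - K D)"
    proof (rule finite_measure_mono)
      show "- KK \<subseteq> (\<Union>D\<in>P. D - K D)"
        using cell_in[OF part] in_cell[OF part] by (fastforce simp: KK_def)
      show "(\<Union>D\<in>P. D - K D) \<in> sets \<mu>" using K(1) borP finP by (intro sets.finite_UN) auto
    qed
    also have "\<dots> \<le> (\<Sum>D\<in>P. measure \<mu> (D - K D))"
      using K borP finP by (intro finite_measure_subadditive_finite) auto
    also have "\<dots> \<le> (\<Sum>D\<in>P. \<kappa>)" using K(3) by (intro sum_mono less_imp_le) auto
    finally show ?thesis by (simp add: cP_def)
  qed
  have KK_cell: "x \<in> K (cell P x)" if "x \<in> KK" for x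
    using that K(2) cell_eq[OF part] by (auto simp: KK_def)

  \<comment> \<open>d1 controls the oscillation of g, \<open>lift_radius\<close> permits shadowing,
    and d2 / 2 puts two points with a common shadow at a distance below d2.\<close>
  define d where "d = min (min d1 (d2 / 2)) lift_radius"
  have d: "0 < d" "d \<le> d1" "d \<le> d2 / 2" "d \<le> lift_radius"
    using d1 d2 lift_radius by (auto simp: d_def)
  obtain E where E: "E \<subseteq> S" "finite E" "S \<subseteq> (\<Union>w\<in>E. ball w d)"
    by (rule compactE_image[OF S_compact, of S "\<lambda>w. ball w d"]) (use d in auto)
  have "S \<noteq> {}" using AE_S AE_False by auto
  then have E0: "E \<noteq> {}" using E by auto
  define cE where "cE = real (card E)"
  have cE: "0 < cE" using E E0 by (simp add: cE_def card_gt_0_iff)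

  \<comment> \<open>\<open>None\<close> stands for a point of \<open>KK\<close>, whose cell can be
    read off the shadowing point; \<open>Some D\<close> names the cell D.\<close>
  define B where "B = insert None (Some ` P)"
  define \<pi> where "\<pi> b = (if b = None then 1 - \<eta> else \<eta> / cP)" for b :: "'a set option"
  have B: "finite B" "(\<Sum>b\<in>B. \<pi> b) = 1"
  proof -
    show "finite B" using finP by (simp add: B_def)
    have "(\<Sum>b\<in>Some ` P. \<pi> b) = (\<Sum>D\<in>P. \<eta> / cP)"
      by (subst sum.reindex) (auto simp: \<pi>_def)
    also have "\<dots> = \<eta>" using cP by (simp add: cP_def)
    finally show "(\<Sum>b\<in>B. \<pi> b) = 1" using finP unfolding B_def
      by (subst sum.insert) (auto simp: \<pi>_def)
  qed
  have \<pi>0: "0 < \<pi> b" for b using \<eta> cP by (auto simp: \<pi>_def)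
  define sy where "sy x = (if x \<in> KK then None else Some (cell P x))" for x
  have syB: "sy x \<in> B" for x using cell_in[OF part] by (auto simp: sy_def B_def)
  have ln\<pi>: "ln (\<pi> (sy x)) = (if x \<in> KK then ln (1 - \<eta>) else ln (\<eta> / cP))" for x
    by (auto simp: sy_def \<pi>_def)
  \<comment> \<open>A lower bound for the logarithm of the i-th factor of the weight of a code,
    evaluated along the orbit of x itself: the term - e / 2 replaces g at the shadowing point by g
    on the orbit.\<close>
  define G where "G x = (g x + (if x \<in> KK then ln (1 - \<eta>) else ln (\<eta> / cP))) + (- (e / 2))" for x
  have Gint: "set_integrable \<mu> S G" and IG: "- I G \<le> V f + e"
  proof -
    note i1 = set_integrable_indicator_comb[OF KKb, of "ln (1 - \<eta>)" "ln (\<eta> / cP)"]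
    note i2 = set_integrable_continuous[of "\<lambda>_. - (e / 2)"]
    note i12 = set_integral_add[OF gint i1(1)]
    note i123 = set_integral_add[OF i12(1) i2]
    show "set_integrable \<mu> S G" unfolding G_def[abs_def] using i123(1) by simp
    have "I G = I g + I (\<lambda>x. if x \<in> KK then ln (1 - \<eta>) else ln (\<eta> / cP)) + - (e / 2)"
      unfolding G_def[abs_def] using i123(2) i12(2) by simp
    also have "\<dots> = - V f - e / 2 - e / 4 - (c - e / 4) * measure \<mu> (- KK)"
      unfolding i1(2) unfolding Ig \<eta>(3) by (simp add: c_def algebra_simps)
    finally have "- I G = V f + 3 * e / 4 + (c - e / 4) * measure \<mu> (- KK)" by simp
    also have "(c - e / 4) * measure \<mu> (- KK) \<le> (c + 1) * (cP * \<kappa>)"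
      using KK c e by (intro mult_mono) auto
    also have "(c + 1) * (cP * \<kappa>) = e / 4" using cP c by (simp add: \<kappa>_def field_simps add_nonneg_eq_0_iff)
    finally show "- I G \<le> V f + e" by simp
  qed

  show "\<exists>C. \<forall>n. partition_entropy \<mu> (dyn_refinement \<alpha> P n) \<le> real n * (V f + e) + C"
  proof (intro exI allI)
    fix n
    let ?Q = "dyn_refinement \<alpha> P n"
    have Q: "?Q \<in> borel_partitions" by (rule dyn_refinement_borel[OF P])
    have partQ: "partition_on UNIV ?Q" by (rule partition_on_atoms[OF part])
    \<comment> \<open>The n-th preimages of the net. Every point of the net contributes total weight
      1, so the whole weighs \<open>cE\<close> for every n; only the additive constant
      \<open>ln cE\<close> results from it.\<close>
    define Z where "Z = (\<Union>w\<in>E. fibn n w)"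
    define qn where "qn z = (\<Prod>i<n. q ((\<alpha> ^^ i) z))" for z
    have ES: "w \<in> S" if "w \<in> E" for w using that E by auto
    note fs = fibn_sum[of q, OF Lq]
    have Zf: "finite Z" unfolding Z_def using E fs ES by auto
    have ZS: "z \<in> S" if "z \<in> Z" for z using that by (auto simp: Z_def fibn_def)
    have Zsum: "(\<Sum>z\<in>Z. qn z) = cE"
    proof -
      have "(\<Sum>z\<in>Z. qn z) = (\<Sum>w\<in>E. \<Sum>z\<in>fibn n w. qn z)"
        unfolding Z_def using E fs ES by (intro sum.UNION_disjoint) (auto simp: fibn_def)
      also have "\<dots> = (\<Sum>w\<in>E. 1)" unfolding qn_def using fs ES by (intro sum.cong) auto
      finally show ?thesis by (simp add: cE_def)
    qed
    have qn0: "0 < qn z" if "z \<in> S" for z unfolding qn_def by (intro prod_pos ballI q0 \<alpha>_pow_in that)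
    have "\<exists>z\<in>Z. \<forall>i<n. dist ((\<alpha> ^^ i) x) ((\<alpha> ^^ i) z) < d" if x: "x \<in> S" for x
    proof -
      obtain w where w: "w \<in> E" "dist w ((\<alpha> ^^ n) x) < d"
        using E(3) \<alpha>_pow_in[OF x, of n] by auto
      then have w': "dist ((\<alpha> ^^ n) x) w < d" by (simp add: dist_commute)
      obtain z where z: "z \<in> S" "(\<alpha> ^^ n) z = w"
        "\<And>i. i \<le> n \<Longrightarrow> dist ((\<alpha> ^^ i) x) ((\<alpha> ^^ i) z) \<le> dist ((\<alpha> ^^ n) x) w"
        using shadowing[OF x ES[OF w(1)], of n] w' d by fastforce
      have "z \<in> Z" using z w by (auto simp: Z_def fibn_def)
      moreover have "\<forall>i<n. dist ((\<alpha> ^^ i) x) ((\<alpha> ^^ i) z) < d"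
        using le_less_trans[OF z(3) w'] by simp
      ultimately show ?thesis by blast
    qed
    then obtain zz where zz: "\<And>x. x \<in> S \<Longrightarrow> zz x \<in> Z"
      "\<And>x i. x \<in> S \<Longrightarrow> i < n \<Longrightarrow> dist ((\<alpha> ^^ i) x) ((\<alpha> ^^ i) (zz x)) < d" by metis
    define lab where "lab x = (zz x, \<lambda>i\<in>{..<n}. sy ((\<alpha> ^^ i) x))" for x
    define labs where "labs = Z \<times> PiE {..<n} (\<lambda>_. B)"
    define W where "W l = qn (fst l) / cE * (\<Prod>i<n. \<pi> (snd l i))" for l
    have labs: "finite labs" unfolding labs_def using Zf B by (intro finite_cartesian_product finite_PiE) auto
    have labS: "lab x \<in> labs" if "x \<in> S" for x
      using zz(1)[OF that] syB by (auto simp: lab_def labs_def)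
    have W0: "0 < W l" if "l \<in> labs" for l
      unfolding W_def using that qn0 ZS cE \<pi>0 by (intro mult_pos_pos divide_pos_pos prod_pos) (auto simp: labs_def)
    have Wsum: "(\<Sum>l\<in>labs. W l) = 1"
    proof -
      have "(\<Sum>l\<in>labs. W l) = (\<Sum>z\<in>Z. qn z / cE) * (\<Sum>\<sigma>\<in>PiE {..<n} (\<lambda>_. B). \<Prod>i<n. \<pi> (\<sigma> i))"
        unfolding labs_def W_def sum_product by (simp add: sum.cartesian_product split_def)
      also have "(\<Sum>z\<in>Z. qn z / cE) = 1" using Zsum cE by (simp add: sum_divide_distrib[symmetric])
      also have "(\<Sum>\<sigma>\<in>PiE {..<n} (\<lambda>_. B). \<Prod>i<n. \<pi> (\<sigma> i)) = 1"
        using B by (subst sum_prod_PiE) auto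
      finally show ?thesis by simp
    qed
    \<comment> \<open>Decoding: equal symbols mean that both points lie in \<open>KK\<close>, where
      a common shadow forces a common cell, or that both name the same cell.\<close>
    have lab_atom: "atom \<alpha> P n x = atom \<alpha> P n y" if x: "x \<in> S" and y: "y \<in> S" and eq: "lab x = lab y" for x y
    proof -
      have "cell P ((\<alpha> ^^ i) x) = cell P ((\<alpha> ^^ i) y)" if i: "i < n" for i
      proof -
        have z: "zz x = zz y" using eq by (simp add: lab_def)
        have "snd (lab x) i = snd (lab y) i" using eq by simp
        then have s: "sy ((\<alpha> ^^ i) x) = sy ((\<alpha> ^^ i) y)" using i by (simp add: lab_def)
        show ?thesis
        proof (cases "(\<alpha> ^^ i) x \<in> KK")
          case True
          then have y': "(\<alpha> ^^ i) y \<in> KK" using s by (auto simp: sy_def split: if_splits)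
          have "dist ((\<alpha> ^^ i) x) ((\<alpha> ^^ i) y) < d2"
            using zz(2)[OF x i] zz(2)[OF y i] z d(3)
              dist_triangle2[of "(\<alpha> ^^ i) x" "(\<alpha> ^^ i) y" "(\<alpha> ^^ i) (zz x)"] by simp
          then show ?thesis
            using d2(2)[OF cell_in[OF part] cell_in[OF part] KK_cell[OF True] KK_cell[OF y']] by simp
        next
          case False
          then show ?thesis using s by (auto simp: sy_def split: if_splits)
        qed
      qed
      then show ?thesis by (auto simp: atom_def)
    qed
    \<comment> \<open>An atom collects the weights of all codes of its points in S. By
      \<open>lab_atom\<close> different atoms have disjoint sets of codes, so these weights sum to
      at most 1.\<close>
    define w where "w D = (\<Sum>l\<in>lab ` (D \<inter> S). W l)" for D
    have sub: "lab ` (D \<inter> S) \<subseteq> labs" for D using labS by auto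
    have Wnn: "0 \<le> W l" if "l \<in> lab ` (D \<inter> S)" for l D
      using W0[OF subsetD[OF sub that]] by simp
    have w_ge: "W (lab x) \<le> w (cell ?Q x)" if x: "x \<in> S" for x
      unfolding w_def
    proof (rule member_le_sum)
      show "lab x \<in> lab ` (cell ?Q x \<inter> S)" using x in_cell[OF partQ, of x] by blast
      show "finite (lab ` (cell ?Q x \<inter> S))" using sub labs by (rule finite_subset)
    qed (use Wnn in blast)
    have "partition_entropy \<mu> ?Q \<le> - (\<Sum>D\<in>?Q. measure \<mu> D * ln (w D))"
    proof (rule Gibbs_inequality[OF Q])
      show "0 \<le> w D" for D unfolding w_def using Wnn by (rule sum_nonneg)
      show "0 < w D" if D: "D \<in> ?Q" "0 < measure \<mu> D" for D
      proof -
        \<comment> \<open>Only points of S have codes with guaranteed positive weight; an atom that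
          misses S is null and imposes nothing in the Gibbs inequality.\<close>
        have "D \<inter> S \<noteq> {}"
        proof
          assume *: "D \<inter> S = {}"
          have "AE x in \<mu>. x \<notin> D" using AE_S by (rule eventually_mono) (use * in auto)
          moreover have "D \<in> sets \<mu>" using D Q by (auto simp: borel_partitions_def)
          ultimately have "measure \<mu> D = 0" by (simp add: prob_eq_0)
          then show False using D by simp
        qed
        then obtain x where x: "x \<in> D" "x \<in> S" by auto
        then show ?thesis using w_ge[OF x(2)] W0[OF labS[OF x(2)]] cell_eq[OF partQ D(1) x(1)] by simp
      qed
      have "(\<Sum>D\<in>?Q. w D) = (\<Sum>l\<in>(\<Union>D\<in>?Q. lab ` (D \<inter> S)). W l)"
        unfolding w_def
      proof (rule sum.UNION_disjoint[symmetric])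
        show "finite ?Q" using Q by (simp add: borel_partitions_def)
        show "\<forall>D\<in>?Q. finite (lab ` (D \<inter> S))" using sub labs by (auto intro: finite_subset)
        show "\<forall>D\<in>?Q. \<forall>D'\<in>?Q. D \<noteq> D' \<longrightarrow> lab ` (D \<inter> S) \<inter> lab ` (D' \<inter> S) = {}"
        proof (intro ballI impI)
          fix D D' assume D: "D \<in> ?Q" "D' \<in> ?Q" "D \<noteq> D'"
          show "lab ` (D \<inter> S) \<inter> lab ` (D' \<inter> S) = {}"
          proof (rule ccontr)
            assume "lab ` (D \<inter> S) \<inter> lab ` (D' \<inter> S) \<noteq> {}"
            then obtain l where "l \<in> lab ` (D \<inter> S)" "l \<in> lab ` (D' \<inter> S)" by blast
            then obtain x y where xy: "x \<in> D" "x \<in> S" "y \<in> D'" "y \<in> S" "lab x = lab y"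
              by (elim imageE IntE) metis
            then show False
              using lab_atom[OF xy(2,4,5)] cell_eq[OF partQ D(1) xy(1)] cell_eq[OF partQ D(2) xy(3)] D(3)
              by (simp add: cell_dyn_refinement[OF part])
          qed
        qed
      qed
      also have "\<dots> \<le> (\<Sum>l\<in>labs. W l)"
        using labs sub less_imp_le[OF W0] by (intro sum_mono2) blast+
      finally show "(\<Sum>D\<in>?Q. w D) \<le> 1" using Wsum by simp
    qed
    also have "(\<Sum>D\<in>?Q. measure \<mu> D * ln (w D)) = (\<integral>x. ln (w (cell ?Q x)) \<partial>\<mu>)"
      using cell_integral(2)[OF Q, of "\<lambda>D. ln (w D)"] by simp
    finally have H: "partition_entropy \<mu> ?Q \<le> - (\<integral>x. ln (w (cell ?Q x)) \<partial>\<mu>)" .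
    have Gi: "set_integrable \<mu> S (\<lambda>x. G ((\<alpha> ^^ i) x))" "I (\<lambda>x. G ((\<alpha> ^^ i) x)) = I G" for i
      using set_integrable_\<alpha>_pow[OF Gint] I_\<alpha>_pow[OF Gint] by auto
    have Gs: "set_integrable \<mu> S (\<lambda>x. \<Sum>i<m. G ((\<alpha> ^^ i) x)) \<and> I (\<lambda>x. \<Sum>i<m. G ((\<alpha> ^^ i) x)) = real m * I G" for m
    proof (induction m)
      case 0
      show ?case using set_integrable_continuous[of "\<lambda>_. 0"] by simp
    next
      case (Suc m)
      then show ?case
        using set_integral_add[OF conjunct1[OF Suc] Gi(1)[of m]] Gi(2)[of m] by (simp add: algebra_simps)
    qed
    note i0 = set_integrable_continuous[of "\<lambda>_. - ln cE"]
    note i1 = set_integral_add[OF conjunct1[OF Gs[of n]] i0]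
    have "real n * I G - ln cE = I (\<lambda>x. (\<Sum>i<n. G ((\<alpha> ^^ i) x)) + - ln cE)"
      using i1(2) Gs[of n] by simp
    also have "\<dots> \<le> (\<integral>x. ln (w (cell ?Q x)) \<partial>\<mu>)"
      unfolding set_lebesgue_integral_def
    proof (rule integral_mono_AE)
      show "integrable \<mu> (\<lambda>x. indicator S x *\<^sub>R ((\<Sum>i<n. G ((\<alpha> ^^ i) x)) + - ln cE))"
        using i1(1) by (simp add: set_integrable_def)
      show "integrable \<mu> (\<lambda>x. ln (w (cell ?Q x)))" by (rule cell_integral(1)[OF Q])
      show "AE x in \<mu>. indicator S x *\<^sub>R ((\<Sum>i<n. G ((\<alpha> ^^ i) x)) + - ln cE) \<le> ln (w (cell ?Q x))"
        using AE_S
      proof eventually_elim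
        case (elim x)
        have zS: "zz x \<in> S" using zz(1)[OF elim] ZS by simp
        have "ln (W (lab x)) = ln (qn (zz x)) - ln cE + ln (\<Prod>i<n. \<pi> (sy ((\<alpha> ^^ i) x)))"
        proof -
          define p where "p = (\<Prod>i<n. \<pi> (sy ((\<alpha> ^^ i) x)))"
          have "W (lab x) = qn (zz x) / cE * p"
            unfolding W_def p_def by (auto simp: lab_def intro!: prod.cong)
          moreover have "0 < p" unfolding p_def by (intro prod_pos) (auto simp: \<pi>0)
          ultimately show ?thesis
            unfolding p_def[symmetric] using qn0[OF zS] cE by (simp add: ln_mult ln_div)
        qed
        also have "ln (qn (zz x)) = (\<Sum>i<n. g ((\<alpha> ^^ i) (zz x)))"
          unfolding qn_def using zS q0[OF \<alpha>_pow_in[OF zS]]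
          by (subst ln_prod) (auto simp: lnq \<alpha>_pow_in less_imp_neq[symmetric])
        also have "ln (\<Prod>i<n. \<pi> (sy ((\<alpha> ^^ i) x))) = (\<Sum>i<n. ln (\<pi> (sy ((\<alpha> ^^ i) x))))"
          by (subst ln_prod) (auto simp: less_imp_neq[OF \<pi>0, symmetric])
        finally have lnW: "ln (W (lab x)) = (\<Sum>i<n. g ((\<alpha> ^^ i) (zz x)) + ln (\<pi> (sy ((\<alpha> ^^ i) x)))) - ln cE"
          by (simp add: sum.distrib)
        have "(\<Sum>i<n. G ((\<alpha> ^^ i) x)) \<le> (\<Sum>i<n. g ((\<alpha> ^^ i) (zz x)) + ln (\<pi> (sy ((\<alpha> ^^ i) x))))"
        proof (rule sum_mono)
          fix i assume "i \<in> {..<n}"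
          then have "dist ((\<alpha> ^^ i) x) ((\<alpha> ^^ i) (zz x)) < d1" using zz(2)[OF elim, of i] d(2) by simp
          then have "dist (g ((\<alpha> ^^ i) x)) (g ((\<alpha> ^^ i) (zz x))) < e / 2"
            by (intro d1(2) \<alpha>_pow_in elim zS)
          then have "g ((\<alpha> ^^ i) x) - e / 2 \<le> g ((\<alpha> ^^ i) (zz x))" unfolding dist_real_def by linarith
          then show "G ((\<alpha> ^^ i) x) \<le> g ((\<alpha> ^^ i) (zz x)) + ln (\<pi> (sy ((\<alpha> ^^ i) x)))"
            unfolding G_def ln\<pi> by simp
        qed
        also have "\<dots> = ln (W (lab x)) + ln cE" using lnW by simp
        also have "ln (W (lab x)) \<le> ln (w (cell ?Q x))"
          using w_ge[OF elim] W0[OF labS[OF elim]] by (simp add: ln_mono)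
        finally show ?case using elim by simp
      qed
    qed
    finally have "partition_entropy \<mu> ?Q \<le> real n * (- I G) + ln cE" using H by simp
    also have "\<dots> \<le> real n * (V f + e) + ln cE" using IG by (intro add_right_mono mult_left_mono) auto
    finally show "partition_entropy \<mu> ?Q \<le> real n * (V f + e) + ln cE" .
  qed
qed

lemma KS_eq_F: "KS_entropy \<alpha> \<mu> = ereal F"
proof (rule antisym)
  show "KS_entropy \<alpha> \<mu> \<le> ereal F"
  proof (rule ereal_le_epsilon2)
    fix e :: real assume e: "0 < e"
    obtain f where f: "f \<in> positive_functions" "V f < F + e" by (rule F_approx[OF e])
    have "KS_entropy \<alpha> \<mu> \<le> ereal (V f)" by (rule KS_le_V[OF f(1)])
    also have "\<dots> \<le> ereal F + ereal e" using f(2) by simp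
    finally show "KS_entropy \<alpha> \<mu> \<le> ereal F + ereal e" .
  qed
qed (rule F_le_KS)

end

section \<open>The cocycle and the t-entropy\<close>

lemma Tietze_CX:
  fixes f :: "'a::metric_space \<Rightarrow> real"
  assumes "closed S" "continuous_on S f"
  obtains g where "g \<in> CX" "\<And>x. x \<in> S \<Longrightarrow> g x = f x"
proof -
  have "normal_space (euclidean :: 'a topology)"
    by (rule metrizable_imp_normal_space) (rule metrizable_space_euclidean)
  then obtain g where "continuous_map euclidean euclideanreal g" "\<And>x. x \<in> S \<Longrightarrow> g x = f x"
    by (rule Tietze_extension_realinterval[of euclidean S UNIV f])
       (use assms in \<open>auto simp: continuous_map_iff_continuous\<close>)
  then show ?thesis by (intro that[of g]) (auto simp: CX_def)
qed

locale transfer_cover = noncontracting_cover \<alpha> S r N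
  for \<alpha> :: "'a::metric_space \<Rightarrow> 'a" and S r N +
  fixes A :: "('a \<Rightarrow> real) \<Rightarrow> 'a \<Rightarrow> real"
  assumes transfer: "transfer_operator \<alpha> A" and compatible: "compatible_on S A"
begin

lemma A_CX: "f \<in> CX \<Longrightarrow> A f \<in> CX"
  and A_add: "f \<in> CX \<Longrightarrow> g \<in> CX \<Longrightarrow> A (\<lambda>x. f x + g x) = (\<lambda>x. A f x + A g x)"
  and A_cmult: "f \<in> CX \<Longrightarrow> A (\<lambda>x. c * f x) = (\<lambda>x. c * A f x)"
  and A_nonneg: "f \<in> CX \<Longrightarrow> (\<And>x. 0 \<le> f x) \<Longrightarrow> 0 \<le> A f y"
  and A_pull: "f \<in> CX \<Longrightarrow> g \<in> CX \<Longrightarrow> A (\<lambda>x. f (\<alpha> x) * g x) = (\<lambda>x. f x * A g x)"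
  using transfer unfolding transfer_operator_def by blast+

lemma positive_functional_A: "positive_functional (\<lambda>f. A f x)"
  by unfold_locales (simp_all add: X_compact A_add A_cmult A_nonneg)

lemma A_mono: "f \<in> CX \<Longrightarrow> g \<in> CX \<Longrightarrow> (\<And>x. f x \<le> g x) \<Longrightarrow> A f y \<le> A g y"
  using positive_functional.mono[OF positive_functional_A] by blast

lemma A_sum: "finite I \<Longrightarrow> (\<And>i. i \<in> I \<Longrightarrow> f i \<in> CX) \<Longrightarrow> A (\<lambda>x. \<Sum>i\<in>I. f i x) y = (\<Sum>i\<in>I. A (f i) y)"
  using positive_functional.sum[OF positive_functional_A] by blast

abbreviation "\<nu> x \<equiv> rep_measure A x"

lemma rep_measure: "sets (\<nu> x) = sets borel" "finite_measure (\<nu> x)" "f \<in> CX \<Longrightarrow> integral\<^sup>L (\<nu> x) f = A f x"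
proof -
  interpret positive_functional "\<lambda>f. A f x" by (rule positive_functional_A)
  have "\<exists>!M. sets M = sets borel \<and> finite_measure M \<and> (\<forall>f\<in>CX. integral\<^sup>L M f = A f x)"
  proof (rule ex1I[of _ rep])
    show "sets rep = sets borel \<and> finite_measure rep \<and> (\<forall>f\<in>CX. integral\<^sup>L rep f = A f x)"
      using finite_rep integral_rep by simp
    fix M :: "'a measure"
    assume "sets M = sets borel \<and> finite_measure M \<and> (\<forall>f\<in>CX. integral\<^sup>L M f = A f x)"
    then show "M = rep"
      by (intro finite_measure_eqI_CX X_compact finite_rep) (auto simp: integral_rep)
  qed
  from theI'[OF this] show "sets (\<nu> x) = sets borel" "finite_measure (\<nu> x)"
    "f \<in> CX \<Longrightarrow> integral\<^sup>L (\<nu> x) f = A f x"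
    unfolding rep_measure_def[symmetric] by auto
qed

lemma CX_measurable_\<nu>: "f \<in> CX \<Longrightarrow> f \<in> borel_measurable (\<nu> x)"
  unfolding CX_def measurable_cong_sets[OF rep_measure(1) refl]
  by (auto intro: borel_measurable_continuous_onI)

lemma CX_integrable_\<nu>: "f \<in> CX \<Longrightarrow> integrable (\<nu> x) f"
proof -
  assume f: "f \<in> CX"
  interpret finite_measure "\<nu> x" by (rule rep_measure)
  obtain B where "\<And>x. \<bar>f x\<bar> \<le> B" using CX_bounded[OF X_compact f] by blast
  then show ?thesis by (intro integrable_const_bound[of _ B] CX_measurable_\<nu> f) auto
qed

text \<open>The transfer identity with \<open>f y = dist y x\<close> gives the integral of
  \<open>dist (\<alpha> y) x\<close> the value \<open>dist x x * A 1 x\<close>, which is 0.\<close>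

lemma AE_\<nu>_fibre: "AE y in \<nu> x. \<alpha> y = x"
proof -
  have d: "(\<lambda>y. dist y x) \<in> CX" by (auto simp: CX_def intro!: continuous_intros)
  have "continuous_on UNIV (\<lambda>y. dist (\<alpha> y) x)" using \<alpha>_cont by (intro continuous_intros)
  then have d\<alpha>: "(\<lambda>y. dist (\<alpha> y) x) \<in> CX" by (simp add: CX_def)
  have "integral\<^sup>L (\<nu> x) (\<lambda>y. dist (\<alpha> y) x) = A (\<lambda>y. dist (\<alpha> y) x * 1) x"
    using rep_measure(3)[OF d\<alpha>] by simp
  also have "\<dots> = dist x x * A (\<lambda>_. 1) x"
    using A_pull[OF d CX_intros(1)[of 1]] by metis
  finally have "integral\<^sup>L (\<nu> x) (\<lambda>y. dist (\<alpha> y) x) = 0" by simp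
  then have "AE y in \<nu> x. dist (\<alpha> y) x = 0"
    using integral_nonneg_eq_0_iff_AE[OF CX_integrable_\<nu>[OF d\<alpha>]] by simp
  then show ?thesis by simp
qed

abbreviation "\<rho> \<equiv> cocycle \<alpha> A"

lemma \<rho>_nonneg: "0 \<le> \<rho> y" by (simp add: cocycle_def)

text \<open>On S the measure \<open>\<nu> x\<close> lives on the finite set \<open>fib x\<close>,
  hence is a sum of point masses, whose sizes are the values of the cocycle.\<close>

lemma integral_\<nu>_S:
  assumes f: "continuous_on S f" and x: "x \<in> S"
  shows "set_lebesgue_integral (\<nu> x) S f = L (\<lambda>y. \<rho> y * f y) x"
proof -
  interpret finite_measure "\<nu> x" by (rule rep_measure)
  have sing: "{y} \<in> sets (\<nu> x)" for y by (simp add: rep_measure(1))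
  have "set_lebesgue_integral (\<nu> x) S f = (\<integral>y. (\<Sum>z\<in>fib x. indicator {z} y * f z) \<partial>\<nu> x)"
    unfolding set_lebesgue_integral_def
  proof (rule integral_cong_AE)
    have "S \<in> sets borel" using S_closed by (rule borel_closed)
    then show "(\<lambda>y. indicator S y *\<^sub>R f y) \<in> borel_measurable (\<nu> x)"
      unfolding measurable_cong_sets[OF rep_measure(1) refl]
      using f by (rule borel_measurable_continuous_on_indicator)
    show "(\<lambda>y. \<Sum>z\<in>fib x. indicator {z} y * f z) \<in> borel_measurable (\<nu> x)"
      using sing by (intro borel_measurable_sum borel_measurable_times borel_measurable_indicator) auto
    show "AE y in \<nu> x. indicator S y *\<^sub>R f y = (\<Sum>z\<in>fib x. indicator {z} y * f z)"
      using AE_\<nu>_fibre[of x]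
    proof eventually_elim
      case (elim y)
      have "(\<Sum>z\<in>fib x. indicator {z} y * f z) = (\<Sum>z\<in>fib x. if z = y then f z else 0)"
        by (intro sum.cong) (auto simp: indicator_def)
      also have "\<dots> = indicator S y *\<^sub>R f y"
        using elim finite_fib[OF x] by (simp add: sum.delta fib_iff indicator_def)
      finally show ?case by simp
    qed
  qed
  also have "\<dots> = (\<Sum>z\<in>fib x. \<integral>y. indicator {z} y * f z \<partial>\<nu> x)"
    using sing by (intro Bochner_Integration.integral_sum integrable_mult_left)
      (auto simp: emeasure_eq_measure)
  also have "\<dots> = (\<Sum>z\<in>fib x. \<rho> z * f z)"
    using sing sets_eq_imp_space_eq[OF rep_measure(1)[of x]]
    by (intro sum.cong) (auto simp: cocycle_def fib_iff)
  finally show ?thesis by (simp add: L_def)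
qed

lemma L\<rho>_continuous: "continuous_on S f \<Longrightarrow> continuous_on S (L (\<lambda>y. \<rho> y * f y))"
proof -
  assume f: "continuous_on S f"
  then have "continuous_on S (\<lambda>x. set_lebesgue_integral (\<nu> x) S f)"
    using compatible by (simp add: compatible_on_def)
  then show ?thesis using integral_\<nu>_S[OF f] by (simp cong: continuous_on_cong)
qed

text \<open>Compatibility gives continuity of fibre sums only. A bump b supported within r / 2 of y
  sees at most one point of each fibre, so near y the cocycle is the fibre sum of \<rho> b, composed
  with \<alpha>, divided by b.\<close>

lemma \<rho>_continuous: "continuous_on S \<rho>"
  unfolding continuous_on_eq_continuous_within
proof
  fix y assume y: "y \<in> S"
  define b where "b z = max 0 (r - 2 * dist y z)" for z
  have bC: "continuous_on S b" unfolding b_def by (intro continuous_intros)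
  have eq: "\<rho> z = L (\<lambda>w. \<rho> w * b w) (\<alpha> z) / b z" if z: "z \<in> S" "dist y z < r / 2" for z
  proof -
    have "b w = 0" if w: "w \<in> fib (\<alpha> z)" "w \<noteq> z" for w
    proof (rule ccontr)
      assume "b w \<noteq> 0"
      then have "dist w z \<le> r" using z(2) dist_triangle3[of w z y] by (auto simp: b_def max_def split: if_splits)
      then show False using fib_separated[of w "\<alpha> z" z] w z by (auto simp: fib_iff)
    qed
    then have "L (\<lambda>w. \<rho> w * b w) (\<alpha> z) = (\<Sum>w\<in>{z}. \<rho> w * b w)"
      unfolding L_def using z finite_fib[OF \<alpha>_in[OF z(1)]]
      by (intro sum.mono_neutral_right) (auto simp: fib_iff)
    moreover have "b z \<noteq> 0" using z by (simp add: b_def)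
    ultimately show ?thesis by simp
  qed
  have "continuous_on S (\<lambda>z. L (\<lambda>w. \<rho> w * b w) (\<alpha> z))"
    using continuous_on_compose2[OF L\<rho>_continuous[OF bC] continuous_on_subset[OF \<alpha>_cont]] \<alpha>_in by auto
  then have "continuous_on (S \<inter> ball y (r / 2)) (\<lambda>z. L (\<lambda>w. \<rho> w * b w) (\<alpha> z) / b z)"
    using bC by (intro continuous_on_divide) (auto intro: continuous_on_subset simp: b_def)
  then have "continuous_on (S \<inter> ball y (r / 2)) \<rho>"
    by (rule continuous_on_eq) (use eq in auto)
  then have "continuous (at y within S \<inter> ball y (r / 2)) \<rho>"
    using y r_pos by (simp add: continuous_on_eq_continuous_within)
  moreover have "at y within S \<inter> ball y (r / 2) = at y within S"
    by (rule at_within_nhd[of y "ball y (r / 2)"]) (use r_pos in auto)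
  ultimately show "continuous (at y within S) \<rho>" by simp
qed

text \<open>Only an inequality: \<open>\<nu> x\<close> may also charge points of the full fibre that
  lie outside S.\<close>

lemma A_ge_L: "f \<in> CX \<Longrightarrow> (\<And>y. 0 \<le> f y) \<Longrightarrow> x \<in> S \<Longrightarrow> L (\<lambda>y. \<rho> y * f y) x \<le> A f x"
proof -
  assume f: "f \<in> CX" "\<And>y. 0 \<le> f y" and x: "x \<in> S"
  have fS: "continuous_on S f" using f(1) by (auto simp: CX_def intro: continuous_on_subset)
  have Sb: "S \<in> sets (\<nu> x)" using borel_closed[OF S_closed] by (simp add: rep_measure(1))
  have "set_lebesgue_integral (\<nu> x) S f \<le> integral\<^sup>L (\<nu> x) f"
    unfolding set_lebesgue_integral_def
    using CX_integrable_\<nu>[OF f(1)] Sb f(2)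
    by (intro integral_mono integrable_mult_indicator) (auto simp: indicator_def)
  then show ?thesis using integral_\<nu>_S[OF fS x] rep_measure(3)[OF f(1)] by simp
qed

lemma An_CX: "f \<in> CX \<Longrightarrow> (A ^^ n) f \<in> CX"
  by (induction n) (auto intro: A_CX)

lemma An_nonneg: "f \<in> CX \<Longrightarrow> (\<And>y. 0 \<le> f y) \<Longrightarrow> 0 \<le> (A ^^ n) f x"
proof (induction n arbitrary: x)
  case (Suc n)
  then show ?case by (simp add: A_nonneg An_CX)
qed simp

definition \<rho>n :: "nat \<Rightarrow> 'a \<Rightarrow> real" where "\<rho>n n y = (\<Prod>i<n. \<rho> ((\<alpha> ^^ i) y))"

lemma \<rho>n_nonneg: "0 \<le> \<rho>n n y" unfolding \<rho>n_def by (intro prod_nonneg) (simp add: \<rho>_nonneg)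

lemma \<rho>n_continuous: "continuous_on S (\<rho>n n)"
  unfolding \<rho>n_def
  by (intro continuous_intros continuous_on_compose2[OF \<rho>_continuous \<alpha>_pow_cont]) (auto intro: \<alpha>_pow_in)

lemma Ln_pull: "(L ^^ n) (\<lambda>y. h ((\<alpha> ^^ n) y) * f y) = (\<lambda>x. h x * (L ^^ n) f x)"
proof (induction n arbitrary: h)
  case (Suc n)
  have "(L ^^ Suc n) (\<lambda>y. h ((\<alpha> ^^ Suc n) y) * f y) = L ((L ^^ n) (\<lambda>y. (h \<circ> \<alpha>) ((\<alpha> ^^ n) y) * f y))"
    by simp
  also have "\<dots> = L (\<lambda>x. h (\<alpha> x) * (L ^^ n) f x)" by (subst Suc) simp
  also have "\<dots> = (\<lambda>x. h x * (L ^^ Suc n) f x)" by (rule ext) (simp add: L_pull)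
  finally show ?case .
qed simp

text \<open>The last factor of \<open>\<rho>n (Suc n)\<close> is a function of \<alpha>^n y; it
  leaves L^n by \<open>Ln_pull\<close> and becomes the weight under the outermost L, where
  \<open>A_ge_L\<close> takes over.\<close>

lemma An_ge_Ln:
  "f \<in> CX \<Longrightarrow> (\<And>y. 0 \<le> f y) \<Longrightarrow> x \<in> S \<Longrightarrow> (L ^^ n) (\<lambda>y. \<rho>n n y * f y) x \<le> (A ^^ n) f x"
proof (induction n arbitrary: x)
  case 0
  then show ?case by (simp add: \<rho>n_def)
next
  case (Suc n)
  have "(L ^^ Suc n) (\<lambda>y. \<rho>n (Suc n) y * f y) x = L ((L ^^ n) (\<lambda>y. \<rho> ((\<alpha> ^^ n) y) * (\<rho>n n y * f y))) x"
    by (simp add: \<rho>n_def mult_ac)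
  also have "\<dots> = L (\<lambda>y. \<rho> y * (L ^^ n) (\<lambda>y. \<rho>n n y * f y) y) x" by (subst Ln_pull) simp
  also have "\<dots> \<le> L (\<lambda>y. \<rho> y * (A ^^ n) f y) x"
    using Suc by (intro L_mono mult_left_mono) (auto simp: \<rho>_nonneg)
  also have "\<dots> \<le> A ((A ^^ n) f) x"
    using Suc.prems by (intro A_ge_L An_CX An_nonneg)
  finally show ?case by simp
qed

end

section \<open>Lower bound for the t-entropy when ln rho is integrable\<close>

locale transfer_measure = transfer_cover \<alpha> S r N A + supported_measure \<alpha> S r N \<mu>
  for \<alpha> :: "'a::metric_space \<Rightarrow> 'a" and S r N A \<mu>
begin

lemma CX_measurable: "f \<in> CX \<Longrightarrow> f \<in> borel_measurable borel"
  by (auto simp: CX_def intro: borel_measurable_continuous_onI)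

lemma CX_integrable: "f \<in> CX \<Longrightarrow> integrable \<mu> f"
proof -
  assume f: "f \<in> CX"
  obtain B where "\<And>x. \<bar>f x\<bar> \<le> B" using CX_bounded[OF X_compact f] by blast
  then show ?thesis
    using CX_measurable[OF f]
    by (intro integrable_const_bound[of _ B]) (auto simp: measurable_cong_sets[OF sets_\<mu> refl])
qed

lemma CX_on_S: "f \<in> CX \<Longrightarrow> continuous_on S f"
  by (auto simp: CX_def intro: continuous_on_subset)

lemma CX_I: "f \<in> CX \<Longrightarrow> integral\<^sup>L \<mu> f = I f"
  by (intro I_integral CX_measurable)

lemma I_cong: "(\<And>x. x \<in> S \<Longrightarrow> f x = g x) \<Longrightarrow> I f = (I g :: real)"
  unfolding set_lebesgue_integral_def by (intro Bochner_Integration.integral_cong) (auto simp: indicator_def)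

lemma sum_integral_unity:
  assumes G: "G \<in> partitions_of_unity"
  shows "(\<Sum>g\<in>G. integral\<^sup>L \<mu> g) = 1"
proof -
  have "(\<Sum>g\<in>G. integral\<^sup>L \<mu> g) = (\<integral>x. (\<Sum>g\<in>G. g x) \<partial>\<mu>)"
    using G by (intro Bochner_Integration.integral_sum[symmetric] CX_integrable) (auto simp: partitions_of_unity_def)
  also have "\<dots> = 1" using G prob_space by (simp add: partitions_of_unity_def)
  finally show ?thesis .
qed

text \<open>The mean of A^n g is at least that of L^n (\<rho>n g), which by invariance is at least
  that of \<rho>n g, and \<rho>n is positive almost everywhere. Thus no logarithm in the t-entropy
  is -\<infinity> in this case.\<close>

lemma integral_An_pos:
  assumes \<rho>pos: "AE x in \<mu>. 0 < \<rho> x" and g: "g \<in> CX" "\<And>x. 0 \<le> g x" "0 < integral\<^sup>L \<mu> g"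
  shows "0 < integral\<^sup>L \<mu> ((A ^^ n) g)"
proof (rule ccontr)
  assume neg: "\<not> 0 < integral\<^sup>L \<mu> ((A ^^ n) g)"
  let ?h = "\<lambda>y. \<rho>n n y * g y"
  have hC: "continuous_on S ?h" using \<rho>n_continuous CX_on_S[OF g(1)] by (intro continuous_intros)
  have h0: "0 \<le> ?h y" for y using \<rho>n_nonneg g(2) by simp
  have "I ?h \<le> I (\<lambda>x. (L ^^ n) ?h ((\<alpha> ^^ n) x))"
    using hC h0 by (intro I_mono set_integrable_continuous set_integrable_\<alpha>_pow Ln_continuous Ln_ge)
  also have "\<dots> = I ((L ^^ n) ?h)"
    by (intro I_\<alpha>_pow set_integrable_continuous Ln_continuous hC)
  also have "\<dots> \<le> I ((A ^^ n) g)"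
    by (intro I_mono set_integrable_continuous Ln_continuous hC CX_on_S An_CX An_ge_Ln g)
  also have "\<dots> \<le> 0" using neg CX_I[OF An_CX[OF g(1)], of n] by simp
  finally have le: "(\<integral>x. indicator S x *\<^sub>R ?h x \<partial>\<mu>) \<le> 0" by (simp add: set_lebesgue_integral_def)
  have int: "integrable \<mu> (\<lambda>x. indicator S x *\<^sub>R ?h x)"
    using set_integrable_continuous[OF hC] by (simp add: set_integrable_def)
  have nn: "AE x in \<mu>. 0 \<le> indicator S x *\<^sub>R ?h x" using h0 by (intro AE_I2) (auto simp: indicator_def)
  have "(\<integral>x. indicator S x *\<^sub>R ?h x \<partial>\<mu>) = 0"
    using le integral_nonneg_AE[OF nn] by linarith
  then have "AE x in \<mu>. indicator S x *\<^sub>R ?h x = 0"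
    using integral_nonneg_eq_0_iff_AE[OF int nn] by simp
  moreover have "AE x in \<mu>. \<forall>i<n. 0 < \<rho> ((\<alpha> ^^ i) x)"
    using AE_\<alpha>_pow[OF \<rho>pos] by (simp add: AE_all_countable)
  ultimately have "AE x in \<mu>. g x = 0"
    using AE_S
  proof eventually_elim
    case (elim x)
    then have "\<rho>n n x \<noteq> 0" by (auto simp: \<rho>n_def)
    then show ?case using elim by simp
  qed
  then have "integral\<^sup>L \<mu> g = 0" by (rule integral_eq_zero_AE)
  then show False using g(3) by simp
qed

lemma t_entropy_term_ge:
  assumes \<rho>pos: "AE x in \<mu>. 0 < \<rho> x" and ln\<rho>: "set_integrable \<mu> S (\<lambda>x. ln (\<rho> x))"
    and G: "G \<in> partitions_of_unity"
  defines "G' \<equiv> {g \<in> G. integral\<^sup>L \<mu> g \<noteq> 0}"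
  shows "real n * (I (\<lambda>x. ln (\<rho> x)) + F)
    \<le> (\<Sum>g\<in>G'. integral\<^sup>L \<mu> g * ln (integral\<^sup>L \<mu> ((A ^^ n) g) / integral\<^sup>L \<mu> g))"
proof -
  define m where "m g = integral\<^sup>L \<mu> g" for g :: "'a \<Rightarrow> real"
  define a where "a g = integral\<^sup>L \<mu> ((A ^^ n) g)" for g
  have finG: "finite G" and GC: "\<And>g. g \<in> G \<Longrightarrow> g \<in> CX" and G0: "\<And>g x. g \<in> G \<Longrightarrow> 0 \<le> g x"
    and G1: "\<And>x. (\<Sum>g\<in>G. g x) = 1"
    using G by (auto simp: partitions_of_unity_def)
  have G'G: "g \<in> G" if "g \<in> G'" for g using that by (simp add: G'_def)
  have finG': "finite G'" using finG by (simp add: G'_def)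
  have m0: "0 < m g" if "g \<in> G'" for g
    using that G0[OF G'G[OF that]] Bochner_Integration.integral_nonneg[of \<mu> g] by (simp add: m_def G'_def order_less_le)
  have a0: "0 < a g" if "g \<in> G'" for g
    unfolding a_def using m0[OF that] GC G0 G'G[OF that] by (intro integral_An_pos \<rho>pos) (auto simp: m_def)
  \<comment> \<open>These weights make the sum of \<open>c g * a g\<close> equal to the sum of
    \<open>m g\<close>, which is 1, so the mean of L^n f is at most 1 up to the \<theta> term, while
    -ln c is exactly the logarithm in the t-entropy.\<close>
  define c where "c g = m g / a g" for g
  have c0: "0 < c g" if "g \<in> G'" for g using m0[OF that] a0[OF that] by (simp add: c_def)
  define s where "s x = (\<Sum>g\<in>G'. c g * g x)" for x
  have s0: "0 \<le> s x" for x unfolding s_def using c0 G0 G'G by (intro sum_nonneg mult_nonneg_nonneg) (auto intro: less_imp_le)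
  have sC: "continuous_on S s" unfolding s_def using GC G'G by (intro continuous_intros CX_on_S) auto
  have summ: "(\<Sum>g\<in>G'. m g) = 1"
  proof -
    have "(\<Sum>g\<in>G'. m g) = (\<Sum>g\<in>G. m g)"
      using finG by (intro sum.mono_neutral_left) (auto simp: G'_def m_def)
    then show ?thesis using sum_integral_unity[OF G] by (simp add: m_def)
  qed
  have intG: "set_integrable \<mu> S g" if "g \<in> G'" for g
    using GC[OF G'G[OF that]] by (intro set_integrable_continuous CX_on_S)
  \<comment> \<open>An almost everywhere lower bound for ln f whose integral is explicit: a Birkhoff
    sum of ln \<rho> plus the concavity bound for ln s.\<close>
  let ?R = "\<lambda>x. (\<Sum>i<n. ln (\<rho> ((\<alpha> ^^ i) x))) + (\<Sum>g\<in>G'. ln (c g) * g x)"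
  have R: "set_integrable \<mu> S ?R" "I ?R = real n * I (\<lambda>x. ln (\<rho> x)) + (\<Sum>g\<in>G'. ln (c g) * m g)"
  proof -
    have R1: "set_integrable \<mu> S (\<lambda>x. \<Sum>i<k. ln (\<rho> ((\<alpha> ^^ i) x))) \<and>
        I (\<lambda>x. \<Sum>i<k. ln (\<rho> ((\<alpha> ^^ i) x))) = real k * I (\<lambda>x. ln (\<rho> x))" for k
    proof (induction k)
      case 0
      show ?case using set_integrable_continuous[of "\<lambda>_. 0"] by simp
    next
      case (Suc k)
      then show ?case
        using set_integral_add[OF conjunct1[OF Suc] set_integrable_\<alpha>_pow[OF ln\<rho>, of k]] I_\<alpha>_pow[OF ln\<rho>, of k]
        by (simp add: algebra_simps)
    qed
    have R2: "set_integrable \<mu> S (\<lambda>x. \<Sum>g\<in>G'. ln (c g) * g x)"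
      using GC G'G by (intro set_integrable_continuous continuous_intros CX_on_S) auto
    have "I (\<lambda>x. \<Sum>g\<in>G'. ln (c g) * g x) = (\<integral>x. (\<Sum>g\<in>G'. ln (c g) * g x) \<partial>\<mu>)"
      using GC G'G by (intro CX_I[symmetric] CX_sum CX_intros) auto
    also have "\<dots> = (\<Sum>g\<in>G'. ln (c g) * m g)"
      unfolding m_def using GC G'G CX_integrable
      by (subst Bochner_Integration.integral_sum) auto
    finally show "set_integrable \<mu> S ?R" "I ?R = real n * I (\<lambda>x. ln (\<rho> x)) + (\<Sum>g\<in>G'. ln (c g) * m g)"
      using set_integral_add[OF conjunct1[OF R1[of n]] R2] R1[of n] by simp_all
  qed
  have bound: "real n * F \<le> \<theta> * real N ^ n - I ?R" if \<theta>: "0 < \<theta>" for \<theta>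
  proof -
    define f where "f y = \<theta> + \<rho>n n y * s y" for y
    have f_ge: "\<theta> \<le> f y" "\<rho>n n y * s y \<le> f y" for y
      using \<theta> s0 \<rho>n_nonneg by (simp_all add: f_def)
    have f: "f \<in> positive_functions"
      unfolding positive_functions_def f_def using \<theta> \<rho>n_nonneg s0 \<rho>n_continuous sC
      by (auto intro!: continuous_intros add_pos_nonneg)
    have Lf: "(L ^^ n) f x \<le> \<theta> * real N ^ n + (\<Sum>g\<in>G'. c g * (A ^^ n) g x)" if x: "x \<in> S" for x
    proof -
      have "f = (\<lambda>y. \<theta> + (\<Sum>g\<in>G'. c g * (\<rho>n n y * g y)))"
        unfolding f_def s_def by (simp add: sum_distrib_left mult_ac)
      then have "(L ^^ n) f x = (L ^^ n) (\<lambda>_. \<theta>) x + (\<Sum>g\<in>G'. c g * (L ^^ n) (\<lambda>y. \<rho>n n y * g y) x)"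
        unfolding Ln_add Ln_sum Ln_cmult by (simp add: Ln_add Ln_sum Ln_cmult)
      also have "\<dots> \<le> \<theta> * real N ^ n + (\<Sum>g\<in>G'. c g * (A ^^ n) g x)"
        using x \<theta> GC G0 G'G c0
        by (intro add_mono Ln_const_le sum_mono mult_left_mono An_ge_Ln) (auto intro: less_imp_le)
      finally show ?thesis .
    qed
    \<comment> \<open>The -1 comes from \<open>ln t \<le> t - 1\<close> and cancels against the
      total 1 of the means \<open>m g\<close>.\<close>
    let ?U = "\<lambda>x. (\<theta> * real N ^ n - 1) + (\<Sum>g\<in>G'. c g * (A ^^ n) g x)"
    have UC: "?U \<in> CX" using GC G'G by (intro CX_intros CX_sum An_CX) auto
    have "I (\<lambda>x. ln ((L ^^ n) f x)) \<le> I ?U"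
    proof (rule I_mono)
      show "set_integrable \<mu> S (\<lambda>x. ln ((L ^^ n) f x))" by (intro integrable_ln positive_Ln f)
      show "set_integrable \<mu> S ?U" by (intro set_integrable_continuous CX_on_S UC)
      fix x assume x: "x \<in> S"
      have "0 < (L ^^ n) f x" using positive_Ln[OF f] x by (simp add: positive_functions_def)
      then have "ln ((L ^^ n) f x) \<le> (L ^^ n) f x - 1" by (rule ln_le_minus_one)
      then show "ln ((L ^^ n) f x) \<le> ?U x" using Lf[OF x] by simp
    qed
    also have "I ?U = \<theta> * real N ^ n - 1 + (\<Sum>g\<in>G'. c g * a g)"
    proof -
      have "integrable \<mu> (\<lambda>x. \<Sum>g\<in>G'. c g * (A ^^ n) g x)"
        using GC G'G by (intro CX_integrable CX_sum CX_intros An_CX) auto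
      moreover have "(\<integral>x. (\<Sum>g\<in>G'. c g * (A ^^ n) g x) \<partial>\<mu>) = (\<Sum>g\<in>G'. c g * a g)"
        unfolding a_def using GC G'G CX_integrable An_CX by (subst Bochner_Integration.integral_sum) auto
      ultimately show ?thesis
        unfolding CX_I[OF UC, symmetric] using prob_space by (subst Bochner_Integration.integral_add) auto
    qed
    also have "(\<Sum>g\<in>G'. c g * a g) = (\<Sum>g\<in>G'. m g)"
      using a0 by (intro sum.cong) (auto simp: c_def less_imp_neq[symmetric])
    finally have "I (\<lambda>x. ln ((L ^^ n) f x)) \<le> \<theta> * real N ^ n" using summ by simp
    moreover have "I ?R \<le> I (\<lambda>x. ln (f x))"
    proof (rule set_integral_mono_AE)
      show "set_integrable \<mu> S ?R" by (rule R)
      show "set_integrable \<mu> S (\<lambda>x. ln (f x))" by (rule integrable_ln[OF f])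
      \<comment> \<open>The members discarded for having mean 0 vanish almost everywhere, so the
        remaining ones still sum to 1 there.\<close>
      have "AE x in \<mu>. \<forall>g\<in>G - G'. g x = 0"
      proof (rule AE_finite_allI)
        show "finite (G - G')" using finG by simp
        fix g assume g: "g \<in> G - G'"
        then have "integral\<^sup>L \<mu> g = 0" by (simp add: G'_def)
        then show "AE x in \<mu>. g x = 0"
          using integral_nonneg_eq_0_iff_AE[OF CX_integrable[OF GC]] g G0 by auto
      qed
      moreover have "AE x in \<mu>. \<forall>i. 0 < \<rho> ((\<alpha> ^^ i) x)"
        using AE_\<alpha>_pow[OF \<rho>pos] by (simp add: AE_all_countable)
      ultimately show "AE x\<in>S in \<mu>. ?R x \<le> ln (f x)"
      proof eventually_elim
        case (elim x)
        have sum1: "(\<Sum>g\<in>G'. g x) = 1"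
        proof -
          have "(\<Sum>g\<in>G'. g x) = (\<Sum>g\<in>G. g x)"
            using finG elim(1) by (intro sum.mono_neutral_left) (auto simp: G'_def)
          then show ?thesis using G1 by simp
        qed
        have spos: "0 < s x"
        proof (rule ccontr)
          assume "\<not> 0 < s x"
          then have "s x = 0" using s0[of x] by simp
          then have "\<forall>g\<in>G'. c g * g x = 0"
            unfolding s_def using less_imp_le[OF c0] G0 G'G finG' by (subst (asm) sum_nonneg_eq_0_iff) auto
          then have "\<forall>g\<in>G'. g x = 0" using c0 by fastforce
          then have "(\<Sum>g\<in>G'. g x) = 0" by (intro sum.neutral) auto
          then show False using sum1 by simp
        qed
        \<comment> \<open>Jensen's inequality for ln with weights g x, obtained from the tangent at
          s x, the mean of the values c g.\<close>
        have "(\<Sum>g\<in>G'. ln (c g) * g x) \<le> (\<Sum>g\<in>G'. (ln (s x) + c g / s x - 1) * g x)"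
        proof (rule sum_mono)
          fix g assume g: "g \<in> G'"
          have "ln (c g / s x) \<le> c g / s x - 1" using c0[OF g] spos by (intro ln_le_minus_one) simp
          then show "ln (c g) * g x \<le> (ln (s x) + c g / s x - 1) * g x"
            using c0[OF g] spos G0[OF G'G[OF g]] by (intro mult_right_mono) (auto simp: ln_div)
        qed
        also have "\<dots> = (ln (s x) - 1) * (\<Sum>g\<in>G'. g x) + s x / s x"
          unfolding s_def[of x] sum_distrib_left sum_divide_distrib
          by (subst sum.distrib[symmetric]) (auto intro!: sum.cong simp: algebra_simps)
        finally have "(\<Sum>g\<in>G'. ln (c g) * g x) \<le> ln (s x)" using sum1 spos by simp
        moreover have "(\<Sum>i<n. ln (\<rho> ((\<alpha> ^^ i) x))) = ln (\<rho>n n x)"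
          unfolding \<rho>n_def using elim(2) by (subst ln_prod) (auto simp: less_imp_neq[symmetric])
        moreover have \<rho>p: "0 < \<rho>n n x" unfolding \<rho>n_def using elim(2) by (intro prod_pos) auto
        then have "ln (\<rho>n n x) + ln (s x) = ln (\<rho>n n x * s x)" using spos by (simp add: ln_mult)
        moreover have "\<dots> \<le> ln (f x)" using f_ge(2)[of x] \<rho>p spos by (intro ln_mono) auto
        ultimately show ?case by simp
      qed
    qed
    ultimately show ?thesis using F_iterate[OF f, of n] by simp
  qed
  have "real n * F \<le> - I ?R"
  proof (rule field_le_epsilon)
    fix e :: real assume e: "0 < e"
    define \<theta> where "\<theta> = e / (real N ^ n + 1)"
    have N: "0 < real N ^ n + 1" by (simp add: add_nonneg_pos)
    have "\<theta> * real N ^ n \<le> \<theta> * (real N ^ n + 1)" using e N by (intro mult_left_mono) (auto simp: \<theta>_def)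
    also have "\<dots> = e" using N by (simp add: \<theta>_def)
    finally show "real n * F \<le> - I ?R + e" using bound[of \<theta>] e N by (simp add: \<theta>_def)
  qed
  then have "real n * (I (\<lambda>x. ln (\<rho> x)) + F) \<le> (\<Sum>g\<in>G'. m g * - ln (c g))"
    unfolding R(2) by (simp add: algebra_simps sum_negf)
  also have "\<dots> = (\<Sum>g\<in>G'. m g * ln (a g / m g))"
    using m0 a0 by (intro sum.cong) (auto simp: c_def ln_div right_diff_distrib)
  finally show ?thesis unfolding m_def a_def .
qed

end

text \<open>Equal members of a family are merged by replacing \<open>g\<close>, \<open>g\<close> with \<open>2 g\<close>, since partitions
  of unity are sets here.\<close>

lemma partition_of_unity_from_family:
  assumes "finite I" "\<And>i. i \<in> I \<Longrightarrow> h i \<in> CX" "\<And>i x. i \<in> I \<Longrightarrow> 0 \<le> h i x"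
    and "\<And>x. (\<Sum>i\<in>I. h i x) = 1" and "\<And>i. i \<in> I \<Longrightarrow> Q (h i)"
    and Q: "\<And>g :: 'a::metric_space \<Rightarrow> real. Q g \<Longrightarrow> Q (\<lambda>x. 2 * g x)"
  shows "\<exists>G\<in>partitions_of_unity. \<forall>g\<in>G. Q g"
  using assms(1-5)
proof (induction "card I" arbitrary: I h rule: less_induct)
  case less
  show ?case
  proof (cases "inj_on h I")
    case True
    have "(\<Sum>g\<in>h ` I. g x) = 1" for x
      using less.prems(4)[of x] by (simp add: sum.reindex[OF True])
    then show ?thesis
      using less.prems by (intro bexI[of _ "h ` I"]) (auto simp: partitions_of_unity_def)
  next
    case False
    then obtain i j where ij: "i \<in> I" "j \<in> I" "i \<noteq> j" "h i = h j" by (auto simp: inj_on_def)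
    define h' where "h' = h(i := \<lambda>x. 2 * h i x)"
    have sum: "(\<Sum>k\<in>I - {j}. h' k x) = 1" for x
    proof -
      have "(\<Sum>k\<in>I - {j}. h' k x) = h' i x + (\<Sum>k\<in>I - {j} - {i}. h' k x)"
        using less.prems(1) ij by (intro sum.remove) auto
      also have "(\<Sum>k\<in>I - {j} - {i}. h' k x) = (\<Sum>k\<in>I - {j} - {i}. h k x)"
        by (intro sum.cong) (auto simp: h'_def)
      also have "h' i x = h j x + h i x" using ij by (simp add: h'_def)
      also have "h j x + h i x + (\<Sum>k\<in>I - {j} - {i}. h k x) = h j x + (\<Sum>k\<in>I - {j}. h k x)"
        using less.prems(1) ij by (subst (2) sum.remove[of _ i]) auto
      also have "\<dots> = (\<Sum>k\<in>I. h k x)" using less.prems(1) ij by (subst sum.remove[of I j]) auto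
      finally show ?thesis using less.prems(4) by simp
    qed
    show ?thesis
    proof (rule less.hyps[of "I - {j}" h'])
      show "card (I - {j}) < card I" using less.prems(1) ij by (intro psubset_card_mono) auto
      show "h' k \<in> CX" if "k \<in> I - {j}" for k
        using less.prems(2) that ij CX_intros(1,4) by (auto simp: h'_def)
      show "Q (h' k)" if "k \<in> I - {j}" for k
        using less.prems(5) that ij Q by (auto simp: h'_def)
    qed (use less.prems ij sum in \<open>auto simp: h'_def\<close>)
  qed
qed

lemma tent_sum:
  fixes t :: real and n :: nat
  assumes "\<bar>t\<bar> \<le> real n"
  shows "(\<Sum>j\<in>{- int n..int n}. max 0 (1 - \<bar>t - of_int j\<bar>)) = 1"
proof -
  define k where "k = \<lfloor>t\<rfloor>"
  have k: "of_int k \<le> t" "t < of_int k + 1" by (auto simp: k_def)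
  have kn: "- int n \<le> k" "k \<le> int n" using assms k by linarith+
  have zero: "max 0 (1 - \<bar>t - of_int j\<bar>) = 0" if "j \<noteq> k" "j \<noteq> k + 1" for j
  proof -
    have "j \<le> k - 1 \<or> k + 2 \<le> j" using that by linarith
    then have "of_int j \<le> (of_int k :: real) - 1 \<or> (of_int k :: real) + 2 \<le> of_int j"
      by (metis of_int_1 of_int_add of_int_diff of_int_le_iff of_int_numeral)
    then show ?thesis using k by auto
  qed
  have at: "max 0 (1 - \<bar>t - of_int k\<bar>) = 1 - (t - of_int k)"
    "max 0 (1 - \<bar>t - of_int (k + 1)\<bar>) = t - of_int k" using k by auto
  show ?thesis
  \<comment> \<open>At the right end the tent k + 1 is outside the index range, but there t = k and
    the tent k alone gives 1.\<close>
  proof (cases "k = int n")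
    case True
    then have t: "t = of_int k" using k assms by simp
    have "(\<Sum>j\<in>{- int n..int n}. max 0 (1 - \<bar>t - of_int j\<bar>)) = (\<Sum>j\<in>{k}. max 0 (1 - \<bar>t - of_int j\<bar>))"
      using kn True by (intro sum.mono_neutral_right) (auto simp: zero)
    then show ?thesis using t by simp
  next
    case False
    have "(\<Sum>j\<in>{- int n..int n}. max 0 (1 - \<bar>t - of_int j\<bar>)) = (\<Sum>j\<in>{k, k + 1}. max 0 (1 - \<bar>t - of_int j\<bar>))"
      using kn False by (intro sum.mono_neutral_right) (auto simp: zero)
    then show ?thesis using at by simp
  qed
qed

section \<open>Upper bound for the t-entropy from a single application of A\<close>

context transfer_measure begin

definition t_term :: "nat \<Rightarrow> ('a \<Rightarrow> real) \<Rightarrow> ereal" where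
  "t_term n g = (if integral\<^sup>L \<mu> g = 0 then 0
     else ereal (integral\<^sup>L \<mu> g) * eln (integral\<^sup>L \<mu> ((A ^^ n) g) / integral\<^sup>L \<mu> g))"

lemma integral_CX_nonneg: "g \<in> CX \<Longrightarrow> (\<And>x. 0 \<le> g x) \<Longrightarrow> 0 \<le> integral\<^sup>L \<mu> g"
  by (intro Bochner_Integration.integral_nonneg) auto

text \<open>The partition of unity consists of tent functions of \<open>\<phi>\<close>, on whose supports \<open>\<phi>\<close>
  oscillates by at most \<open>2 d\<close>.\<close>

lemma INF_t_term_le:
  assumes \<phi>: "\<phi> \<in> CX" and c: "0 < c" "integral\<^sup>L \<mu> (A (\<lambda>x. exp (\<phi> x))) \<le> c"
  shows "(INF G\<in>partitions_of_unity. \<Sum>g\<in>G. t_term 1 g) \<le> ereal (ln c - integral\<^sup>L \<mu> \<phi>)"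
proof -
  have bound: "(INF G\<in>partitions_of_unity. \<Sum>g\<in>G. t_term 1 g) \<le> ereal (ln c + exp (2 * d) - 1 - integral\<^sup>L \<mu> \<phi>)"
    if d: "0 < d" for d
  proof -
    obtain B where B: "\<And>x. \<bar>\<phi> x\<bar> \<le> B" using CX_bounded[OF X_compact \<phi>] by blast
    obtain n :: nat where n: "B / d < n" using reals_Archimedean2 by blast
    define h where "h j x = max 0 (1 - \<bar>\<phi> x / d - of_int j\<bar>)" for j :: int and x
    \<comment> \<open>Localization of \<phi> on the support of g, in terms of a free level b rather
      than the index j: in this form it survives doubling g, as the merging of equal members
      requires. For a tent, b is the upper end of its support, of width 2 d.\<close>
    define Q where "Q g \<longleftrightarrow> (\<exists>b. \<forall>x. g x \<noteq> 0 \<longrightarrow> \<phi> x \<le> b \<and> b \<le> \<phi> x + 2 * d)" for g :: "'a \<Rightarrow> real"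
    have "\<exists>G\<in>partitions_of_unity. \<forall>g\<in>G. Q g"
    proof (rule partition_of_unity_from_family[of "{- int n..int n}" h])
      show "h j \<in> CX" for j
        unfolding h_def using \<phi> d by (auto simp: CX_def intro!: continuous_intros)
      show "(\<Sum>j\<in>{- int n..int n}. h j x) = 1" for x
        unfolding h_def
      proof (rule tent_sum)
        have "\<bar>\<phi> x / d\<bar> \<le> B / d" using B[of x] d by (simp add: abs_divide divide_right_mono)
        then show "\<bar>\<phi> x / d\<bar> \<le> real n" using n by linarith
      qed
      show "Q (h j)" for j
        unfolding Q_def
      proof (intro exI allI impI)
        fix x assume "h j x \<noteq> 0"
        then have "\<bar>\<phi> x / d - of_int j\<bar> < 1" by (auto simp: h_def max_def split: if_splits)
        then have "\<phi> x / d < of_int j + 1" "of_int j - 1 < \<phi> x / d" by linarith+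
        then show "\<phi> x \<le> (of_int j + 1) * d \<and> (of_int j + 1) * d \<le> \<phi> x + 2 * d"
          using d by (simp add: field_simps)
      qed
      show "Q (\<lambda>x. 2 * g x)" if "Q g" for g using that by (auto simp: Q_def)
    qed (auto simp: h_def)
    then obtain G where G: "G \<in> partitions_of_unity" "\<And>g. g \<in> G \<Longrightarrow> Q g" by blast
    have finG: "finite G" and GC: "\<And>g. g \<in> G \<Longrightarrow> g \<in> CX" and G0: "\<And>g x. g \<in> G \<Longrightarrow> 0 \<le> g x"
      and G1: "\<And>x. (\<Sum>g\<in>G. g x) = 1"
      using G(1) by (auto simp: partitions_of_unity_def)
    obtain b where b: "\<And>g x. g \<in> G \<Longrightarrow> g x \<noteq> 0 \<Longrightarrow> \<phi> x \<le> b g \<and> b g \<le> \<phi> x + 2 * d"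
      using G(2) unfolding Q_def by metis
    have m\<phi>: "integral\<^sup>L \<mu> (\<lambda>x. \<phi> x * g x) \<le> b g * integral\<^sup>L \<mu> g" if g: "g \<in> G" for g
    proof -
      have "integral\<^sup>L \<mu> (\<lambda>x. \<phi> x * g x) \<le> integral\<^sup>L \<mu> (\<lambda>x. b g * g x)"
      proof (rule integral_mono)
        show "\<phi> x * g x \<le> b g * g x" for x
          using b[OF g, of x] G0[OF g, of x] by (cases "g x = 0") (auto intro: mult_right_mono)
      qed (use GC[OF g] \<phi> in \<open>auto intro!: CX_integrable CX_intros\<close>)
      then show ?thesis by simp
    qed
    have A\<phi>: "exp (b g) * integral\<^sup>L \<mu> (A g) \<le> exp (2 * d) * integral\<^sup>L \<mu> (A (\<lambda>x. exp (\<phi> x) * g x))"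
      if g: "g \<in> G" for g
    proof -
      have "integral\<^sup>L \<mu> (\<lambda>y. exp (b g) * A g y) \<le> integral\<^sup>L \<mu> (\<lambda>y. exp (2 * d) * A (\<lambda>x. exp (\<phi> x) * g x) y)"
      proof (rule integral_mono)
        fix y
        have "A (\<lambda>x. exp (b g) * g x) y \<le> A (\<lambda>x. exp (2 * d) * (exp (\<phi> x) * g x)) y"
        proof (rule A_mono)
          fix x
          show "exp (b g) * g x \<le> exp (2 * d) * (exp (\<phi> x) * g x)"
          proof (cases "g x = 0")
            case False
            then have "exp (b g) \<le> exp (2 * d + \<phi> x)" using b[OF g, of x] by simp
            then have "exp (b g) * g x \<le> exp (2 * d + \<phi> x) * g x"
              using G0[OF g] by (intro mult_right_mono) auto
            then show ?thesis by (simp add: exp_add)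
          qed simp
        qed (use GC[OF g] \<phi> in \<open>auto intro!: CX_intros\<close>)
        then show "exp (b g) * A g y \<le> exp (2 * d) * A (\<lambda>x. exp (\<phi> x) * g x) y"
          using GC[OF g] \<phi> by (simp add: A_cmult CX_intros)
      qed (use GC[OF g] \<phi> in \<open>auto intro!: CX_integrable CX_intros A_CX\<close>)
      then show ?thesis by simp
    qed
    \<comment> \<open>The tangent bound is taken where its errors add up well: over G the means sum
      to 1, and the terms with \<open>exp (b g)\<close> sum to at most
      \<open>exp (2 * d) * c\<close>. A member with vanishing mean of A g contributes -\<infinity>
      and needs no estimate.\<close>
    have term_le: "t_term 1 g \<le> ereal (integral\<^sup>L \<mu> g * (ln c - 1) + exp (b g) * integral\<^sup>L \<mu> (A g) / c - b g * integral\<^sup>L \<mu> g)"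
      if g: "g \<in> G" for g
    proof (cases "integral\<^sup>L \<mu> g = 0")
      case True
      have "0 \<le> integral\<^sup>L \<mu> (A g)"
        using GC[OF g] G0[OF g] by (intro integral_CX_nonneg A_CX A_nonneg)
      then show ?thesis using True c by (simp add: t_term_def)
    next
      case False
      then have m: "0 < integral\<^sup>L \<mu> g" using integral_CX_nonneg[OF GC[OF g] G0[OF g]] by simp
      show ?thesis
      proof (cases "0 < integral\<^sup>L \<mu> (A g)")
        case True
        define u where "u = exp (b g) * integral\<^sup>L \<mu> (A g) / (c * integral\<^sup>L \<mu> g)"
        have "ln u \<le> u - 1" unfolding u_def using True m c by (intro ln_le_minus_one) simp
        moreover have "ln u = b g + ln (integral\<^sup>L \<mu> (A g) / integral\<^sup>L \<mu> g) - ln c"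
          unfolding u_def using True m c by (simp add: ln_mult ln_div)
        ultimately have "ln (integral\<^sup>L \<mu> (A g) / integral\<^sup>L \<mu> g) \<le> ln c - 1 + u - b g" by simp
        then have "integral\<^sup>L \<mu> g * ln (integral\<^sup>L \<mu> (A g) / integral\<^sup>L \<mu> g) \<le> integral\<^sup>L \<mu> g * (ln c - 1 + u - b g)"
          using m by (intro mult_left_mono) auto
        also have "\<dots> = integral\<^sup>L \<mu> g * (ln c - 1) + exp (b g) * integral\<^sup>L \<mu> (A g) / c - b g * integral\<^sup>L \<mu> g"
          unfolding u_def using m c by (simp add: field_simps)
        finally show ?thesis using m True by (simp add: t_term_def eln_def not_le)
      next
        case False
        then have "integral\<^sup>L \<mu> (A g) / integral\<^sup>L \<mu> g \<le> 0" using m by (simp add: divide_le_0_iff)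
        then show ?thesis using m by (simp add: t_term_def eln_def)
      qed
    qed
    have "(INF G\<in>partitions_of_unity. \<Sum>g\<in>G. t_term 1 g) \<le> (\<Sum>g\<in>G. t_term 1 g)"
      by (rule INF_lower[OF G(1)])
    also have "\<dots> \<le> (\<Sum>g\<in>G. ereal (integral\<^sup>L \<mu> g * (ln c - 1) + exp (b g) * integral\<^sup>L \<mu> (A g) / c - b g * integral\<^sup>L \<mu> g))"
      by (intro sum_mono term_le)
    also have "\<dots> = ereal ((\<Sum>g\<in>G. integral\<^sup>L \<mu> g) * (ln c - 1) + (\<Sum>g\<in>G. exp (b g) * integral\<^sup>L \<mu> (A g)) / c
        - (\<Sum>g\<in>G. b g * integral\<^sup>L \<mu> g))"
      by (simp add: sum.distrib sum_subtractf sum_distrib_right sum_divide_distrib)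
    also have "\<dots> \<le> ereal (ln c + exp (2 * d) - 1 - integral\<^sup>L \<mu> \<phi>)"
    proof -
      have "integral\<^sup>L \<mu> \<phi> = (\<integral>x. (\<Sum>g\<in>G. \<phi> x * g x) \<partial>\<mu>)"
        using G1 by (simp add: sum_distrib_left[symmetric])
      also have "\<dots> = (\<Sum>g\<in>G. integral\<^sup>L \<mu> (\<lambda>x. \<phi> x * g x))"
        using GC \<phi> by (intro Bochner_Integration.integral_sum CX_integrable CX_intros)
      also have "\<dots> \<le> (\<Sum>g\<in>G. b g * integral\<^sup>L \<mu> g)" by (intro sum_mono m\<phi>)
      finally have 1: "integral\<^sup>L \<mu> \<phi> \<le> (\<Sum>g\<in>G. b g * integral\<^sup>L \<mu> g)" .
      have "(\<Sum>g\<in>G. exp (b g) * integral\<^sup>L \<mu> (A g)) \<le> (\<Sum>g\<in>G. exp (2 * d) * integral\<^sup>L \<mu> (A (\<lambda>x. exp (\<phi> x) * g x)))"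
        by (intro sum_mono A\<phi>)
      also have "\<dots> = exp (2 * d) * (\<integral>y. (\<Sum>g\<in>G. A (\<lambda>x. exp (\<phi> x) * g x) y) \<partial>\<mu>)"
        using GC \<phi> by (subst Bochner_Integration.integral_sum)
          (auto intro!: CX_integrable CX_intros A_CX simp: sum_distrib_left)
      also have "(\<lambda>y. \<Sum>g\<in>G. A (\<lambda>x. exp (\<phi> x) * g x) y) = A (\<lambda>x. \<Sum>g\<in>G. exp (\<phi> x) * g x)"
        using finG GC \<phi> by (intro ext A_sum[symmetric] CX_intros)
      also have "\<dots> = A (\<lambda>x. exp (\<phi> x))" using G1 by (simp add: sum_distrib_left[symmetric])
      also have "exp (2 * d) * integral\<^sup>L \<mu> (A (\<lambda>x. exp (\<phi> x))) \<le> exp (2 * d) * c"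
        using c by (intro mult_left_mono) auto
      finally have 2: "(\<Sum>g\<in>G. exp (b g) * integral\<^sup>L \<mu> (A g)) / c \<le> exp (2 * d)"
        using c by (simp add: field_simps)
      show ?thesis using 1 2 sum_integral_unity[OF G(1)] by simp
    qed
    finally show ?thesis .
  qed
  \<comment> \<open>The partition depends on d but the infimum does not, so d can tend to 0.\<close>
  have "((\<lambda>d. ln c + exp (2 * d) - 1 - integral\<^sup>L \<mu> \<phi>) \<longlongrightarrow> ln c + exp (2 * 0) - 1 - integral\<^sup>L \<mu> \<phi>) (at_right 0)"
    by (intro tendsto_intros)
  then have "((\<lambda>d. ereal (ln c + exp (2 * d) - 1 - integral\<^sup>L \<mu> \<phi>)) \<longlongrightarrow> ereal (ln c - integral\<^sup>L \<mu> \<phi>)) (at_right 0)"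
    by simp
  then show ?thesis
    by (rule tendsto_lowerbound) (use bound in \<open>auto simp: eventually_at_right_less eventually_at_filter intro!: eventually_mono[OF eventually_at_right_less]\<close>)
qed

lemma INF_t_term_le_V:
  assumes f: "f \<in> positive_functions" and e: "0 < e"
  shows "(INF G\<in>partitions_of_unity. \<Sum>g\<in>G. t_term 1 g) \<le> ereal (I (\<lambda>x. ln (\<rho> x + e)) + V f)"
proof -
  \<comment> \<open>The shift by e keeps \<phi>0 real and continuous where \<rho> vanishes.\<close>
  define \<phi>0 where "\<phi>0 x = ln (f x) - ln (L f (\<alpha> x)) - ln (\<rho> x + e)" for x
  have f0: "0 < f x" and Lf0: "0 < L f x" if "x \<in> S" for x
    using f positive_L[OF f] that by (auto simp: positive_functions_def)
  have \<rho>e: "(\<lambda>x. \<rho> x + e) \<in> positive_functions"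
    using e \<rho>_continuous \<rho>_nonneg by (auto simp: positive_functions_def intro!: continuous_intros add_nonneg_pos)
  have i: "set_integrable \<mu> S (\<lambda>x. ln (f x))" "set_integrable \<mu> S (\<lambda>x. ln (L f (\<alpha> x)))"
    "set_integrable \<mu> S (\<lambda>x. ln (\<rho> x + e))"
    using integrable_ln[OF f] set_integrable_\<alpha>[OF integrable_ln[OF positive_L[OF f]]] integrable_ln[OF \<rho>e] by auto
  have I\<phi>0: "I \<phi>0 = - V f - I (\<lambda>x. ln (\<rho> x + e))"
    unfolding \<phi>0_def[abs_def] V_def
    using set_integral_diff(2)[OF set_integral_diff(1)[OF i(1,2)] i(3)] set_integral_diff(2)[OF i(1,2)]
      I_\<alpha>[OF integrable_ln[OF positive_L[OF f]]] by simp
  have "continuous_on S (\<lambda>x. ln (L f (\<alpha> x)))"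
    using continuous_on_compose2[OF continuous_ln[OF positive_L[OF f]] continuous_on_subset[OF \<alpha>_cont, of S]] \<alpha>_in by auto
  then have \<phi>0C: "continuous_on S \<phi>0"
    unfolding \<phi>0_def[abs_def] using continuous_ln[OF f] continuous_ln[OF \<rho>e] by (intro continuous_on_diff)
  obtain \<phi> where \<phi>: "\<phi> \<in> CX" "\<And>x. x \<in> S \<Longrightarrow> \<phi> x = \<phi>0 x" using Tietze_CX[OF S_closed \<phi>0C] by metis
  \<comment> \<open>A integrates over all of X, whereas the bound on fibre sums concerns S only. The
    penalty removes the mass of \<open>\<nu> x\<close> off S in the limit, and it does not change
    the \<mu>-integral because \<mu> is carried by S.\<close>
  define \<psi> where "\<psi> k x = \<phi> x - real k * infdist x S" for k :: nat and x
  have \<psi>C: "\<psi> k \<in> CX" for k unfolding \<psi>_def using \<phi>(1) by (intro CX_intros)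
  have e\<psi>C: "(\<lambda>x. exp (\<psi> k x)) \<in> CX" for k using \<psi>C by (rule CX_intros)
  have e\<phi>C: "(\<lambda>x. exp (\<phi> x)) \<in> CX" using \<phi>(1) by (rule CX_intros)
  have \<psi>S: "\<psi> k x = \<phi>0 x" if "x \<in> S" for k x using \<phi>(2) that by (simp add: \<psi>_def)
  have \<psi>le: "\<psi> k x \<le> \<phi> x" for k x by (simp add: \<psi>_def infdist_nonneg)
  have Sne: "S \<noteq> {}" using AE_S AE_False by auto
  have lim: "(\<lambda>k. A (\<lambda>x. exp (\<psi> k x)) x) \<longlonglongrightarrow> L (\<lambda>y. \<rho> y * exp (\<phi>0 y)) x" if x: "x \<in> S" for x
  proof -
    have "(\<lambda>k. integral\<^sup>L (\<nu> x) (\<lambda>y. exp (\<psi> k y))) \<longlonglongrightarrow> (\<integral>y. indicator S y *\<^sub>R exp (\<phi>0 y) \<partial>\<nu> x)"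
    proof (rule integral_dominated_convergence[where w = "\<lambda>y. exp (\<phi> y)"])
      show "(\<lambda>y. indicator S y *\<^sub>R exp (\<phi>0 y)) \<in> borel_measurable (\<nu> x)"
        unfolding measurable_cong_sets[OF rep_measure(1) refl]
        using \<phi>0C borel_closed[OF S_closed]
        by (intro borel_measurable_continuous_on_indicator continuous_intros)
      show "AE y in \<nu> x. (\<lambda>k. exp (\<psi> k y)) \<longlonglongrightarrow> indicator S y *\<^sub>R exp (\<phi>0 y)"
      proof (rule AE_I2)
        fix y
        show "(\<lambda>k. exp (\<psi> k y)) \<longlonglongrightarrow> indicator S y *\<^sub>R exp (\<phi>0 y)"
        proof (cases "y \<in> S")
          case False
          then have pos: "0 < infdist y S" using S_closed Sne by (intro infdist_pos_not_in_closed)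
          have "(\<lambda>k. exp (\<phi> y) * exp (- infdist y S) ^ k) \<longlonglongrightarrow> exp (\<phi> y) * 0"
            using pos by (intro tendsto_mult tendsto_const LIMSEQ_power_zero) simp
          moreover have "exp (\<psi> k y) = exp (\<phi> y) * exp (- infdist y S) ^ k" for k
            unfolding \<psi>_def exp_of_nat_mult[symmetric] exp_add[symmetric] by simp
          ultimately show ?thesis using False by simp
        qed (simp add: \<psi>S)
      qed
    qed (use CX_measurable_\<nu>[OF e\<psi>C] CX_integrable_\<nu>[OF e\<phi>C] \<psi>le in auto)
    moreover have "(\<integral>y. indicator S y *\<^sub>R exp (\<phi>0 y) \<partial>\<nu> x) = L (\<lambda>y. \<rho> y * exp (\<phi>0 y)) x"
      using integral_\<nu>_S[of "\<lambda>y. exp (\<phi>0 y)", OF _ x] \<phi>0C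
      by (simp add: set_lebesgue_integral_def continuous_on_exp)
    ultimately show ?thesis using rep_measure(3)[OF e\<psi>C] by simp
  qed
  \<comment> \<open>The factor \<rho> / (\<rho> + e) is at most 1, and what remains is a probability
    on the fibre.\<close>
  have L1: "L (\<lambda>y. \<rho> y * exp (\<phi>0 y)) x \<le> 1" if x: "x \<in> S" for x
  proof -
    have "L (\<lambda>y. \<rho> y * exp (\<phi>0 y)) x \<le> L (\<lambda>y. (1 / L f (\<alpha> y)) * f y) x"
    proof (rule L_mono)
      fix y assume y: "y \<in> S"
      have "exp (\<phi>0 y) = f y / L f (\<alpha> y) / (\<rho> y + e)"
        using f0[OF y] Lf0[OF \<alpha>_in[OF y]] e \<rho>_nonneg[of y]
        by (simp add: \<phi>0_def exp_diff add_nonneg_pos)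
      then have "\<rho> y * exp (\<phi>0 y) = (\<rho> y / (\<rho> y + e)) * (f y / L f (\<alpha> y))" by simp
      also have "\<dots> \<le> 1 * (f y / L f (\<alpha> y))"
        using f0[OF y] Lf0[OF \<alpha>_in[OF y]] e \<rho>_nonneg[of y]
        by (intro mult_right_mono) (auto simp: divide_le_eq_1 add_nonneg_pos)
      finally show "\<rho> y * exp (\<phi>0 y) \<le> (1 / L f (\<alpha> y)) * f y" by simp
    qed
    also have "\<dots> = (1 / L f x) * L f x" by (rule L_pull)
    finally show ?thesis using Lf0[OF x] by simp
  qed
  have "(\<lambda>k. integral\<^sup>L \<mu> (A (\<lambda>x. exp (\<psi> k x)))) \<longlonglongrightarrow> I (L (\<lambda>y. \<rho> y * exp (\<phi>0 y)))"
    unfolding CX_I[OF A_CX[OF e\<psi>C]] set_lebesgue_integral_def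
  proof (rule integral_dominated_convergence[where w = "\<lambda>x. indicator S x *\<^sub>R A (\<lambda>x. exp (\<phi> x)) x"])
    show "(\<lambda>x. indicator S x *\<^sub>R L (\<lambda>y. \<rho> y * exp (\<phi>0 y)) x) \<in> borel_measurable \<mu>"
      using set_measurable_continuous[OF L\<rho>_continuous] \<phi>0C
      by (simp add: set_borel_measurable_def continuous_on_exp)
    show "(\<lambda>x. indicator S x *\<^sub>R A (\<lambda>x. exp (\<psi> k x)) x) \<in> borel_measurable \<mu>" for k
      using set_measurable_continuous[OF CX_on_S[OF A_CX[OF e\<psi>C]]] by (simp add: set_borel_measurable_def)
    show "integrable \<mu> (\<lambda>x. indicator S x *\<^sub>R A (\<lambda>x. exp (\<phi> x)) x)"
      using set_integrable_continuous[OF CX_on_S[OF A_CX[OF e\<phi>C]]] by (simp add: set_integrable_def)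
    show "AE x in \<mu>. (\<lambda>k. indicator S x *\<^sub>R A (\<lambda>x. exp (\<psi> k x)) x)
        \<longlonglongrightarrow> indicator S x *\<^sub>R L (\<lambda>y. \<rho> y * exp (\<phi>0 y)) x"
      using lim by (intro AE_I2) (auto simp: indicator_def)
    show "AE x in \<mu>. norm (indicator S x *\<^sub>R A (\<lambda>x. exp (\<psi> k x)) x) \<le> indicator S x *\<^sub>R A (\<lambda>x. exp (\<phi> x)) x" for k
      using A_nonneg[OF e\<psi>C] A_mono[OF e\<psi>C e\<phi>C] \<psi>le by (intro AE_I2) (auto simp: indicator_def)
  qed
  moreover have "I (L (\<lambda>y. \<rho> y * exp (\<phi>0 y))) \<le> I (\<lambda>_. 1)"
    by (intro I_mono set_integrable_continuous L\<rho>_continuous continuous_intros \<phi>0C L1)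
  \<comment> \<open>The bound 1 is reached only in the limit, so the constant c of
    \<open>INF_t_term_le\<close> is taken as 1 + d, at the cost ln (1 + d) \<le> d.\<close>
  ultimately have ev: "eventually (\<lambda>k. integral\<^sup>L \<mu> (A (\<lambda>x. exp (\<psi> k x))) < 1 + d) sequentially" if "0 < d" for d
    using that by (intro order_tendstoD(2)) auto
  show ?thesis
  proof (rule ereal_le_epsilon2)
    fix d :: real assume d: "0 < d"
    obtain k where k: "integral\<^sup>L \<mu> (A (\<lambda>x. exp (\<psi> k x))) < 1 + d"
      using ev[OF d] by (auto simp: eventually_sequentially)
    have "(INF G\<in>partitions_of_unity. \<Sum>g\<in>G. t_term 1 g) \<le> ereal (ln (1 + d) - integral\<^sup>L \<mu> (\<psi> k))"
      using d k by (intro INF_t_term_le \<psi>C) auto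
    also have "integral\<^sup>L \<mu> (\<psi> k) = I \<phi>0" unfolding CX_I[OF \<psi>C] by (intro I_cong \<psi>S)
    also have "ereal (ln (1 + d) - I \<phi>0) \<le> ereal (I (\<lambda>x. ln (\<rho> x + e)) + V f) + ereal d"
      using ln_add_one_self_le_self[of d] d unfolding I\<phi>0 by simp
    finally show "(INF G\<in>partitions_of_unity. \<Sum>g\<in>G. t_term 1 g)
      \<le> ereal (I (\<lambda>x. ln (\<rho> x + e)) + V f) + ereal d" .
  qed
qed

end

section \<open>The integral of ln rho, possibly -\<infinity>, and the formula for the
  t-entropy\<close>

context transfer_measure begin

abbreviation "J \<equiv> set_ereal_integral \<mu> S (\<lambda>x. eln (\<rho> x))"

lemma \<rho>_bounded: obtains B where "1 \<le> B" "\<And>x. x \<in> S \<Longrightarrow> \<rho> x \<le> B"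
proof -
  have "bounded (\<rho> ` S)" using \<rho>_continuous S_compact by (intro compact_imp_bounded compact_continuous_image)
  then obtain B where "\<And>x. x \<in> S \<Longrightarrow> \<bar>\<rho> x\<bar> \<le> B" by (auto simp: bounded_iff)
  then show ?thesis by (intro that[of "max 1 B"]) (auto simp: le_max_iff_disj abs_le_iff)
qed

text \<open>The shift by 1 makes one C dominate the logarithms of
  \<open>\<rho> x + 1 / real (Suc k)\<close> for all k at once.\<close>

lemma ln_\<rho>_bounded: obtains C where "0 \<le> C" "\<And>x. x \<in> S \<Longrightarrow> ln (\<rho> x + 1) \<le> C"
proof -
  obtain B where B: "1 \<le> B" "\<And>x. x \<in> S \<Longrightarrow> \<rho> x \<le> B" using \<rho>_bounded by metis
  show ?thesis
    using B \<rho>_nonneg by (intro that[of "ln (B + 1)"]) (auto intro!: ln_mono add_nonneg_pos)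
qed

lemma \<rho>_set_measurable [measurable]: "(\<lambda>x. indicator S x * \<rho> x) \<in> borel_measurable \<mu>"
  using set_measurable_continuous[OF \<rho>_continuous] by (simp add: set_borel_measurable_def)

lemma ln_\<rho>_e_integrable: "0 < e \<Longrightarrow> set_integrable \<mu> S (\<lambda>x. ln (\<rho> x + e))"
  using \<rho>_continuous \<rho>_nonneg
  by (intro integrable_ln) (auto simp: positive_functions_def intro!: continuous_intros add_nonneg_pos)

text \<open>\<open>H\<close> is the integral of \<open>C - ln \<rho> \<ge> 0\<close>, as a limit of integrals of \<open>C - ln (\<rho> + e)\<close>
  by monotone convergence; this treats the cases \<open>J = -\<infinity>\<close> and \<open>J > -\<infinity>\<close> together.\<close>

lemma J_limit:
  fixes C :: real
  assumes C: "0 \<le> C" "\<And>x. x \<in> S \<Longrightarrow> ln (\<rho> x + 1) \<le> C"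
  defines "H \<equiv> \<integral>\<^sup>+x. e2ennreal (ereal C - eln (\<rho> x)) * indicator S x \<partial>\<mu>"
  shows "J = ereal C - enn2ereal H"
    and "(SUP k. ennreal (C - I (\<lambda>x. ln (\<rho> x + 1 / real (Suc k))))) = H"
proof -
  let ?pos = "\<lambda>x. e2ennreal (eln (\<rho> x)) * indicator S x"
  let ?neg = "\<lambda>x. e2ennreal (- eln (\<rho> x)) * indicator S x"
  let ?h = "\<lambda>x. e2ennreal (ereal C - eln (\<rho> x)) * indicator S x"
  have ms: "(\<lambda>x. \<phi> (\<rho> x) * indicator S x) \<in> borel_measurable \<mu>"
    if [measurable]: "\<phi> \<in> borel_measurable borel" for \<phi> :: "real \<Rightarrow> ennreal"
  proof -
    have "(\<lambda>x. \<phi> (\<rho> x) * indicator S x) = (\<lambda>x. \<phi> (indicator S x * \<rho> x) * indicator S x)"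
      by (auto simp: indicator_def)
    then show ?thesis by simp
  qed
  have eln_m: "eln \<in> borel_measurable borel" unfolding eln_def by measurable
  have posm: "?pos \<in> borel_measurable \<mu>" and negm: "?neg \<in> borel_measurable \<mu>"
    and hm: "?h \<in> borel_measurable \<mu>"
    using eln_m by (auto intro!: ms[of "\<lambda>t. e2ennreal (eln t)"] ms[of "\<lambda>t. e2ennreal (- eln t)"]
      ms[of "\<lambda>t. e2ennreal (ereal C - eln t)"])
  have le: "eln (\<rho> x) \<le> ereal C" if x: "x \<in> S" for x
  proof (cases "\<rho> x \<le> 0")
    case False
    then have "ln (\<rho> x) \<le> ln (\<rho> x + 1)" by (intro ln_mono) auto
    then have "ln (\<rho> x) \<le> C" using C(2)[OF x] by (rule order_trans)
    then show ?thesis using False by (simp add: eln_def)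
  qed (simp add: eln_def)
  have int1: "(\<integral>\<^sup>+x. ennreal C * indicator S x \<partial>\<mu>) = ennreal C"
  proof -
    have "(\<integral>\<^sup>+x. ennreal C * indicator S x \<partial>\<mu>) = (\<integral>\<^sup>+x. ennreal C \<partial>\<mu>)"
      by (rule nn_integral_cong_AE, rule eventually_mono[OF AE_S]) simp
    then show ?thesis using emeasure_space_1 by simp
  qed
  have "(\<integral>\<^sup>+x. ?pos x \<partial>\<mu>) \<le> (\<integral>\<^sup>+x. ennreal C * indicator S x \<partial>\<mu>)"
    using le by (intro nn_integral_mono) (auto simp: indicator_def e2ennreal_ereal[symmetric] intro!: e2ennreal_mono simp del: e2ennreal_ereal)
  then have posfin: "(\<integral>\<^sup>+x. ?pos x \<partial>\<mu>) \<noteq> \<infinity>" using int1 by (auto simp: top_unique)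
  \<comment> \<open>The identity C - ln \<rho> = C + neg - pos in additive form, since subtraction
    in \<open>ennreal\<close> truncates; the integral of \<open>?pos\<close> is finite and can be
    cancelled afterwards.\<close>
  have "?pos x + ?h x = ennreal C * indicator S x + ?neg x" for x
  proof (cases "x \<in> S")
    case x: True
    show ?thesis
    proof (cases "\<rho> x \<le> 0")
      case True
      then show ?thesis using x by (simp add: eln_def)
    next
      case False
      have l: "ln (\<rho> x) \<le> C" using le[OF x] False by (simp add: eln_def)
      have "ennreal (ln (\<rho> x)) + ennreal (C - ln (\<rho> x)) = ennreal C + ennreal (- ln (\<rho> x))"
      proof (cases "0 \<le> ln (\<rho> x)")
        case True
        then show ?thesis using l C by (simp add: ennreal_plus[symmetric] ennreal_neg del: ennreal_plus)
      next
        case False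
        then show ?thesis using l C by (simp add: ennreal_plus[symmetric] ennreal_neg del: ennreal_plus)
      qed
      then show ?thesis using x False by (simp add: eln_def)
    qed
  qed simp
  then have "(\<integral>\<^sup>+x. ?pos x + ?h x \<partial>\<mu>) = (\<integral>\<^sup>+x. ennreal C * indicator S x + ?neg x \<partial>\<mu>)"
    by (intro nn_integral_cong) simp
  then have "(\<integral>\<^sup>+x. ?pos x \<partial>\<mu>) + H = (\<integral>\<^sup>+x. ennreal C * indicator S x \<partial>\<mu>) + (\<integral>\<^sup>+x. ?neg x \<partial>\<mu>)"
    unfolding H_def
    using nn_integral_add[OF posm hm] nn_integral_add[OF _ negm, of "\<lambda>x. ennreal C * indicator S x"] by simp
  then have "(\<integral>\<^sup>+x. ?pos x \<partial>\<mu>) + H = ennreal C + (\<integral>\<^sup>+x. ?neg x \<partial>\<mu>)"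
    unfolding int1 .
  then have eq: "enn2ereal (\<integral>\<^sup>+x. ?pos x \<partial>\<mu>) + enn2ereal H = ereal C + enn2ereal (\<integral>\<^sup>+x. ?neg x \<partial>\<mu>)"
    using C by (metis plus_ennreal.rep_eq enn2ereal_ennreal)
  obtain p where p: "enn2ereal (\<integral>\<^sup>+x. ?pos x \<partial>\<mu>) = ereal p"
    using posfin enn2ereal_nonneg[of "\<integral>\<^sup>+x. ?pos x \<partial>\<mu>"]
    by (cases "\<integral>\<^sup>+x. ?pos x \<partial>\<mu>" rule: ennreal_cases) auto
  show "J = ereal C - enn2ereal H"
    unfolding set_ereal_integral_def using eq unfolding p
    using enn2ereal_nonneg[of H] enn2ereal_nonneg[of "\<integral>\<^sup>+x. ?neg x \<partial>\<mu>"]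
    by (cases "enn2ereal H"; cases "enn2ereal (\<integral>\<^sup>+x. ?neg x \<partial>\<mu>)") auto
  let ?hk = "\<lambda>k x. ennreal (C - ln (\<rho> x + 1 / real (Suc k))) * indicator S x"
  have le1: "ln (\<rho> x + 1 / real (Suc k)) \<le> C" if "x \<in> S" for x k
  proof -
    have "1 / real (Suc k) \<le> 1" by simp
    moreover have "0 < \<rho> x + 1 / real (Suc k)" using \<rho>_nonneg by (intro add_nonneg_pos) auto
    ultimately have "ln (\<rho> x + 1 / real (Suc k)) \<le> ln (\<rho> x + 1)" by (intro ln_mono) auto
    then show ?thesis using C(2)[OF that] by simp
  qed
  have hk_int: "(\<integral>\<^sup>+x. ?hk k x \<partial>\<mu>) = ennreal (C - I (\<lambda>x. ln (\<rho> x + 1 / real (Suc k))))" for k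
  proof -
    have i: "set_integrable \<mu> S (\<lambda>x. C - ln (\<rho> x + 1 / real (Suc k)))"
      "I (\<lambda>x. C - ln (\<rho> x + 1 / real (Suc k))) = C - I (\<lambda>x. ln (\<rho> x + 1 / real (Suc k)))"
      using set_integral_diff[OF set_integrable_continuous[OF continuous_on_const[of S C]]
        ln_\<rho>_e_integrable[of "1 / real (Suc k)"]] by auto
    have "(\<integral>\<^sup>+x. ?hk k x \<partial>\<mu>) = (\<integral>\<^sup>+x. ennreal (indicator S x *\<^sub>R (C - ln (\<rho> x + 1 / real (Suc k)))) \<partial>\<mu>)"
      by (intro nn_integral_cong) (auto simp: indicator_def)
    also have "\<dots> = ennreal (\<integral>x. indicator S x *\<^sub>R (C - ln (\<rho> x + 1 / real (Suc k))) \<partial>\<mu>)"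
      using i(1) le1 by (intro nn_integral_eq_integral) (auto simp: set_integrable_def indicator_def)
    finally show ?thesis using i(2) by (simp add: set_lebesgue_integral_def)
  qed
  have hk_meas: "?hk k \<in> borel_measurable \<mu>" for k
    by (rule ms[of "\<lambda>t. ennreal (C - ln (t + 1 / real (Suc k)))"]) measurable
  have inc: "incseq ?hk"
  proof (rule incseq_SucI, rule le_funI)
    fix k x
    have "ln (\<rho> x + 1 / real (Suc (Suc k))) \<le> ln (\<rho> x + 1 / real (Suc k))"
    proof (rule ln_mono)
      show "0 < \<rho> x + 1 / real (Suc (Suc k))" using \<rho>_nonneg by (intro add_nonneg_pos) auto
      show "\<rho> x + 1 / real (Suc (Suc k)) \<le> \<rho> x + 1 / real (Suc k)"
        by (intro add_left_mono divide_left_mono) auto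
    qed
    then show "?hk k x \<le> ?hk (Suc k) x" by (intro mult_right_mono ennreal_leI) auto
  qed
  \<comment> \<open>Where \<rho> x = 0 the logarithms tend to -\<infinity> and both sides are
    infinite; this is the case in which \<open>eln\<close> differs from \<open>ln\<close>.\<close>
  have sup: "(SUP k. ?hk k x) = ?h x" if x: "x \<in> S" for x
  proof (rule LIMSEQ_unique[OF LIMSEQ_SUP])
    show "incseq (\<lambda>k. ?hk k x)" using inc by (auto simp: incseq_def le_fun_def)
    have lim0: "(\<lambda>k. \<rho> x + 1 / real (Suc k)) \<longlonglongrightarrow> \<rho> x + 0"
      by (intro tendsto_intros LIMSEQ_inverse_real_of_nat[unfolded inverse_eq_divide])
    show "(\<lambda>k. ?hk k x) \<longlonglongrightarrow> ?h x"
    proof (cases "\<rho> x \<le> 0")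
      case True
      then have \<rho>0: "\<rho> x = 0" using \<rho>_nonneg[of x] by simp
      have "filterlim (\<lambda>k. \<rho> x + 1 / real (Suc k)) (at_right 0) sequentially"
        using lim0 \<rho>0 by (auto simp: filterlim_at)
      then have "filterlim (\<lambda>k. ln (\<rho> x + 1 / real (Suc k))) at_bot sequentially"
        by (rule filterlim_compose[OF ln_at_0])
      then have "filterlim (\<lambda>k. - ln (\<rho> x + 1 / real (Suc k))) at_top sequentially"
        by (simp add: filterlim_uminus_at_top)
      then have "filterlim (\<lambda>k. C + - ln (\<rho> x + 1 / real (Suc k))) at_top sequentially"
        by (rule filterlim_tendsto_add_at_top[OF tendsto_const])
      then have "(\<lambda>k. ennreal (C + - ln (\<rho> x + 1 / real (Suc k)))) \<longlonglongrightarrow> \<infinity>"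
        by (simp only: ennreal_tendsto_top_eq_at_top infinity_ennreal_def)
      then show ?thesis using True x by (simp add: eln_def)
    next
      case False
      have "(\<lambda>k. ennreal (C - ln (\<rho> x + 1 / real (Suc k)))) \<longlonglongrightarrow> ennreal (C - ln (\<rho> x + 0))"
        using False by (intro tendsto_ennrealI tendsto_diff tendsto_const tendsto_ln lim0) auto
      then show ?thesis using False x by (simp add: eln_def)
    qed
  qed
  have "(SUP k. ennreal (C - I (\<lambda>x. ln (\<rho> x + 1 / real (Suc k))))) = (\<integral>\<^sup>+x. (SUP k. ?hk k x) \<partial>\<mu>)"
    unfolding hk_int[symmetric]
    by (rule nn_integral_monotone_convergence_SUP[OF inc hk_meas, symmetric])
  also have "\<dots> = H"
    unfolding H_def
  proof (rule nn_integral_cong)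
    fix x show "(SUP k. ?hk k x) = ?h x"
      using sup[of x] by (cases "x \<in> S") auto
  qed
  finally show "(SUP k. ennreal (C - I (\<lambda>x. ln (\<rho> x + 1 / real (Suc k))))) = H" .
qed

text \<open>H is finite here, so its integrand is finite almost everywhere, which excludes \<rho> =
  0 up to a null set; \<open>eln\<close> then agrees with \<open>ln\<close> and the integral is an
  ordinary one.\<close>

lemma J_real:
  assumes "J \<noteq> -\<infinity>"
  shows "AE x in \<mu>. 0 < \<rho> x" and "set_integrable \<mu> S (\<lambda>x. ln (\<rho> x))" and "J = ereal (I (\<lambda>x. ln (\<rho> x)))"
proof -
  obtain C where C: "0 \<le> C" "\<And>x. x \<in> S \<Longrightarrow> ln (\<rho> x + 1) \<le> C" using ln_\<rho>_bounded by metis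
  let ?h = "\<lambda>x. e2ennreal (ereal C - eln (\<rho> x)) * indicator S x"
  define H where "H = (\<integral>\<^sup>+x. ?h x \<partial>\<mu>)"
  have JH: "J = ereal C - enn2ereal H" unfolding H_def by (rule J_limit(1)[OF C])
  then have Hfin: "H \<noteq> \<infinity>" using assms by auto
  have eq: "?h x = ennreal (C - ln (\<rho> x)) * indicator S x" if "0 < \<rho> x" for x
    using that by (simp add: eln_def)
  have \<rho>m: "(\<lambda>x. indicator S x * \<rho> x) \<in> borel_measurable \<mu>" by measurable
  have hm: "?h \<in> borel_measurable \<mu>"
  proof -
    have "?h = (\<lambda>x. e2ennreal (ereal C - eln (indicator S x * \<rho> x)) * indicator S x)"
      by (auto simp: indicator_def)
    also have "\<dots> \<in> borel_measurable \<mu>" unfolding eln_def by measurable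
    finally show ?thesis .
  qed
  have "AE x in \<mu>. ?h x \<noteq> \<infinity>" using hm Hfin unfolding H_def by (intro nn_integral_PInf_AE) auto
  then show pos: "AE x in \<mu>. 0 < \<rho> x"
    using AE_S
  proof eventually_elim
    case (elim x)
    then show ?case by (cases "\<rho> x \<le> 0") (auto simp: eln_def)
  qed
  let ?g = "\<lambda>x. indicator S x *\<^sub>R (C - ln (\<rho> x))"
  have lnm: "(\<lambda>x. indicator S x *\<^sub>R ln (\<rho> x)) \<in> borel_measurable \<mu>"
  proof -
    have "(\<lambda>x. indicator S x *\<^sub>R ln (\<rho> x)) = (\<lambda>x. indicator S x *\<^sub>R ln (indicator S x * \<rho> x))"
      by (auto simp: indicator_def)
    also have "\<dots> \<in> borel_measurable \<mu>" by measurable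
    finally show ?thesis .
  qed
  have gm: "?g \<in> borel_measurable \<mu>"
  proof -
    have "(\<lambda>x. indicator S x *\<^sub>R C - indicator S x *\<^sub>R ln (\<rho> x)) \<in> borel_measurable \<mu>"
      using lnm by measurable
    then show ?thesis by (simp add: right_diff_distrib)
  qed
  have g0: "AE x in \<mu>. 0 \<le> ?g x"
    using pos
  proof eventually_elim
    case (elim x)
    show ?case
    proof (cases "x \<in> S")
      case True
      have "ln (\<rho> x) \<le> ln (\<rho> x + 1)" using elim by (intro ln_mono) auto
      then have "ln (\<rho> x) \<le> C" using C(2)[OF True] by (rule order_trans)
      then show ?thesis using True by simp
    qed simp
  qed
  have Hg: "(\<integral>\<^sup>+x. ennreal (?g x) \<partial>\<mu>) = H"
    unfolding H_def by (intro nn_integral_cong_AE) (use pos in \<open>eventually_elim, auto simp: eln_def indicator_def\<close>)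
  have gi: "integrable \<mu> ?g"
    using gm g0 Hg Hfin by (intro integrableI_nonneg) (auto simp: less_top)
  have Hval: "H = ennreal (integral\<^sup>L \<mu> ?g)" using nn_integral_eq_integral[OF gi g0] Hg by simp
  have gi': "set_integrable \<mu> S (\<lambda>x. C - ln (\<rho> x))" using gi by (simp add: set_integrable_def)
  have Ci: "set_integrable \<mu> S (\<lambda>x. C)" by (intro set_integrable_continuous continuous_intros)
  show li: "set_integrable \<mu> S (\<lambda>x. ln (\<rho> x))"
    using set_integral_diff(1)[OF Ci gi'] by simp
  have "integral\<^sup>L \<mu> ?g = C - I (\<lambda>x. ln (\<rho> x))"
    using set_integral_diff(2)[OF Ci li] by (simp add: set_lebesgue_integral_def[of _ _ "\<lambda>x. C - ln (\<rho> x)"])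
  moreover have "0 \<le> integral\<^sup>L \<mu> ?g" using g0 by (rule integral_nonneg_AE)
  ultimately show "J = ereal (I (\<lambda>x. ln (\<rho> x)))" unfolding JH Hval by simp
qed

text \<open>The monotone limit in the form in which it is used: a bound obtained for every positive
  shift of \<rho> passes to \<rho> itself, also when \<open>J = -\<infinity>\<close>.\<close>

lemma le_J:
  assumes "\<And>k. x \<le> ereal (I (\<lambda>x. ln (\<rho> x + 1 / real (Suc k))))"
  shows "x \<le> J"
proof -
  obtain C where C: "0 \<le> C" "\<And>x. x \<in> S \<Longrightarrow> ln (\<rho> x + 1) \<le> C" using ln_\<rho>_bounded by metis
  define H where "H = (\<integral>\<^sup>+x. e2ennreal (ereal C - eln (\<rho> x)) * indicator S x \<partial>\<mu>)"
  have JH: "J = ereal C - enn2ereal H"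
    and Hsup: "(SUP k. ennreal (C - I (\<lambda>x. ln (\<rho> x + 1 / real (Suc k))))) = H"
    unfolding H_def using J_limit[OF C] by blast+
  show ?thesis
  proof (cases x)
    case (real y)
    have "H \<le> ennreal (C - y)"
      unfolding Hsup[symmetric] using assms real by (intro SUP_least ennreal_leI) simp
    \<comment> \<open>\<open>ennreal\<close> truncates negative reals to 0; the inequality y \<le> C
      shown next removes the \<open>max\<close>.\<close>
    then have "enn2ereal H \<le> ereal (max 0 (C - y))"
      by (metis enn2ereal_ennreal ennreal_eq_0_iff less_eq_ennreal.rep_eq max.absorb1 max.absorb2 max.cobounded1 linear ennreal_0)
    moreover have "y \<le> C"
    proof -
      have "y \<le> I (\<lambda>x. ln (\<rho> x + 1 / real (Suc 0)))" using assms[of 0] real by simp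
      also have "\<dots> \<le> I (\<lambda>x. C)"
      proof (rule I_mono)
        show "set_integrable \<mu> S (\<lambda>x. ln (\<rho> x + 1 / real (Suc 0)))" by (rule ln_\<rho>_e_integrable) simp
        show "set_integrable \<mu> S (\<lambda>x. C)" by (intro set_integrable_continuous continuous_intros)
      qed (use C(2) in simp)
      finally show ?thesis by simp
    qed
    ultimately have "enn2ereal H \<le> ereal (C - y)" by simp
    then show ?thesis unfolding JH real by (cases "enn2ereal H") auto
  next
    case PInf
    then show ?thesis using assms[of 0] by simp
  qed simp
qed

lemma t_entropy_eq: "t_entropy A \<mu> = J + ereal F"
proof (rule antisym)
  let ?T = "\<lambda>n. INF G\<in>partitions_of_unity. \<Sum>g\<in>G. t_term n g"
  have t: "t_entropy A \<mu> = (INF n\<in>{1::nat..}. ereal (1 / real n) * ?T n)"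
    unfolding t_entropy_def t_term_def ..
  have "t_entropy A \<mu> \<le> ereal (1 / real 1) * ?T 1" unfolding t by (rule INF_lower) simp
  then have T1: "t_entropy A \<mu> \<le> ?T 1" by (simp add: one_ereal_def[symmetric])
  \<comment> \<open>\<open>V f\<close> is real and can be moved to the left, so that the limit in
    the shift is taken with f fixed; the infimum over f comes afterwards.\<close>
  have V: "t_entropy A \<mu> - ereal (V f) \<le> J" if f: "f \<in> positive_functions" for f
  proof (rule le_J)
    fix k
    have "t_entropy A \<mu> \<le> ereal (I (\<lambda>x. ln (\<rho> x + 1 / real (Suc k))) + V f)"
      using T1 INF_t_term_le_V[OF f, of "1 / real (Suc k)"] by (auto intro: order_trans)
    then show "t_entropy A \<mu> - ereal (V f) \<le> ereal (I (\<lambda>x. ln (\<rho> x + 1 / real (Suc k))))"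
      by (cases "t_entropy A \<mu>") auto
  qed
  show "t_entropy A \<mu> \<le> J + ereal F"
  proof (rule ereal_le_epsilon2)
    fix e :: real assume e: "0 < e"
    obtain f where f: "f \<in> positive_functions" "V f < F + e" by (rule F_approx[OF e])
    have "t_entropy A \<mu> \<le> J + ereal (V f)"
      using V[OF f(1)] by (cases "t_entropy A \<mu>"; cases J) auto
    also have "\<dots> \<le> J + (ereal F + ereal e)" using f(2) by (intro add_left_mono) simp
    finally show "t_entropy A \<mu> \<le> J + ereal F + ereal e" by (simp add: add.assoc)
  qed
  show "J + ereal F \<le> t_entropy A \<mu>"
  \<comment> \<open>\<open>F\<close> is real, so for \<open>J = -\<infinity>\<close> the left side
    is -\<infinity>. Otherwise every term with a nonzero mean has a finite logarithm.\<close>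
  proof (cases "J = -\<infinity>")
    case False
    note Jr = J_real[OF False]
    show ?thesis
      unfolding t
    proof (rule INF_greatest)
      fix n :: nat assume n: "n \<in> {1..}"
      have "ereal (real n * (I (\<lambda>x. ln (\<rho> x)) + F)) \<le> ?T n"
      proof (rule INF_greatest)
        fix G assume G: "G \<in> (partitions_of_unity :: ('a \<Rightarrow> real) set set)"
        let ?G' = "{g \<in> G. integral\<^sup>L \<mu> g \<noteq> 0}"
        have finG: "finite G" and G0: "\<And>g. g \<in> G \<Longrightarrow> g \<in> CX" "\<And>g x. g \<in> G \<Longrightarrow> 0 \<le> g x"
          using G by (auto simp: partitions_of_unity_def)
        have "(\<Sum>g\<in>G. t_term n g) = (\<Sum>g\<in>?G'. t_term n g)"
          using finG by (intro sum.mono_neutral_right) (auto simp: t_term_def)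
        also have "\<dots> = (\<Sum>g\<in>?G'. ereal (integral\<^sup>L \<mu> g * ln (integral\<^sup>L \<mu> ((A ^^ n) g) / integral\<^sup>L \<mu> g)))"
        proof (rule sum.cong)
          fix g assume g: "g \<in> ?G'"
          then have m: "0 < integral\<^sup>L \<mu> g" using integral_CX_nonneg[of g] G0 by (auto simp: order_less_le)
          have "0 < integral\<^sup>L \<mu> ((A ^^ n) g)" using g m G0 by (intro integral_An_pos Jr) auto
          then have "0 < integral\<^sup>L \<mu> ((A ^^ n) g) / integral\<^sup>L \<mu> g" using m by simp
          then show "t_term n g = ereal (integral\<^sup>L \<mu> g * ln (integral\<^sup>L \<mu> ((A ^^ n) g) / integral\<^sup>L \<mu> g))"
            using m by (simp add: t_term_def eln_def not_le)
        qed simp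
        also have "\<dots> = ereal (\<Sum>g\<in>?G'. integral\<^sup>L \<mu> g * ln (integral\<^sup>L \<mu> ((A ^^ n) g) / integral\<^sup>L \<mu> g))"
          by simp
        finally show "ereal (real n * (I (\<lambda>x. ln (\<rho> x)) + F)) \<le> (\<Sum>g\<in>G. t_term n g)"
          using t_entropy_term_ge[OF Jr(1,2) G, of n] by simp
      qed
      then have "ereal (1 / real n) * ereal (real n * (I (\<lambda>x. ln (\<rho> x)) + F)) \<le> ereal (1 / real n) * ?T n"
        by (intro ereal_mult_left_mono) auto
      then show "J + ereal F \<le> ereal (1 / real n) * ?T n" using n unfolding Jr(3) by simp
    qed
  qed simp
qed

end

section \<open>The set of essential points\<close>

lemma essential_set_closed: "closed (essential_set \<alpha>)"
proof -
  have "essential_set \<alpha> = - \<Union>{V. open V \<and> \<not> (\<exists>\<mu>\<in>invariant_measures \<alpha>. measure \<mu> V > 0)}"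
    by (auto simp: essential_set_def)
  then show ?thesis by (simp add: closed_def open_Union)
qed

text \<open>The complement is covered by null open sets, possibly uncountably many. Compact subsets
  of it are null by a finite subcover, and the points at distance at least 1 / (n + 1) from the
  essential set exhaust it by countably many compact sets.\<close>

lemma AE_essential:
  fixes \<alpha> :: "'a::metric_space \<Rightarrow> 'a"
  assumes X: "compact (UNIV :: 'a set)" and \<mu>: "\<mu> \<in> invariant_measures \<alpha>"
  shows "AE x in \<mu>. x \<in> essential_set \<alpha>"
proof -
  let ?S = "essential_set \<alpha>"
  have sets: "sets \<mu> = sets borel" and prob: "prob_space \<mu>" using \<mu> by (auto simp: invariant_measures_def)
  interpret prob_space \<mu> by fact
  have null_compact: "K \<in> null_sets \<mu>" if K: "compact K" "K \<inter> ?S = {}" for K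
  proof -
    have "\<exists>V. open V \<and> x \<in> V \<and> V \<in> null_sets \<mu>" if x: "x \<in> K" for x
    proof -
      have "x \<notin> ?S" using x K by auto
      then obtain V where V: "open V" "x \<in> V" "\<not> (\<exists>\<mu>\<in>invariant_measures \<alpha>. measure \<mu> V > 0)"
        by (auto simp: essential_set_def)
      then have "measure \<mu> V = 0" using \<mu> by (auto simp: zero_less_measure_iff)
      moreover have "V \<in> sets \<mu>" using V sets by simp
      ultimately show ?thesis using V by (auto simp: null_sets_def emeasure_eq_measure)
    qed
    then obtain V where V: "\<And>x. x \<in> K \<Longrightarrow> open (V x) \<and> x \<in> V x \<and> V x \<in> null_sets \<mu>" by metis
    obtain C where C: "C \<subseteq> K" "finite C" "K \<subseteq> (\<Union>x\<in>C. V x)"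
      by (rule compactE_image[OF K(1), of K V]) (use V in auto)
    have "(\<Union>x\<in>C. V x) \<in> null_sets \<mu>" using C V by (intro null_sets.finite_UN) auto
    then show ?thesis
      using C(3) borel_compact[OF K(1)] sets by (auto intro: null_sets_subset)
  qed
  \<comment> \<open>An empty essential set is treated apart because \<open>infdist\<close> to it is
    0.\<close>
  define K where "K n = {x. ?S = {} \<or> 1 / real (Suc n) \<le> infdist x ?S}" for n
  have "closed (K n)" for n
    unfolding K_def by (cases "?S = {}") (auto intro!: closed_Collect_le continuous_intros)
  then have "compact (K n)" for n using compact_Int_closed[OF X] by simp
  moreover have "K n \<inter> ?S = {}" for n by (auto simp: K_def field_simps)
  ultimately have null: "(\<Union>n. K n) \<in> null_sets \<mu>" using null_compact by (intro null_sets_UN) auto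
  have "{x \<in> space \<mu>. x \<notin> ?S} \<subseteq> (\<Union>n. K n)"
  proof
    fix x assume "x \<in> {x \<in> space \<mu>. x \<notin> ?S}"
    then have x: "x \<notin> ?S" by simp
    show "x \<in> (\<Union>n. K n)"
    proof (cases "?S = {}")
      case False
      then have "0 < infdist x ?S" using x essential_set_closed by (intro infdist_pos_not_in_closed)
      then obtain n where "1 / real (Suc n) < infdist x ?S" using nat_approx_posE by blast
      then show ?thesis by (auto simp: K_def intro: less_imp_le)
    qed (simp add: K_def)
  qed
  then show ?thesis using null by (rule AE_I'[rotated])
qed

text \<open>Preimages of neighbourhoods have the same measure, which gives one inclusion. For the
  other, an essential point outside the compact image would yield an invariant measure charging the
  complement of that image; the preimage of this complement misses the essential set and is null,
  against invariance.\<close>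

lemma essential_image:
  fixes \<alpha> :: "'a::metric_space \<Rightarrow> 'a"
  assumes X: "compact (UNIV :: 'a set)" and \<alpha>: "continuous_on UNIV \<alpha>"
  shows "\<alpha> ` essential_set \<alpha> = essential_set \<alpha>"
proof
  let ?S = "essential_set \<alpha>"
  have \<alpha>m: "\<alpha> \<in> borel \<rightarrow>\<^sub>M borel" using \<alpha> by (rule borel_measurable_continuous_onI)
  have inv: "measure \<mu> (\<alpha> -` V) = measure \<mu> V" if \<mu>: "\<mu> \<in> invariant_measures \<alpha>" and V: "open V" for \<mu> V
  proof -
    have s: "sets \<mu> = sets borel" and d: "distr \<mu> borel \<alpha> = \<mu>" using \<mu> by (auto simp: invariant_measures_def)
    have "measure (distr \<mu> borel \<alpha>) V = measure \<mu> (\<alpha> -` V \<inter> space \<mu>)"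
      using \<alpha>m V by (intro measure_distr) (simp_all add: measurable_cong_sets[OF s refl])
    then show ?thesis using d sets_eq_imp_space_eq[OF s] by simp
  qed
  show "\<alpha> ` ?S \<subseteq> ?S"
  proof safe
    fix x assume x: "x \<in> ?S"
    show "\<alpha> x \<in> ?S"
      unfolding essential_set_def
    proof safe
      fix V assume V: "open V" "\<alpha> x \<in> V"
      have "open (\<alpha> -` V)" using \<alpha> V(1) by (simp add: open_vimage)
      then obtain \<mu> where "\<mu> \<in> invariant_measures \<alpha>" "measure \<mu> (\<alpha> -` V) > 0"
        using x V by (auto simp: essential_set_def)
      then show "\<exists>\<mu>\<in>invariant_measures \<alpha>. measure \<mu> V > 0" using inv V by auto
    qed
  qed
  show "?S \<subseteq> \<alpha> ` ?S"
  proof (rule ccontr)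
    assume "\<not> ?S \<subseteq> \<alpha> ` ?S"
    then obtain x where x: "x \<in> ?S" "x \<notin> \<alpha> ` ?S" by auto
    have "compact ?S" using compact_Int_closed[OF X essential_set_closed] by simp
    then have "compact (\<alpha> ` ?S)" using \<alpha> by (intro compact_continuous_image) (auto intro: continuous_on_subset)
    then have op: "open (- \<alpha> ` ?S)" by (simp add: compact_imp_closed open_Compl)
    then obtain \<mu> where \<mu>: "\<mu> \<in> invariant_measures \<alpha>" "measure \<mu> (- \<alpha> ` ?S) > 0"
      using x by (auto simp: essential_set_def)
    have s: "sets \<mu> = sets borel" and "prob_space \<mu>" using \<mu> by (auto simp: invariant_measures_def)
    then interpret prob_space \<mu> by simp
    have "open (\<alpha> -` (- \<alpha> ` ?S))" using \<alpha> op by (rule open_vimage[rotated])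
    then have "\<alpha> -` (- \<alpha> ` ?S) \<in> sets \<mu>" using s by simp
    moreover have "AE y in \<mu>. y \<notin> \<alpha> -` (- \<alpha> ` ?S)"
      using AE_essential[OF X \<mu>(1)] by (rule eventually_mono) auto
    ultimately have "measure \<mu> (\<alpha> -` (- \<alpha> ` ?S)) = 0" by (simp add: prob_eq_0)
    then show False using inv[OF \<mu>(1) op] \<mu>(2) by simp
  qed
qed

section \<open>Upper semicontinuity of the entropy and conclusion\<close>

lemma (in supported_measure) V_integral:
  assumes f: "f \<in> positive_functions" and \<psi>: "\<psi> \<in> CX" "\<And>x. x \<in> S \<Longrightarrow> \<psi> x = ln (L f x) - ln (f x)"
  shows "integral\<^sup>L \<mu> \<psi> = V f"
proof -
  have "integral\<^sup>L \<mu> \<psi> = I \<psi>"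
    using \<psi>(1) by (intro I_integral) (auto simp: CX_def intro: borel_measurable_continuous_onI)
  also have "\<dots> = I (\<lambda>x. ln (L f x) - ln (f x))"
    unfolding set_lebesgue_integral_def using \<psi>(2)
    by (intro Bochner_Integration.integral_cong) (auto simp: indicator_def)
  also have "\<dots> = V f"
    unfolding V_def by (intro set_integral_diff integrable_ln positive_L f)
  finally show ?thesis .
qed

lemma usc_entropy_eq:
  fixes \<alpha> :: "'a::metric_space \<Rightarrow> 'a"
  assumes sup: "\<And>\<nu>. \<nu> \<in> invariant_measures \<alpha> \<Longrightarrow> supported_measure \<alpha> S r N \<nu>"
    and \<mu>: "\<mu> \<in> invariant_measures \<alpha>"
  shows "usc_entropy \<alpha> \<mu> = KS_entropy \<alpha> \<mu>"
proof (rule antisym)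
  interpret M: supported_measure \<alpha> S r N \<mu> using sup \<mu> by simp
  show "KS_entropy \<alpha> \<mu> \<le> usc_entropy \<alpha> \<mu>"
    unfolding usc_entropy_def by (intro INF_greatest SUP_upper) auto
  show "usc_entropy \<alpha> \<mu> \<le> KS_entropy \<alpha> \<mu>"
    unfolding M.KS_eq_F
  proof (rule ereal_le_epsilon2)
    fix e :: real assume e: "0 < e"
    obtain f where f: "f \<in> M.positive_functions" "M.V f < M.F + e" by (rule M.F_approx[OF e])
    have cont: "continuous_on S (\<lambda>x. ln (M.L f x) - ln (f x))"
      by (intro continuous_on_diff M.continuous_ln M.positive_L f)
    obtain \<psi> where \<psi>: "\<psi> \<in> CX" "\<And>x. x \<in> S \<Longrightarrow> \<psi> x = ln (M.L f x) - ln (f x)"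
      using Tietze_CX[OF M.S_closed cont] by metis
    \<comment> \<open>\<open>\<psi>\<close> extends \<open>ln (L f) - ln f\<close> to X and does not
      depend on the measure, so \<open>V f\<close> is the evaluation of the measure at a function of
      \<open>CX\<close>, and U is a weak-* neighbourhood of \<mu>.\<close>
    define U where "U = {\<nu> \<in> invariant_measures \<alpha>. integral\<^sup>L \<nu> \<psi> < M.F + e}"
    have "openin (weak_star \<alpha>) U"
      unfolding weak_star_def openin_pullback_topology
    proof (intro exI conjI)
      show "openin (powertop_real CX) {h \<in> topspace (powertop_real CX). h \<psi> \<in> {..<M.F + e}}"
        by (rule openin_continuous_map_preimage[OF continuous_map_product_projection[OF \<psi>(1)]]) simp
      show "U = (\<lambda>\<mu>. \<lambda>f\<in>CX. integral\<^sup>L \<mu> f) -` {h \<in> topspace (powertop_real CX). h \<psi> \<in> {..<M.F + e}} \<inter> invariant_measures \<alpha>"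
        using \<psi>(1) by (auto simp: U_def)
    qed
    moreover have "\<mu> \<in> U" using \<mu> f(2) M.V_integral[OF f(1) \<psi>] by (simp add: U_def)
    ultimately have "usc_entropy \<alpha> \<mu> \<le> (SUP \<nu>\<in>U. KS_entropy \<alpha> \<nu>)"
      unfolding usc_entropy_def by (intro INF_lower) auto
    also have "\<dots> \<le> ereal (M.F + e)"
    proof (rule SUP_least)
      fix \<nu> assume \<nu>: "\<nu> \<in> U"
      interpret N: supported_measure \<alpha> S r N \<nu> using sup \<nu> by (simp add: U_def)
      \<comment> \<open>\<open>positive_functions\<close> and \<open>L\<close> depend on \<alpha>
        and S only, so the f chosen for \<mu> is admissible for \<nu>; this is where the entropy is
        bounded on the whole neighbourhood.\<close>
      have "KS_entropy \<alpha> \<nu> \<le> ereal (N.V f)" by (rule N.KS_le_V[OF f(1)])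
      also have "\<dots> = ereal (integral\<^sup>L \<nu> \<psi>)" using N.V_integral[OF f(1) \<psi>] by simp
      also have "\<dots> \<le> ereal (M.F + e)" using \<nu> by (simp add: U_def)
      finally show "KS_entropy \<alpha> \<nu> \<le> ereal (M.F + e)" .
    qed
    finally show "usc_entropy \<alpha> \<mu> \<le> ereal M.F + ereal e" by simp
  qed
qed

theorem theorem35:
  fixes \<alpha> :: "'a::metric_space \<Rightarrow> 'a"
    and A :: "('a \<Rightarrow> real) \<Rightarrow> ('a \<Rightarrow> real)"
    and \<mu> :: "'a measure"
  assumes "compact (UNIV :: 'a set)"
    and "continuous_on UNIV \<alpha>"
    and "open_map (top_of_set (essential_set \<alpha>)) (top_of_set (essential_set \<alpha>)) \<alpha>"
    and "non_contracting_on (essential_set \<alpha>) \<alpha>"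
    and "finite_sheeted_on (essential_set \<alpha>) \<alpha>"
    and "transfer_operator \<alpha> A"
    and "compatible_on (essential_set \<alpha>) A"
    and "\<mu> \<in> invariant_measures \<alpha>"
  shows "t_entropy A \<mu> =
    set_ereal_integral \<mu> (essential_set \<alpha>) (\<lambda>x. eln (cocycle \<alpha> A x)) + usc_entropy \<alpha> \<mu>"
proof -
  let ?S = "essential_set \<alpha>"
  obtain r where r: "0 < r" "\<And>x y. x \<in> ?S \<Longrightarrow> y \<in> ?S \<Longrightarrow> dist x y \<le> r \<Longrightarrow> dist x y \<le> dist (\<alpha> x) (\<alpha> y)"
    using assms(4) unfolding non_contracting_on_def by blast
  obtain N where N: "\<And>x. x \<in> ?S \<Longrightarrow> finite (\<alpha> -` {x} \<inter> ?S) \<and> card (\<alpha> -` {x} \<inter> ?S) \<le> N"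
    using assms(5) unfolding finite_sheeted_on_def by blast
  have cover: "noncontracting_cover \<alpha> ?S r N"
    by (rule noncontracting_cover.intro[OF assms(1,2) essential_set_closed essential_image[OF assms(1,2)] assms(3) r N])
  have sup: "supported_measure \<alpha> ?S r N \<nu>" if "\<nu> \<in> invariant_measures \<alpha>" for \<nu>
  proof (intro supported_measure.intro supported_measure_axioms.intro cover)
    show "AE x in \<nu>. x \<in> ?S" by (rule AE_essential[OF assms(1) that])
  qed (use that in \<open>auto simp: invariant_measures_def\<close>)
  have "transfer_cover \<alpha> ?S r N A"
    using cover assms(6,7) by (intro transfer_cover.intro transfer_cover_axioms.intro)
  then interpret transfer_measure \<alpha> ?S r N A \<mu>
    using sup[OF assms(8)] by (intro transfer_measure.intro)
  show ?thesis
    using t_entropy_eq KS_eq_F usc_entropy_eq[OF sup assms(8)] by simp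
qed

end
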